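(* For $n\ge 1$ let $Z_3(n)$ be the number of equivalence classes of triples $(\sigma_1,\sigma_2,\sigma_3)\in S_n\times S_n\times S_n$ under $(\sigma_1,\sigma_2,\sigma_3)\sim(\gamma_1\sigma_1\gamma_2,\gamma_1\sigma_2\gamma_2,\gamma_1\sigma_3\gamma_2)$, $\gamma_1,\gamma_2\in S_n$, and let $Z_3(0)=1$; for $n\ge1$ this is the number of (possibly disconnected) rank $3$ colored tensor invariants built from $n$ copies of $\Phi$ and $n$ copies of $\bar\Phi$. Put $Z_3(x)=\sum_{n=0}^{\infty}Z_3(n)x^n$ and define its plethystic logarithm by $$\mathrm{Plog}[Z_3(x)]=\sum_{k=1}^{\infty}\frac{\mu(k)}{k}\log\big(Z_3(x^k)\big),$$ where $\mu$ is the Möbius function ($\mu(1)=1$, $\mu(k)=0$ if $k$ has repeated prime factors, $\mu(k)=(-1)^m$ if $k$ is a product of $m$ distinct primes). Then the coefficient of $x^n$ in $\mathrm{Plog}[Z_3(x)]$ is the number of connected invariants, i.e. of connected $3$-colored bipartite graphs with $n$ black vertices (corresponding to $\bar\Phi$) and $n$ white vertices (corresponding to $\Phi$). The expansion begins $$\mathrm{Plog}[Z_3(x)]=x+3x^2+7x^3+26x^4+97x^5+624x^6+4163x^7+\cdots.$$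
   Context: $S_n$ is the symmetric group on $\{1,\dots,n\}$. $\Phi_{i_1i_2i_3}$ is a complex rank $3$ tensor with no symmetry assumed among its indices, $\bar\Phi$ is its complex conjugate, and a unitary group acts independently on each index. The dimension $N$ of each index space is assumed larger than $n$. Invariants are obtained by contracting the $a$-th index of each $\Phi$ with the $a$-th index of some $\bar\Phi$, for each color $a\in\{1,2,3\}$; the contraction pattern of color $a$ among $n$ copies of $\Phi$ and $n$ copies of $\bar\Phi$ is a permutation $\sigma_a\in S_n$, and the equivalence by $\gamma_1,\gamma_2$ expresses relabelling of the copies of $\Phi$ and of $\bar\Phi$. The associated $3$-colored bipartite graph has a white vertex for each $\Phi$, a black vertex for each $\bar\Phi$, and an edge of color $a$ for each contraction of a color-$a$ index; graphs are counted up to relabelling of the white vertices and of the black vertices (colors being kept fixed). An invariant is called connected if its graph is connected. *)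

theory Defs
  imports
    Complex_Main
    "HOL-Library.FuncSet"
    "HOL-Combinatorics.Permutations"
    "HOL-Computational_Algebra.Formal_Power_Series"
    "HOL-Computational_Algebra.Squarefree"
    "Graph_Theory.Digraph_Component"
begin

type_synonym perm_triple = "(nat \<Rightarrow> nat) \<times> (nat \<Rightarrow> nat) \<times> (nat \<Rightarrow> nat)"

definition sym_group :: "nat \<Rightarrow> (nat \<Rightarrow> nat) set" where
  "sym_group n = {\<sigma>. \<sigma> permutes {1..n}}"

definition perm_triples :: "nat \<Rightarrow> perm_triple set" where
  "perm_triples n = sym_group n \<times> sym_group n \<times> sym_group n"

definition triple_equiv :: "nat \<Rightarrow> (perm_triple \<times> perm_triple) set" where
  "triple_equiv n =
     {((\<sigma>1, \<sigma>2, \<sigma>3), (\<tau>1, \<tau>2, \<tau>3)).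
        (\<sigma>1, \<sigma>2, \<sigma>3) \<in> perm_triples n \<and>
        (\<exists>\<gamma>1 \<in> sym_group n. \<exists>\<gamma>2 \<in> sym_group n.
           \<tau>1 = \<gamma>1 \<circ> \<sigma>1 \<circ> \<gamma>2 \<and> \<tau>2 = \<gamma>1 \<circ> \<sigma>2 \<circ> \<gamma>2 \<and> \<tau>3 = \<gamma>1 \<circ> \<sigma>3 \<circ> \<gamma>2)}"

definition Z3 :: "nat \<Rightarrow> nat" where
  "Z3 n = (if n = 0 then 1 else card (perm_triples n // triple_equiv n))"

(* Only the entries with all three indices in {1..N} matter in dimension N. *)
type_synonym tensor3 = "nat \<Rightarrow> nat \<Rightarrow> nat \<Rightarrow> complex"

(* The a-th index of the j-th copy of the conjugate tensor is contracted with
   the a-th index of the \<sigma>a(j)-th copy of the tensor; i1 j, i2 j, i3 j are the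
   indices of the j-th copy of the tensor. *)
definition tensor_invariant :: "nat \<Rightarrow> nat \<Rightarrow> perm_triple \<Rightarrow> tensor3 \<Rightarrow> complex" where
  "tensor_invariant N n = (\<lambda>(\<sigma>1, \<sigma>2, \<sigma>3) \<Phi>.
     \<Sum>i1 \<in> {1..n} \<rightarrow>\<^sub>E {1..N}. \<Sum>i2 \<in> {1..n} \<rightarrow>\<^sub>E {1..N}. \<Sum>i3 \<in> {1..n} \<rightarrow>\<^sub>E {1..N}.
       (\<Prod>j\<in>{1..n}. \<Phi> (i1 j) (i2 j) (i3 j)) *
       (\<Prod>j\<in>{1..n}. cnj (\<Phi> (i1 (\<sigma>1 j)) (i2 (\<sigma>2 j)) (i3 (\<sigma>3 j)))))"

definition invariants :: "nat \<Rightarrow> nat \<Rightarrow> (tensor3 \<Rightarrow> complex) set" where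
  "invariants N n = tensor_invariant N n ` perm_triples n"

(* A 3-colored bipartite graph on white vertices {1..n} and black vertices {1..n}
   is given by its set of edges (color, white end, black end). *)
type_synonym colored_edge = "nat \<times> nat \<times> nat"

definition colored_graphs :: "nat \<Rightarrow> colored_edge set set" where
  "colored_graphs n =
     {E. E \<subseteq> {1..3} \<times> {1..n} \<times> {1..n} \<and>
         (\<forall>a\<in>{1..3}. \<forall>w\<in>{1..n}. \<exists>!b. (a, w, b) \<in> E) \<and>
         (\<forall>a\<in>{1..3}. \<forall>b\<in>{1..n}. \<exists>!w. (a, w, b) \<in> E)}"

definition graph_relabelling :: "nat \<Rightarrow> (colored_edge set \<times> colored_edge set) set" where
  "graph_relabelling n =
     {(E, E'). E \<in> colored_graphs n \<and>
        (\<exists>\<alpha> \<in> sym_group n. \<exists>\<beta> \<in> sym_group n. E' = (\<lambda>(a, w, b). (a, \<alpha> w, \<beta> b)) ` E)}"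

datatype vertex = White nat | Black nat

(* Arcs point from white to black only to fit the record type; connectedness below
   is that of the underlying undirected graph, and it excludes the empty graph. *)
definition to_digraph :: "nat \<Rightarrow> colored_edge set \<Rightarrow> (vertex, colored_edge) pre_digraph" where
  "to_digraph n E =
     \<lparr>verts = White ` {1..n} \<union> Black ` {1..n}, arcs = E,
      tail = (\<lambda>(a, w, b). White w), head = (\<lambda>(a, w, b). Black b)\<rparr>"

definition graph_connected :: "nat \<Rightarrow> colored_edge set \<Rightarrow> bool" where
  "graph_connected n E \<longleftrightarrow> Digraph_Component.connected (to_digraph n E)"

definition triple_graph :: "nat \<Rightarrow> perm_triple \<Rightarrow> colored_edge set" where
  "triple_graph n = (\<lambda>(\<sigma>1, \<sigma>2, \<sigma>3).
     (\<Union>j\<in>{1..n}. {(1, \<sigma>1 j, j), (2, \<sigma>2 j, j), (3, \<sigma>3 j, j)}))"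

definition connected_invariants :: "nat \<Rightarrow> nat \<Rightarrow> (tensor3 \<Rightarrow> complex) set" where
  "connected_invariants N n =
     tensor_invariant N n ` {s \<in> perm_triples n. graph_connected n (triple_graph n s)}"

definition num_connected_graphs :: "nat \<Rightarrow> nat" where
  "num_connected_graphs n =
     card ({E \<in> colored_graphs n. graph_connected n E} // graph_relabelling n)"

definition moebius :: "nat \<Rightarrow> int" where
  "moebius k = (if squarefree k then (-1) ^ card (prime_factors k) else 0)"

(* The logarithm of a series with constant coefficient 1;
   fps_ln 1 is the expansion of log (1 + x). *)
definition fps_log :: "'a::field_char_0 fps \<Rightarrow> 'a fps" where
  "fps_log f = fps_ln 1 oo (f - 1)"

(* The infinite sum converges in the usual topology on formal power series. *)
definition Plog :: "'a::field_char_0 fps \<Rightarrow> 'a fps" where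
  "Plog f = (\<Sum>m. let k = Suc m in
     fps_const (of_int (moebius k) / of_nat k) * fps_log (f oo fps_X ^ k))"

definition Z3_series :: "rat fps" where
  "Z3_series = Abs_fps (\<lambda>n. of_nat (Z3 n))"

end

theory Submission
  imports Defs "HOL-Library.Multiset" "HOL-Library.Disjoint_Sets" "HOL-Computational_Algebra.Polynomial"
begin

text \<open>
  Edges of colour 1 identify white with black vertices, so a triple up to equivalence is the pair
  \<open>(\<sigma>2 \<circ> inv \<sigma>1, \<sigma>3 \<circ> inv \<sigma>1)\<close> up to simultaneous conjugation, that is, an isomorphism type of a
  finite set with two permutations, and the graph is connected iff the pair acts transitively.
  An isomorphism type is determined by the multiset of the types of its orbits, and every
  multiset of transitive types occurs. Counting these multisets weighted by their size gives
  \<open>n * Z n = (\<Sum>k=1..n. (\<Sum>d | d dvd k. d * c d) * Z (n - k))\<close> for the numbers \<open>c d\<close> of transitive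
  types. This says that \<open>\<Sum>d | d dvd k. d * c d\<close> are the coefficients of \<open>x Z'(x) / Z(x)\<close>, and
  Moebius inversion identifies the coefficients of the plethystic logarithm with \<open>c\<close>.

  A tensor invariant determines the type: for \<open>\<Phi> v = z ^ (M ^ e v)\<close> with \<open>e\<close> injective and \<open>M\<close> large it
  becomes a polynomial in \<open>z\<close> and its conjugate whose exponents encode the multisets of indices.

  For the numerical values, Burnside's lemma expresses \<open>Z n\<close> as the sum of the orders of the
  centralizers over the conjugacy classes of the symmetric group, and removing one cycle at a
  time yields these orders.
\<close>


section \<open>Systems of permutations, isomorphism and orbits\<close>

text \<open>The index type stays arbitrary because the theory is used twice: with
  \<open>bool\<close> for the pairs attached to triples, and with \<open>unit\<close> for single
  permutations, whose isomorphism types are the cycle types that enter the evaluation. Carriers are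
  arbitrary finite sets, since orbits, complements of orbits and disjoint unions must all be systems
  of the same kind. Transitivity is compared with connectedness through closed subsets rather than
  paths: closed vertex sets of the graph and closed subsets for the pair determine each other
  directly. The recursion for \<open>n * Z n\<close> is the logarithmic derivative of the usual
  infinite product, read off coefficient by coefficient, so that only finite sums occur. Burnside's
  lemma first yields squares of centralizer orders, summed over all permutations. A conjugacy class
  has \<open>n!\<close> divided by the centralizer order many members, so one factor cancels and a
  single order remains for each partition. In the test tensors, \<open>n \<le> N\<close> lets the
  copies carry pairwise different index values; this is how the whole contraction pattern is
  remembered.\<close>

definition perm_family :: "'a set \<Rightarrow> ('i \<Rightarrow> 'a \<Rightarrow> 'a) \<Rightarrow> bool" where
  "perm_family X F \<longleftrightarrow> finite X \<and> (\<forall>i. bij_betw (F i) X X)"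

definition iso_map :: "('a \<Rightarrow> 'b) \<Rightarrow> 'a set \<Rightarrow> ('i \<Rightarrow> 'a \<Rightarrow> 'a) \<Rightarrow> 'b set \<Rightarrow> ('i \<Rightarrow> 'b \<Rightarrow> 'b) \<Rightarrow> bool" where
  "iso_map f X F Y G \<longleftrightarrow> bij_betw f X Y \<and> (\<forall>i. \<forall>x\<in>X. f (F i x) = G i (f x))"

definition isom :: "'a set \<Rightarrow> ('i \<Rightarrow> 'a \<Rightarrow> 'a) \<Rightarrow> 'b set \<Rightarrow> ('i \<Rightarrow> 'b \<Rightarrow> 'b) \<Rightarrow> bool" where
  "isom X F Y G \<longleftrightarrow> (\<exists>f. iso_map f X F Y G)"

text \<open>Both directions are included so that reachability is symmetric by construction, whatever
  \<open>F\<close> is.\<close>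

definition step :: "'a set \<Rightarrow> ('i \<Rightarrow> 'a \<Rightarrow> 'a) \<Rightarrow> ('a \<times> 'a) set" where
  "step X F = {(x, y). x \<in> X \<and> y \<in> X \<and> (\<exists>i. y = F i x \<or> x = F i y)}"

text \<open>The reflexive closure lives on the whole type; cutting it down to
  \<open>X \<times> X\<close> gives an equivalence on \<open>X\<close>, as the quotient
  requires.\<close>

definition reach :: "'a set \<Rightarrow> ('i \<Rightarrow> 'a \<Rightarrow> 'a) \<Rightarrow> ('a \<times> 'a) set" where
  "reach X F = (step X F)\<^sup>* \<inter> X \<times> X"

definition orbits :: "'a set \<Rightarrow> ('i \<Rightarrow> 'a \<Rightarrow> 'a) \<Rightarrow> 'a set set" where
  "orbits X F = X // reach X F"

text \<open>The empty system is excluded, like the empty graph. A transitive type of size 0 could be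
  repeated in a multiset without changing the total size and would spoil the count.\<close>

definition transitive :: "'a set \<Rightarrow> ('i \<Rightarrow> 'a \<Rightarrow> 'a) \<Rightarrow> bool" where
  "transitive X F \<longleftrightarrow> X \<noteq> {} \<and> reach X F = X \<times> X"

lemma perm_familyD: "perm_family X F \<Longrightarrow> finite X" "perm_family X F \<Longrightarrow> bij_betw (F i) X X"
  "perm_family X F \<Longrightarrow> x \<in> X \<Longrightarrow> F i x \<in> X"
  by (auto simp: perm_family_def intro: bij_betw_apply)

lemma perm_family_subset:
  assumes "perm_family X F" "C \<subseteq> X" "\<And>i x. x \<in> C \<Longrightarrow> F i x \<in> C"
  shows "perm_family C F"
proof -
  have fin: "finite C" by (rule finite_subset[OF assms(2) perm_familyD(1)[OF assms(1)]])
  moreover have "bij_betw (F i) C C" for i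
  proof -
    have "inj_on (F i) C"
      by (rule inj_on_subset[OF bij_betw_imp_inj_on[OF perm_familyD(2)[OF assms(1), of i]] assms(2)])
    moreover have "F i ` C \<subseteq> C" using assms(3) by auto
    ultimately show ?thesis using fin by (simp add: bij_betw_def endo_inj_surj)
  qed
  ultimately show ?thesis by (simp add: perm_family_def)
qed

section \<open>Isomorphisms of systems\<close>

lemma iso_map_inv:
  assumes "iso_map f X F Y G" "perm_family X F"
  shows "iso_map (inv_into X f) Y G X F"
proof -
  have b: "bij_betw f X Y" using assms by (simp add: iso_map_def)
  have "inv_into X f (G i y) = F i (inv_into X f y)" if "y \<in> Y" for i y
  proof -
    obtain x where x: "x \<in> X" "y = f x" using \<open>y \<in> Y\<close> b by (blast dest: bij_betw_imp_surj_on)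
    have "G i y = f (F i x)" using assms x by (simp add: iso_map_def)
    moreover have "F i x \<in> X" by (rule perm_familyD(3)[OF assms(2) x(1)])
    ultimately show ?thesis using x b by (simp add: bij_betw_def)
  qed
  then show ?thesis using b by (simp add: iso_map_def bij_betw_inv_into)
qed

lemma iso_map_comp:
  assumes "iso_map f X F Y G" "iso_map g Y G Z H"
  shows "iso_map (g \<circ> f) X F Z H"
proof -
  have "bij_betw (g \<circ> f) X Z" using assms unfolding iso_map_def by (blast intro: bij_betw_trans)
  moreover have "f x \<in> Y" if "x \<in> X" for x using assms(1) that by (auto simp: iso_map_def intro: bij_betw_apply)
  ultimately show ?thesis using assms by (simp add: iso_map_def)
qed

lemma isom_sym: "isom X F Y G \<Longrightarrow> perm_family X F \<Longrightarrow> isom Y G X F"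
  using iso_map_inv unfolding isom_def by blast

lemma isom_trans: "isom X F Y G \<Longrightarrow> isom Y G Z H \<Longrightarrow> isom X F Z H"
  unfolding isom_def using iso_map_comp by blast

lemma isom_card: "isom X F Y G \<Longrightarrow> card X = card Y"
  by (auto simp: isom_def iso_map_def dest: bij_betw_same_card)

lemma perm_family_iso_map:
  assumes "perm_family X F" "iso_map f X F Y G"
  shows "perm_family Y G"
proof -
  have b: "bij_betw f X Y" using assms by (simp add: iso_map_def)
  then have "finite Y" using perm_familyD(1)[OF assms(1)] bij_betw_finite[OF b] by simp
  moreover have "bij_betw (G i) Y Y" for i
  proof -
    have "G i ` Y = Y"
    proof -
      have "G i ` Y = (G i \<circ> f) ` X" using b by (auto simp: bij_betw_def)
      also have "\<dots> = (f \<circ> F i) ` X" using assms(2) by (auto simp: iso_map_def image_iff)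
      also have "\<dots> = f ` X" unfolding image_comp[symmetric] by (simp add: bij_betw_imp_surj_on[OF perm_familyD(2)[OF assms(1)]])
      finally show ?thesis using b by (auto simp: bij_betw_def)
    qed
    then show ?thesis using \<open>finite Y\<close> by (simp add: bij_betw_def finite_surj_inj)
  qed
  ultimately show ?thesis by (simp add: perm_family_def)
qed

section \<open>Orbits and transitivity\<close>

lemma sym_step: "sym (step X F)"
  by (auto simp: step_def sym_def)

lemma equiv_reach: "equiv X (reach X F)"
proof (rule equivI)
  show "reach X F \<subseteq> X \<times> X" by (auto simp: reach_def)
  show "refl_on X (reach X F)" by (auto simp: reach_def refl_on_def)
  show "sym (reach X F)" using sym_rtrancl[OF sym_step, of X F] by (auto simp: reach_def sym_def)
  show "trans (reach X F)" by (auto simp: reach_def trans_def)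
qed

lemma orbits_disjoint: "C \<in> orbits X F \<Longrightarrow> D \<in> orbits X F \<Longrightarrow> C = D \<or> C \<inter> D = {}"
  unfolding orbits_def by (rule quotient_disj[OF equiv_reach])

lemma Union_orbits: "\<Union>(orbits X F) = X"
  unfolding orbits_def by (rule Union_quotient[OF equiv_reach])

lemma orbits_subset: "C \<in> orbits X F \<Longrightarrow> C \<subseteq> X"
  using Union_orbits[of X F] by auto

lemma orbits_nonempty: "C \<in> orbits X F \<Longrightarrow> C \<noteq> {}"
  unfolding orbits_def by (rule in_quotient_imp_non_empty[OF equiv_reach])

lemma finite_orbits: "finite X \<Longrightarrow> finite (orbits X F)"
  using finite_UnionD[of "orbits X F"] Union_orbits[of X F] by simp

lemma orbits_closed: "perm_family X F \<Longrightarrow> C \<in> orbits X F \<Longrightarrow> x \<in> C \<Longrightarrow> F i x \<in> C"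
proof -
  assume a: "perm_family X F" "C \<in> orbits X F" "x \<in> C"
  have "x \<in> X" using a(3) orbits_subset[OF a(2)] by auto
  then have "(x, F i x) \<in> reach X F" using perm_familyD(3)[OF a(1)] by (auto simp: reach_def step_def)
  then show ?thesis using a(2,3) in_quotient_imp_closed[OF equiv_reach, of C X F x "F i x"] unfolding orbits_def by blast
qed

lemma orbits_closed_rev:
  assumes "perm_family X F" "C \<in> orbits X F" "x \<in> X" "F i x \<in> C" shows "x \<in> C"
proof -
  obtain D where D: "D \<in> orbits X F" "x \<in> D" using assms(3) Union_orbits[of X F] by auto
  then show ?thesis using orbits_closed[OF assms(1) D, of i] orbits_disjoint[OF D(1) assms(2)] assms(4) by auto
qed

lemma perm_family_orbit: "perm_family X F \<Longrightarrow> C \<in> orbits X F \<Longrightarrow> perm_family C F"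
  by (rule perm_family_subset[OF _ orbits_subset orbits_closed])

lemma transitive_orbit: assumes "perm_family X F" "C \<in> orbits X F" shows "transitive C F"
proof -
  \<comment> \<open>A path that starts in \<open>C\<close> never leaves it, so it is also a path for
    the system restricted to \<open>C\<close>.\<close>
  have "(x, y) \<in> (step C F)\<^sup>* \<and> y \<in> C" if "(x, y) \<in> (step X F)\<^sup>*" "x \<in> C" for x y
    using that
  proof (induction rule: rtrancl_induct)
    case (step y z)
    then have y: "y \<in> C" "(x, y) \<in> (step C F)\<^sup>*" by auto
    obtain i where "y \<in> X" "z \<in> X" "z = F i y \<or> y = F i z" using step(2) by (auto simp: step_def)
    then have "z \<in> C"
      using y(1) orbits_closed[OF assms y(1), of i] orbits_closed_rev[OF assms, of z i] by auto
    then have "(y, z) \<in> step C F" using step(2) y by (auto simp: step_def)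
    then show ?case using y \<open>z \<in> C\<close> by auto
  qed auto
  moreover have "(x, y) \<in> (step X F)\<^sup>*" if "x \<in> C" "y \<in> C" for x y
    using in_quotient_imp_in_rel[OF equiv_reach, of C X F x y] assms(2) that
    unfolding orbits_def by (auto simp: reach_def)
  ultimately have "reach C F = C \<times> C" unfolding reach_def by blast
  then show ?thesis using orbits_nonempty[OF assms(2)] by (simp add: transitive_def)
qed

lemma transitive_closed_subset:
  assumes "transitive X F" "S \<subseteq> X" "S \<noteq> {}" "\<And>i x. x \<in> X \<Longrightarrow> F i x \<in> X \<Longrightarrow> x \<in> S \<longleftrightarrow> F i x \<in> S"
  shows "S = X"
proof -
  obtain x where x: "x \<in> S" using assms(3) by auto
  have "y \<in> S" if "y \<in> X" for y
  proof -
    have "(x, y) \<in> (step X F)\<^sup>*" using assms(1,2) x that by (auto simp: transitive_def reach_def)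
    then show ?thesis
    proof (induction rule: rtrancl_induct)
      case (step y z)
      then obtain i where "y \<in> X" "z \<in> X" "z = F i y \<or> y = F i z" by (auto simp: step_def)
      then show ?case using assms(4)[of y i] assms(4)[of z i] step.IH by metis
    qed (rule x)
  qed
  then show ?thesis using assms(2) by auto
qed

text \<open>The orbit of any point is closed in both directions, so it is everything once nonempty
  closed sets are. In this form transitivity can be checked, and compared with graph connectedness,
  without paths.\<close>

lemma transitive_iff_closed:
  assumes "perm_family X F"
  shows "transitive X F \<longleftrightarrow> X \<noteq> {} \<and> (\<forall>S\<subseteq>X. S \<noteq> {} \<longrightarrow> (\<forall>i. \<forall>x\<in>X. x \<in> S \<longleftrightarrow> F i x \<in> S) \<longrightarrow> S = X)"
proof
  assume c: "transitive X F"
  show "X \<noteq> {} \<and> (\<forall>S\<subseteq>X. S \<noteq> {} \<longrightarrow> (\<forall>i. \<forall>x\<in>X. x \<in> S \<longleftrightarrow> F i x \<in> S) \<longrightarrow> S = X)"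
  proof (intro conjI allI impI)
    show "X \<noteq> {}" using c by (simp add: transitive_def)
    show "S = X" if S: "S \<subseteq> X" "S \<noteq> {}" "\<forall>i. \<forall>x\<in>X. x \<in> S \<longleftrightarrow> F i x \<in> S" for S
      by (rule transitive_closed_subset[OF c S(1,2) S(3)[rule_format]])
  qed
next
  assume a: "X \<noteq> {} \<and> (\<forall>S\<subseteq>X. S \<noteq> {} \<longrightarrow> (\<forall>i. \<forall>x\<in>X. x \<in> S \<longleftrightarrow> F i x \<in> S) \<longrightarrow> S = X)"
  obtain x where x: "x \<in> X" using conjunct1[OF a] by auto
  define C where "C = reach X F `` {x}"
  have C: "C \<in> orbits X F" using x by (simp add: C_def orbits_def quotientI)
  have "\<forall>i. \<forall>x\<in>X. x \<in> C \<longleftrightarrow> F i x \<in> C"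
  proof (intro allI ballI iffI)
    show "F i x \<in> C" if "x \<in> C" for i x by (rule orbits_closed[OF assms C that])
    show "x \<in> C" if "x \<in> X" "F i x \<in> C" for i x by (rule orbits_closed_rev[OF assms C that])
  qed
  then have "C = X"
    by (rule conjunct2[OF a, THEN spec, THEN mp, THEN mp, THEN mp, OF orbits_subset[OF C] orbits_nonempty[OF C]])
  then show "transitive X F" using transitive_orbit[OF assms C] by simp
qed

text \<open>The orbits are the only partition into closed transitive blocks. This identifies the
  orbits of isomorphic copies, of complements of orbits and of disjoint unions.\<close>

lemma orbits_eqI:
  assumes perm_family: "perm_family X F" and U: "\<Union>P = X"
    and dj: "\<And>C D. C \<in> P \<Longrightarrow> D \<in> P \<Longrightarrow> C = D \<or> C \<inter> D = {}"
    and cl: "\<And>C i x. C \<in> P \<Longrightarrow> x \<in> C \<Longrightarrow> F i x \<in> C"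
    and cn: "\<And>C. C \<in> P \<Longrightarrow> transitive C F"
  shows "orbits X F = P"
proof -
  \<comment> \<open>Forward closedness of all blocks gives closedness under inverse steps: the block
    of \<open>x\<close> also contains \<open>F i x\<close>, so it meets \<open>C\<close> and equals
    it.\<close>
  have cl': "x \<in> C" if C: "C \<in> P" "x \<in> X" "F i x \<in> C" for C x i
  proof -
    obtain D where "D \<in> P" "x \<in> D" using C U by blast
    then show ?thesis using cl[of D x i] dj[of C D] C by blast
  qed
  have key: "reach X F `` {x} = C" if C: "C \<in> P" "x \<in> C" for C x
  proof (intro equalityI subsetI)
    fix y assume "y \<in> C"
    then have "(x, y) \<in> (step C F)\<^sup>*" using cn[OF C(1)] C(2) by (auto simp: transitive_def reach_def)
    moreover have CX: "C \<subseteq> X" using C U by auto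
    then have "step C F \<subseteq> step X F" by (auto simp: step_def)
    ultimately have "(x, y) \<in> (step X F)\<^sup>*" using rtrancl_mono by blast
    then show "y \<in> reach X F `` {x}" using CX C \<open>y \<in> C\<close> by (auto simp: reach_def)
  next
    fix y assume "y \<in> reach X F `` {x}"
    then have "(x, y) \<in> (step X F)\<^sup>*" by (auto simp: reach_def)
    then show "y \<in> C"
    proof (induction rule: rtrancl_induct)
      case (step y z)
      then show ?case using cl[OF C(1)] cl'[OF C(1)] by (auto simp: step_def)
    qed (rule C)
  qed
  show ?thesis
  proof (intro equalityI subsetI)
    fix C assume "C \<in> orbits X F"
    then obtain x where x: "x \<in> X" "C = reach X F `` {x}" by (auto simp: orbits_def quotient_def)
    then obtain D where "D \<in> P" "x \<in> D" using U by blast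
    then show "C \<in> P" using key x by simp
  next
    fix C assume C: "C \<in> P"
    then obtain x where x: "x \<in> C" using cn by (auto simp: transitive_def)
    then have "x \<in> X" using C U by auto
    then show "C \<in> orbits X F" using key[OF C x] by (auto simp: orbits_def quotient_def)
  qed
qed

lemma transitive_iso_map:
  assumes "transitive X F" "iso_map f X F Y G"
  shows "transitive Y G"
proof -
  have b: "bij_betw f X Y" using assms by (simp add: iso_map_def)
  have s: "(f x, f y) \<in> step Y G" if xy: "(x, y) \<in> step X F" for x y
  proof -
    obtain i where i: "x \<in> X" "y \<in> X" "y = F i x \<or> x = F i y" using xy by (auto simp: step_def)
    then have "f y = G i (f x) \<or> f x = G i (f y)" using assms(2) unfolding iso_map_def by metis
    then show ?thesis using i bij_betw_apply[OF b] by (auto simp: step_def)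
  qed
  have "(f x, f y) \<in> (step Y G)\<^sup>*" if "(x, y) \<in> (step X F)\<^sup>*" for x y
    using that by (induction rule: rtrancl_induct) (auto intro: rtrancl_into_rtrancl s)
  then have "(x, y) \<in> (step Y G)\<^sup>*" if "x \<in> Y" "y \<in> Y" for x y
    using that assms(1) b by (auto simp: transitive_def reach_def bij_betw_def)
  moreover have "Y \<noteq> {}" using assms(1) b by (auto simp: transitive_def bij_betw_def)
  ultimately show ?thesis by (auto simp: transitive_def reach_def)
qed

lemma iso_map_restrict:
  assumes "iso_map f X F Y G" "C \<subseteq> X"
  shows "iso_map f C F (f ` C) G"
  using assms unfolding iso_map_def by (auto intro: bij_betw_subset)

lemma orbits_iso_map:
  assumes "perm_family X F" "iso_map f X F Y G"
  shows "orbits Y G = (`) f ` orbits X F"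
proof (rule orbits_eqI)
  have b: "bij_betw f X Y" using assms by (simp add: iso_map_def)
  show "perm_family Y G" by (rule perm_family_iso_map[OF assms])
  show "\<Union> ((`) f ` orbits X F) = Y" using b Union_orbits[of X F] by (auto simp: bij_betw_def)
  show "C = D \<or> C \<inter> D = {}" if CD: "C \<in> (`) f ` orbits X F" "D \<in> (`) f ` orbits X F" for C D
  proof -
    obtain C' D' where C': "C = f ` C'" "D = f ` D'" "C' \<in> orbits X F" "D' \<in> orbits X F" using CD by auto
    have "C' = D' \<or> C' \<inter> D' = {}" by (rule orbits_disjoint[OF C'(3,4)])
    moreover have "f ` (C' \<inter> D') = f ` C' \<inter> f ` D'"
      using inj_on_image_Int[of f X C' D'] b orbits_subset[OF C'(3)] orbits_subset[OF C'(4)]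
      by (simp add: bij_betw_def)
    ultimately show ?thesis using C'(1,2) by auto
  qed
  show "G i x \<in> C" if C: "C \<in> (`) f ` orbits X F" "x \<in> C" for C i x
  proof -
    obtain C' x' where C': "C' \<in> orbits X F" "C = f ` C'" "x' \<in> C'" "x = f x'" using C by auto
    then have "x' \<in> X" using orbits_subset[OF C'(1)] by auto
    then have "G i x = f (F i x')" using assms(2) C' by (simp add: iso_map_def)
    then show ?thesis using orbits_closed[OF assms(1) C'(1,3)] C' by auto
  qed
  show "transitive C G" if C: "C \<in> (`) f ` orbits X F" for C
  proof -
    obtain C' where C': "C' \<in> orbits X F" "C = f ` C'" using C by auto
    show ?thesis
      using transitive_iso_map[OF transitive_orbit[OF assms(1) C'(1)] iso_map_restrict[OF assms(2) orbits_subset[OF C'(1)]]] C'(2)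
      by simp
  qed
qed

section \<open>Isomorphism types and multisets of transitive types\<close>

text \<open>Equal image multisets have fibres of equal cardinality over each value; bijections
  between corresponding fibres are glued. Used to match orbits and, for tensors, to match index
  triples.\<close>

lemma image_mset_eq_obtain_bij:
  assumes fin: "finite A" "finite B" and eq: "image_mset f (mset_set A) = image_mset g (mset_set B)"
  obtains h where "bij_betw h A B" "\<And>x. x \<in> A \<Longrightarrow> g (h x) = f x"
proof -
  have "card {x \<in> A. f x = v} = card {y \<in> B. g y = v}" for v
    using arg_cong[OF eq, of "\<lambda>M. count M v"] fin by (simp add: count_image_mset_eq_card_vimage)
  then have "\<exists>h. bij_betw h {x \<in> A. f x = v} {y \<in> B. g y = v}" for v
    using fin by (intro finite_same_card_bij) auto
  then obtain h where h: "\<And>v. bij_betw (h v) {x \<in> A. f x = v} {y \<in> B. g y = v}" by metis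
  have hB: "h (f x) x \<in> B \<and> g (h (f x) x) = f x" if "x \<in> A" for x
    using bij_betw_apply[OF h[of "f x"], of x] that by simp
  have "inj_on (\<lambda>x. h (f x) x) A"
  proof (rule inj_onI)
    fix x y assume xy: "x \<in> A" "y \<in> A" "h (f x) x = h (f y) y"
    then have "f x = f y" using hB by metis
    then show "x = y" using xy bij_betw_imp_inj_on[OF h[of "f x"]] by (auto simp: inj_on_def)
  qed
  moreover have "(\<lambda>x. h (f x) x) ` A = B"
  proof (intro equalityI subsetI)
    fix y assume y: "y \<in> B"
    then have "y \<in> h (g y) ` {x \<in> A. f x = g y}" using bij_betw_imp_surj_on[OF h[of "g y"]] by simp
    then obtain x where x: "x \<in> A" "f x = g y" "y = h (g y) x" by blast
    then have "y = h (f x) x" by simp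
    then show "y \<in> (\<lambda>x. h (f x) x) ` A" using x(1) by (rule image_eqI)
  qed (use hB in auto)
  ultimately have "bij_betw (\<lambda>x. h (f x) x) A B" by (simp add: bij_betw_def)
  then show thesis using that hB by blast
qed

lemma image_mset_orbits_iso_map:
  assumes "perm_family X F" "iso_map f X F Y G" "\<And>C. C \<in> orbits X F \<Longrightarrow> k' (f ` C) = k C"
  shows "image_mset k' (mset_set (orbits Y G)) = image_mset k (mset_set (orbits X F))"
proof -
  have b: "inj_on f X" using assms(2) by (simp add: iso_map_def bij_betw_def)
  have "inj_on ((`) f) (orbits X F)"
    by (rule inj_on_subset[OF inj_on_image_Pow[OF b]]) (use orbits_subset[of _ X F] in auto)
  then have "mset_set (orbits Y G) = image_mset ((`) f) (mset_set (orbits X F))"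
    by (simp add: orbits_iso_map[OF assms(1,2)] image_mset_mset_set)
  then have "image_mset k' (mset_set (orbits Y G)) = image_mset (\<lambda>C. k' (f ` C)) (mset_set (orbits X F))"
    by (simp add: image_mset.compositionality o_def)
  also have "\<dots> = image_mset k (mset_set (orbits X F))"
    using assms(3) finite_orbits[OF perm_familyD(1)[OF assms(1)], of F] by (intro image_mset_cong) simp
  finally show ?thesis .
qed

text \<open>Orbits with equal keys are matched and the isomorphisms between them glued. The key is
  abstract: isomorphism types serve for general systems, cardinalities for a single
  permutation.\<close>

lemma isom_if_image_mset_orbits_eq:
  assumes X: "perm_family X F" and Y: "perm_family Y G"
    and eq: "image_mset k (mset_set (orbits X F)) = image_mset k' (mset_set (orbits Y G))"
    and iso: "\<And>C D. C \<in> orbits X F \<Longrightarrow> D \<in> orbits Y G \<Longrightarrow> k C = k' D \<Longrightarrow> isom C F D G"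
  shows "isom X F Y G"
proof -
  obtain h where h: "bij_betw h (orbits X F) (orbits Y G)" "\<And>C. C \<in> orbits X F \<Longrightarrow> k' (h C) = k C"
    using image_mset_eq_obtain_bij[OF finite_orbits[OF perm_familyD(1)[OF X]] finite_orbits[OF perm_familyD(1)[OF Y]] eq]
    by blast
  have "\<exists>f. iso_map f C F (h C) G" if C: "C \<in> orbits X F" for C
    using iso[OF C bij_betw_apply[OF h(1) C]] h(2)[OF C] by (simp add: isom_def)
  then obtain \<phi> where \<phi>: "\<And>C. C \<in> orbits X F \<Longrightarrow> iso_map (\<phi> C) C F (h C) G" by metis
  \<comment> \<open>Orbits are disjoint, so \<open>THE\<close> selects the one orbit containing
    \<open>x\<close>, and the isomorphism chosen for that orbit is applied.\<close>
  define f where "f x = \<phi> (THE C. C \<in> orbits X F \<and> x \<in> C) x" for x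
  have f: "f x = \<phi> C x" if C: "C \<in> orbits X F" "x \<in> C" for C x
  proof -
    have "(THE C. C \<in> orbits X F \<and> x \<in> C) = C"
      using C orbits_disjoint[of C X F] by (intro the_equality) auto
    then show ?thesis by (simp add: f_def)
  qed
  have bC: "bij_betw f C (h C)" if C: "C \<in> orbits X F" for C
  proof -
    have "bij_betw (\<phi> C) C (h C)" using \<phi>[OF C] by (simp add: iso_map_def)
    then show ?thesis using f[OF C] bij_betw_cong[of C f "\<phi> C"] by simp
  qed
  have "disjoint_family_on h (orbits X F)"
    unfolding disjoint_family_on_def
  proof (intro ballI impI)
    fix C D assume CD: "C \<in> orbits X F" "D \<in> orbits X F" "C \<noteq> D"
    then have "h C \<noteq> h D" using bij_betw_imp_inj_on[OF h(1)] by (auto simp: inj_on_def)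
    then show "h C \<inter> h D = {}"
      using orbits_disjoint[OF bij_betw_apply[OF h(1) CD(1)] bij_betw_apply[OF h(1) CD(2)]] by simp
  qed
  then have "bij_betw f (\<Union>C\<in>orbits X F. C) (\<Union>C\<in>orbits X F. h C)"
    using bC by (rule bij_betw_UNION_disjoint)
  moreover have "(\<Union>C\<in>orbits X F. h C) = Y"
    using bij_betw_imp_surj_on[OF h(1)] Union_orbits[of Y G] by simp
  ultimately have "bij_betw f X Y" using Union_orbits[of X F] by simp
  moreover have "f (F i x) = G i (f x)" if x: "x \<in> X" for i x
  proof -
    obtain C where C: "C \<in> orbits X F" "x \<in> C" using x Union_orbits[of X F] by auto
    have "F i x \<in> C" by (rule orbits_closed[OF X C])
    then show ?thesis using f[OF C(1)] \<phi>[OF C(1)] C(2) by (simp add: iso_map_def)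
  qed
  ultimately show ?thesis unfolding isom_def iso_map_def by blast
qed

text \<open>Standard models: each finite system is isomorphic to one of these, so that types of
  systems on different carriers, even of different HOL types, become comparable values.\<close>

definition std_families :: "nat \<Rightarrow> ('i \<Rightarrow> nat \<Rightarrow> nat) set" where
  "std_families n = {\<sigma>. \<forall>i. \<sigma> i permutes {1..n}}"

text \<open>The cardinality is recorded because permutations of \<open>{1..n}\<close>, as functions, do not determine \<open>n\<close>.\<close>
definition iso_type :: "'a set \<Rightarrow> ('i \<Rightarrow> 'a \<Rightarrow> 'a) \<Rightarrow> nat \<times> ('i \<Rightarrow> nat \<Rightarrow> nat) set" where
  "iso_type X F = (card X, {\<sigma> \<in> std_families (card X). isom {1..card X} \<sigma> X F})"

lemma perm_family_std_families: "\<sigma> \<in> std_families n \<Longrightarrow> perm_family {1..n} \<sigma>"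
  by (simp add: std_families_def perm_family_def permutes_imp_bij)

lemma ex_std_families_isom:
  assumes "perm_family X F"
  obtains \<sigma> where "\<sigma> \<in> std_families (card X)" "isom {1..card X} \<sigma> X F"
proof -
  obtain h where h: "bij_betw h {1..card X} X"
    using ex_bij_betw_nat_finite_1[OF perm_familyD(1)[OF assms]] by blast
  define \<sigma> where "\<sigma> i x = (if x \<in> {1..card X} then inv_into {1..card X} h (F i (h x)) else x)" for i x
  have "bij_betw (inv_into {1..card X} h \<circ> F i \<circ> h) {1..card X} {1..card X}" for i
    using bij_betw_trans[OF bij_betw_trans[OF h perm_familyD(2)[OF assms, of i]] bij_betw_inv_into[OF h]]
    by (simp add: o_assoc)
  then have "bij_betw (\<sigma> i) {1..card X} {1..card X}" for i
    using bij_betw_cong[of "{1..card X}" "\<sigma> i" "inv_into {1..card X} h \<circ> F i \<circ> h"] by (simp add: \<sigma>_def)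
  then have "\<sigma> i permutes {1..card X}" for i
    by (rule bij_imp_permutes) (simp only: \<sigma>_def if_False)
  then have "\<sigma> \<in> std_families (card X)" by (simp add: std_families_def)
  moreover have "h (\<sigma> i x) = F i (h x)" if x: "x \<in> {1..card X}" for i x
  proof -
    have "F i (h x) \<in> X" by (rule perm_familyD(3)[OF assms bij_betw_apply[OF h x]])
    then have "h (inv_into {1..card X} h (F i (h x))) = F i (h x)" by (rule bij_betw_inv_into_right[OF h])
    then show ?thesis using x by (simp only: \<sigma>_def if_True)
  qed
  then have "iso_map h {1..card X} \<sigma> X F" using h by (simp add: iso_map_def)
  ultimately show thesis using that unfolding isom_def by blast
qed

lemma iso_type_eq_iff:
  assumes "perm_family X F" "perm_family Y G"
  shows "iso_type X F = iso_type Y G \<longleftrightarrow> isom X F Y G"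
proof
  assume eq: "iso_type X F = iso_type Y G"
  \<comment> \<open>The class of \<open>X\<close> is nonempty, and any standard model in it links
    \<open>X\<close> to \<open>Y\<close>.\<close>
  obtain \<sigma> where s: "\<sigma> \<in> std_families (card X)" "isom {1..card X} \<sigma> X F" using ex_std_families_isom[OF assms(1)] by blast
  have c: "card X = card Y" using eq by (simp add: iso_type_def)
  have "\<sigma> \<in> snd (iso_type X F)" using s by (simp add: iso_type_def)
  then have "\<sigma> \<in> snd (iso_type Y G)" using eq by simp
  then have "isom {1..card X} \<sigma> Y G" using c by (simp add: iso_type_def)
  then show "isom X F Y G" by (rule isom_trans[OF isom_sym[OF s(2) perm_family_std_families[OF s(1)]]])
next
  assume iso: "isom X F Y G"
  have "isom {1..card X} \<sigma> X F \<longleftrightarrow> isom {1..card X} \<sigma> Y G" for \<sigma>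
  proof
    show "isom {1..card X} \<sigma> Y G" if "isom {1..card X} \<sigma> X F" by (rule isom_trans[OF that iso])
    show "isom {1..card X} \<sigma> X F" if "isom {1..card X} \<sigma> Y G"
      by (rule isom_trans[OF that isom_sym[OF iso assms(1)]])
  qed
  then show "iso_type X F = iso_type Y G" using isom_card[OF iso] by (simp add: iso_type_def)
qed

definition iso_types :: "nat \<Rightarrow> (nat \<times> ('i \<Rightarrow> nat \<Rightarrow> nat) set) set" where
  "iso_types n = iso_type {1..n} ` std_families n"

definition transitive_types :: "nat \<Rightarrow> (nat \<times> ('i \<Rightarrow> nat \<Rightarrow> nat) set) set" where
  "transitive_types n = iso_type {1..n} ` {\<sigma> \<in> std_families n. transitive {1..n} \<sigma>}"

lemma fst_iso_type: "fst (iso_type X F) = card X"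
  by (simp add: iso_type_def)

lemma fst_transitive_types: "t \<in> transitive_types n \<Longrightarrow> fst t = n"
  by (auto simp: transitive_types_def fst_iso_type)

lemma iso_type_transitive_in_transitive_types:
  assumes "perm_family X F" "transitive X F"
  shows "iso_type X F \<in> transitive_types (card X)"
proof -
  obtain \<sigma> where s: "\<sigma> \<in> std_families (card X)" "isom {1..card X} \<sigma> X F" using ex_std_families_isom[OF assms(1)] by blast
  note f = perm_family_std_families[OF s(1)]
  have "iso_type X F = iso_type {1..card X} \<sigma>" using iso_type_eq_iff[OF f assms(1)] s(2) by simp
  moreover have "isom X F {1..card X} \<sigma>" by (rule isom_sym[OF s(2) f])
  then have "transitive {1..card X} \<sigma>" using transitive_iso_map[OF assms(2)] unfolding isom_def by blast
  ultimately show ?thesis using s(1) by (simp add: transitive_types_def)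
qed

definition iso_type_mset :: "'a set \<Rightarrow> ('i \<Rightarrow> 'a \<Rightarrow> 'a) \<Rightarrow> (nat \<times> ('i \<Rightarrow> nat \<Rightarrow> nat) set) multiset" where
  "iso_type_mset X F = image_mset (\<lambda>C. iso_type C F) (mset_set (orbits X F))"

lemma iso_type_mset_eq_iff:
  assumes X: "perm_family X F" and Y: "perm_family Y G"
  shows "iso_type_mset X F = iso_type_mset Y G \<longleftrightarrow> isom X F Y G"
proof
  assume eq: "iso_type_mset X F = iso_type_mset Y G"
  show "isom X F Y G"
  proof (rule isom_if_image_mset_orbits_eq[OF X Y eq[unfolded iso_type_mset_def]])
    fix C D assume "C \<in> orbits X F" "D \<in> orbits Y G" "iso_type C F = iso_type D G"
    then show "isom C F D G" using iso_type_eq_iff[OF perm_family_orbit[OF X] perm_family_orbit[OF Y]] by simp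
  qed
next
  assume "isom X F Y G"
  then obtain f where f: "iso_map f X F Y G" by (auto simp: isom_def)
  have "iso_type (f ` C) G = iso_type C F" if C: "C \<in> orbits X F" for C
  proof -
    have i: "iso_map f C F (f ` C) G" by (rule iso_map_restrict[OF f orbits_subset[OF C]])
    have "isom C F (f ` C) G" using i unfolding isom_def by blast
    then show ?thesis using iso_type_eq_iff[OF perm_family_orbit[OF X C] perm_family_iso_map[OF perm_family_orbit[OF X C] i]] by simp
  qed
  then show "iso_type_mset X F = iso_type_mset Y G"
    unfolding iso_type_mset_def using image_mset_orbits_iso_map[OF X f, of "\<lambda>C. iso_type C G" "\<lambda>C. iso_type C F"] by simp
qed

lemma set_iso_type_mset:
  assumes "perm_family X F"
  shows "set_mset (iso_type_mset X F) \<subseteq> (\<Union>k. transitive_types k)"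
proof -
  have "iso_type C F \<in> (\<Union>k. transitive_types k)" if C: "C \<in> orbits X F" for C
    using iso_type_transitive_in_transitive_types[OF perm_family_orbit[OF assms C] transitive_orbit[OF assms C]] by blast
  then show ?thesis
    using finite_orbits[OF perm_familyD(1)[OF assms], of F] unfolding iso_type_mset_def by (auto simp: image_iff)
qed

lemma sum_iso_type_mset:
  assumes "perm_family X F"
  shows "sum_mset (image_mset fst (iso_type_mset X F)) = card X"
proof -
  have "sum_mset (image_mset fst (iso_type_mset X F)) = (\<Sum>C\<in>orbits X F. card C)"
    by (simp add: iso_type_mset_def image_mset.compositionality o_def fst_iso_type sum_unfold_sum_mset)
  also have "\<dots> = card (\<Union>(orbits X F))"
    using orbits_disjoint[of _ X F] finite_subset[OF orbits_subset perm_familyD(1)[OF assms]]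
    by (intro card_Union_disjoint[symmetric]) (auto simp: pairwise_def disjnt_def)
  finally show ?thesis by (simp add: Union_orbits)
qed

text \<open>Realised by the disjoint union of representatives. Listing the multiset gives repeated
  types different positions, and the position is the tag that keeps their copies apart.\<close>

lemma ex_iso_type_mset:
  assumes M: "set_mset M \<subseteq> (\<Union>k. transitive_types k)"
  obtains \<sigma> where "\<sigma> \<in> std_families (sum_mset (image_mset fst M))"
    "iso_type_mset {1..sum_mset (image_mset fst M)} \<sigma> = M"
proof -
  obtain ts where ts: "mset ts = M" using ex_mset by blast
  define I where "I = {..<length ts}"
  define k where "k i = fst (ts ! i)" for i
  have "\<exists>\<rho>. \<rho> \<in> std_families (k i) \<and> transitive {1..k i} \<rho> \<and> ts ! i = iso_type {1..k i} \<rho>" if i: "i \<in> I" for i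
  proof -
    have "ts ! i \<in> set_mset M" using i ts by (auto simp: I_def)
    then obtain n where "ts ! i \<in> transitive_types n" using M by blast
    then show ?thesis using fst_transitive_types[of "ts ! i" n] unfolding transitive_types_def k_def by blast
  qed
  then obtain \<rho> where \<rho>: "\<And>i. i \<in> I \<Longrightarrow> \<rho> i \<in> std_families (k i)" "\<And>i. i \<in> I \<Longrightarrow> transitive {1..k i} (\<rho> i)"
    "\<And>i. i \<in> I \<Longrightarrow> ts ! i = iso_type {1..k i} (\<rho> i)" by metis
  define X where "X = (SIGMA i:I. {1..k i})"
  define F where "F j = (\<lambda>(i, x). (i, \<rho> i j x))" for j
  define B where "B i = {i} \<times> {1..k i}" for i
  have perm: "\<rho> i j permutes {1..k i}" if "i \<in> I" for i j using \<rho>(1)[OF that] by (simp add: std_families_def)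
  have "Pair i ` {1..k i} = B i" for i unfolding B_def by blast
  then have iso: "iso_map (Pair i) {1..k i} (\<rho> i) (B i) F" for i
    by (simp add: iso_map_def bij_betw_def F_def inj_on_def)
  have famB: "perm_family (B i) F" if i: "i \<in> I" for i by (rule perm_family_iso_map[OF perm_family_std_families[OF \<rho>(1)[OF i]] iso])
  have connB: "transitive (B i) F" if i: "i \<in> I" for i by (rule transitive_iso_map[OF \<rho>(2)[OF i] iso])
  have XB: "\<Union>(B ` I) = X" by (auto simp: X_def B_def)
  have fX: "finite X" by (simp add: X_def I_def)
  have famX: "perm_family X F"
  proof -
    have "F j ` X \<subseteq> X" for j
    proof (rule image_subsetI)
      fix p assume "p \<in> X"
      then obtain i x where p: "p = (i, x)" "i \<in> I" "x \<in> {1..k i}" unfolding X_def by blast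
      then have "\<rho> i j x \<in> {1..k i}" using permutes_in_image[OF perm[OF p(2)]] by blast
      then show "F j p \<in> X" using p by (simp add: X_def F_def)
    qed
    moreover have "inj_on (F j) X" for j
    proof (rule inj_onI)
      fix p q assume pq: "p \<in> X" "q \<in> X" "F j p = F j q"
      obtain i x where p: "p = (i, x)" "i \<in> I" using pq(1) unfolding X_def by blast
      obtain i' y where q: "q = (i', y)" using prod.exhaust by blast
      show "p = q" using pq(3) permutes_inj[OF perm[OF p(2)], of j] by (auto simp: p q F_def inj_def)
    qed
    ultimately have "bij_betw (F j) X X" for j
      using fX by (simp add: bij_betw_def endo_inj_surj)
    then show ?thesis using fX by (simp add: perm_family_def)
  qed
  have orbits: "orbits X F = B ` I"
  proof (rule orbits_eqI[OF famX XB])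
    show "C = D \<or> C \<inter> D = {}" if CD: "C \<in> B ` I" "D \<in> B ` I" for C D
    proof -
      obtain i j where "C = B i" "D = B j" using CD by blast
      then show ?thesis by (cases "i = j") (auto simp: B_def)
    qed
    show "F i x \<in> C" if C: "C \<in> B ` I" and x: "x \<in> C" for C i x
    proof -
      obtain j where j: "j \<in> I" "C = B j" using C by blast
      then show ?thesis using perm_familyD(3)[OF famB[OF j(1)]] x by simp
    qed
    show "transitive C F" if C: "C \<in> B ` I" for C
    proof -
      obtain j where j: "j \<in> I" "C = B j" using C by blast
      then show ?thesis using connB[OF j(1)] by simp
    qed
  qed
  have tyB: "iso_type (B i) F = ts ! i" if i: "i \<in> I" for i
  proof -
    have "isom {1..k i} (\<rho> i) (B i) F" using iso[of i] unfolding isom_def by blast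
    then show ?thesis using iso_type_eq_iff[OF perm_family_std_families[OF \<rho>(1)[OF i]] famB[OF i]] \<rho>(3)[OF i] by simp
  qed
  have "inj_on B I"
  proof (rule inj_onI)
    fix i j assume ij: "i \<in> I" "j \<in> I" "B i = B j"
    have "B i \<noteq> {}" using connB[OF ij(1)] by (simp add: transitive_def)
    then show "i = j" using ij(3) by (auto simp: B_def)
  qed
  then have "mset_set (orbits X F) = image_mset B (mset_set I)"
    unfolding orbits by (rule image_mset_mset_set[symmetric])
  then have "iso_type_mset X F = image_mset (\<lambda>i. iso_type (B i) F) (mset_set I)"
    by (simp add: iso_type_mset_def image_mset.compositionality o_def)
  also have "\<dots> = image_mset (\<lambda>i. ts ! i) (mset_set I)"
    using tyB by (intro image_mset_cong) (simp add: I_def)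
  also have "\<dots> = M"
  proof -
    have "image_mset (\<lambda>i. ts ! i) (mset_set I) = mset (map (\<lambda>i. ts ! i) [0..<length ts])"
      by (simp add: I_def lessThan_atLeast0)
    then show ?thesis using ts by (simp add: map_nth)
  qed
  finally have tyX: "iso_type_mset X F = M" .
  then have cX: "card X = sum_mset (image_mset fst M)" using sum_iso_type_mset[OF famX] by simp
  obtain \<sigma> where s: "\<sigma> \<in> std_families (card X)" "isom {1..card X} \<sigma> X F" using ex_std_families_isom[OF famX] by blast
  then have "iso_type_mset {1..card X} \<sigma> = M" using iso_type_mset_eq_iff[OF perm_family_std_families[OF s(1)] famX] tyX by simp
  then show thesis using that s(1) cX by simp
qed

text \<open>This compares counts of classes by two functions that identify the same elements,
  although their values may be of unrelated kinds.\<close>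

lemma card_image_eq_if_kernel_eq:
  assumes "\<And>x y. x \<in> A \<Longrightarrow> y \<in> A \<Longrightarrow> f x = f y \<longleftrightarrow> g x = g y"
  shows "card (f ` A) = card (g ` A)"
proof -
  have "bij_betw (\<lambda>v. g (inv_into A f v)) (f ` A) (g ` A)"
  proof (rule bij_betw_imageI)
    show "inj_on (\<lambda>v. g (inv_into A f v)) (f ` A)"
    proof (rule inj_onI)
      fix v w assume v: "v \<in> f ` A" "w \<in> f ` A" "g (inv_into A f v) = g (inv_into A f w)"
      have "f (inv_into A f v) = f (inv_into A f w)"
        using assms[OF inv_into_into[OF v(1)] inv_into_into[OF v(2)]] v(3) by simp
      then show "v = w" using f_inv_into_f[OF v(1)] f_inv_into_f[OF v(2)] by simp
    qed
    have "g (inv_into A f (f x)) = g x" if x: "x \<in> A" for x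
      using assms[OF inv_into_into[OF imageI[OF x, of f]] x] f_inv_into_f[OF imageI[OF x, of f]] by simp
    then show "(\<lambda>v. g (inv_into A f v)) ` f ` A = g ` A" by (auto simp: image_iff)
  qed
  then show ?thesis by (rule bij_betw_same_card)
qed

lemma card_iso_types_eq_card_msets:
  "card (iso_types n :: (nat \<times> ('i \<Rightarrow> nat \<Rightarrow> nat) set) set) =
   card {M :: (nat \<times> ('i \<Rightarrow> nat \<Rightarrow> nat) set) multiset. set_mset M \<subseteq> (\<Union>k. transitive_types k) \<and> sum_mset (image_mset fst M) = n}"
proof -
  have "card (iso_types n :: (nat \<times> ('i \<Rightarrow> nat \<Rightarrow> nat) set) set) = card ((\<lambda>\<sigma> :: 'i \<Rightarrow> nat \<Rightarrow> nat. iso_type_mset {1..n} \<sigma>) ` std_families n)"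
    unfolding iso_types_def
  proof (rule card_image_eq_if_kernel_eq)
    fix \<sigma> \<tau> :: "'i \<Rightarrow> nat \<Rightarrow> nat" assume "\<sigma> \<in> std_families n" "\<tau> \<in> std_families n"
    then show "iso_type {1..n} \<sigma> = iso_type {1..n} \<tau> \<longleftrightarrow> iso_type_mset {1..n} \<sigma> = iso_type_mset {1..n} \<tau>"
      using iso_type_eq_iff[OF perm_family_std_families perm_family_std_families] iso_type_mset_eq_iff[OF perm_family_std_families perm_family_std_families] by blast
  qed
  also have "(\<lambda>\<sigma> :: 'i \<Rightarrow> nat \<Rightarrow> nat. iso_type_mset {1..n} \<sigma>) ` std_families n =
      {M. set_mset M \<subseteq> (\<Union>k. transitive_types k) \<and> sum_mset (image_mset fst M) = n}"
  proof (intro equalityI subsetI)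
    fix M :: "(nat \<times> ('i \<Rightarrow> nat \<Rightarrow> nat) set) multiset"
    assume "M \<in> iso_type_mset {1..n} ` std_families n"
    then obtain \<sigma> :: "'i \<Rightarrow> nat \<Rightarrow> nat" where s: "\<sigma> \<in> std_families n" "M = iso_type_mset {1..n} \<sigma>" by blast
    show "M \<in> {M. set_mset M \<subseteq> (\<Union>k. transitive_types k) \<and> sum_mset (image_mset fst M) = n}"
      using set_iso_type_mset[OF perm_family_std_families[OF s(1)]] sum_iso_type_mset[OF perm_family_std_families[OF s(1)]] s(2) by simp
  next
    fix M :: "(nat \<times> ('i \<Rightarrow> nat \<Rightarrow> nat) set) multiset"
    assume "M \<in> {M. set_mset M \<subseteq> (\<Union>k. transitive_types k) \<and> sum_mset (image_mset fst M) = n}"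
    then have M: "set_mset M \<subseteq> (\<Union>k. transitive_types k)" "sum_mset (image_mset fst M) = n" by auto
    obtain \<sigma> where s: "\<sigma> \<in> std_families (sum_mset (image_mset fst M))"
        "iso_type_mset {1..sum_mset (image_mset fst M)} \<sigma> = M"
      by (rule ex_iso_type_mset[OF M(1)])
    show "M \<in> iso_type_mset {1..n} ` std_families n" by (rule image_eqI[of _ _ \<sigma>]) (use s M(2) in simp_all)
  qed
  finally show ?thesis .
qed

section \<open>Counting multisets of prescribed total size\<close>

definition msets_of :: "'a set \<Rightarrow> ('a \<Rightarrow> nat) \<Rightarrow> nat \<Rightarrow> 'a multiset set" where
  "msets_of T s n = {M. set_mset M \<subseteq> T \<and> sum_mset (image_mset s M) = n}"

lemma sum_mset_image_eq_sum_count: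
  assumes "finite A" "set_mset M \<subseteq> A"
  shows "sum_mset (image_mset s M) = (\<Sum>t\<in>A. s t * count M t :: nat)"
  using assms(2)
proof (induction M)
  case (add x M)
  have "(\<Sum>t\<in>A. s t * count (add_mset x M) t) = (\<Sum>t\<in>A. s t * count M t + (if t = x then s x else 0))"
    by (rule sum.cong) auto
  also have "\<dots> = (\<Sum>t\<in>A. s t * count M t) + s x"
    using add.prems assms(1) by (simp add: sum.distrib)
  finally show ?case using add by simp
qed simp

context
  fixes T :: "'a set" and s :: "'a \<Rightarrow> nat"
  assumes pos: "\<And>t. t \<in> T \<Longrightarrow> s t > 0" and fin: "\<And>k. finite {t \<in> T. s t = k}"
begin

lemma finite_small: "finite {t \<in> T. s t \<le> n}"
proof -
  have "{t \<in> T. s t \<le> n} = (\<Union>k\<le>n. {t \<in> T. s t = k})" by auto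
  then show ?thesis using fin by simp
qed

lemma msets_of_count_le:
  assumes "M \<in> msets_of T s n"
  shows "s t * count M t \<le> n"
proof (cases "t \<in># M")
  case True
  have "replicate_mset (count M t) t \<subseteq># M" by (simp add: count_le_replicate_mset_subset_eq[symmetric])
  then obtain N where N: "M = replicate_mset (count M t) t + N" unfolding mset_subset_eq_exists_conv by blast
  have "sum_mset (image_mset s M) = sum_mset (image_mset s (replicate_mset (count M t) t + N))"
    using N by (rule arg_cong)
  also have "\<dots> = s t * count M t + sum_mset (image_mset s N)" by (simp add: mult.commute)
  finally show ?thesis using assms by (simp add: msets_of_def)
qed (simp add: not_in_iff)

lemma msets_of_set_subset:
  assumes "M \<in> msets_of T s n"
  shows "set_mset M \<subseteq> {t \<in> T. s t \<le> n}"
proof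
  fix t assume t: "t \<in># M"
  then have "s t * 1 \<le> s t * count M t" by (intro mult_le_mono2) (simp add: Suc_le_eq)
  then have "s t \<le> n" using msets_of_count_le[OF assms, of t] by linarith
  moreover have "t \<in> T" using t assms unfolding msets_of_def by blast
  ultimately show "t \<in> {t \<in> T. s t \<le> n}" by simp
qed

text \<open>Positive weights bound the number of elements by \<open>n\<close>, and only finitely
  many elements have weight at most \<open>n\<close>.\<close>

lemma finite_msets_of: "finite (msets_of T s n)"
proof (rule finite_subset)
  show "msets_of T s n \<subseteq> mset ` {xs. set xs \<subseteq> {t \<in> T. s t \<le> n} \<and> length xs \<le> n}"
  proof
    fix M assume M: "M \<in> msets_of T s n"
    obtain xs where xs: "mset xs = M" using ex_mset by blast
    have "size M = sum_mset (image_mset (\<lambda>_. 1) M)" by simp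
    also have "\<dots> \<le> sum_mset (image_mset s M)"
      using M pos by (intro sum_mset_mono) (auto simp: msets_of_def Suc_le_eq)
    finally have "length xs \<le> n" using M xs by (auto simp: msets_of_def)
    moreover have "set xs \<subseteq> {t \<in> T. s t \<le> n}" using msets_of_set_subset[OF M] xs by auto
    ultimately show "M \<in> mset ` {xs. set xs \<subseteq> {t \<in> T. s t \<le> n} \<and> length xs \<le> n}" using xs by blast
  qed
  show "finite (mset ` {xs. set xs \<subseteq> {t \<in> T. s t \<le> n} \<and> length xs \<le> n})"
    using finite_lists_length_le[OF finite_small] by simp
qed

text \<open>Adding \<open>j\<close> copies of \<open>t\<close> is a bijection onto the multisets
  counted on the left.\<close>

lemma card_msets_of_count_ge:
  assumes t: "t \<in> T" and j: "j * s t \<le> n"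
  shows "card {M \<in> msets_of T s n. j \<le> count M t} = card (msets_of T s (n - j * s t))"
proof -
  have "bij_betw (\<lambda>M. M + replicate_mset j t) (msets_of T s (n - j * s t)) {M \<in> msets_of T s n. j \<le> count M t}"
  proof (rule bij_betw_imageI)
    show "inj_on (\<lambda>M. M + replicate_mset j t) (msets_of T s (n - j * s t))" by (simp add: inj_on_def)
    show "(\<lambda>M. M + replicate_mset j t) ` msets_of T s (n - j * s t) = {M \<in> msets_of T s n. j \<le> count M t}"
    proof (intro equalityI subsetI)
      fix M assume "M \<in> {M \<in> msets_of T s n. j \<le> count M t}"
      then have M: "M \<in> msets_of T s n" "replicate_mset j t \<subseteq># M"
        by (simp_all add: count_le_replicate_mset_subset_eq)
      define M' where "M' = M - replicate_mset j t"
      have eq: "M = M' + replicate_mset j t" using M(2) by (simp add: M'_def)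
      have "set_mset M' \<subseteq> T" using M(1) by (auto simp: msets_of_def M'_def dest: in_diffD)
      moreover have "sum_mset (image_mset s M') + j * s t = n" using M(1) unfolding msets_of_def
        by (simp add: eq)
      ultimately have "M' \<in> msets_of T s (n - j * s t)" by (simp add: msets_of_def)
      then show "M \<in> (\<lambda>M. M + replicate_mset j t) ` msets_of T s (n - j * s t)"
        using eq by blast
    next
      fix M assume "M \<in> (\<lambda>M. M + replicate_mset j t) ` msets_of T s (n - j * s t)"
      then obtain M' where "M' \<in> msets_of T s (n - j * s t)" "M = M' + replicate_mset j t" by blast
      then show "M \<in> {M \<in> msets_of T s n. j \<le> count M t}"
        using t j by (auto simp: msets_of_def split: if_splits)
    qed
  qed
  then show ?thesis by (rule bij_betw_same_card[symmetric])
qed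

text \<open>Double counting: the total size \<open>n\<close> of a multiset is a sum of
  \<open>s t\<close> over its elements \<open>t\<close> and over \<open>j\<close> from 1 to the
  multiplicity of \<open>t\<close>. After exchanging sums, the multisets with at least
  \<open>j\<close> copies of \<open>t\<close> are counted by total size \<open>n - j * s t\<close>,
  and collecting the terms with \<open>k = j * s t\<close> produces the divisor sum.\<close>

lemma euler_transform_recursion:
  "n * card (msets_of T s n) =
     (\<Sum>k=1..n. (\<Sum>d | d dvd k. d * card {t \<in> T. s t = d}) * card (msets_of T s (n - k)))"
proof -
  define P where "P m = card (msets_of T s m)" for m
  define A where "A = {t \<in> T. s t \<le> n}"
  have fA: "finite A" by (simp add: A_def finite_small)
  have pA: "s t > 0" if "t \<in> A" for t using pos that by (simp add: A_def)
  have "n * P n = (\<Sum>M\<in>msets_of T s n. sum_mset (image_mset s M))"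
    by (simp add: P_def msets_of_def mult.commute)
  also have "\<dots> = (\<Sum>M\<in>msets_of T s n. \<Sum>t\<in>A. s t * count M t)"
    using msets_of_set_subset by (intro sum.cong refl sum_mset_image_eq_sum_count[OF fA]) (simp add: A_def)
  \<comment> \<open>The multiplicity becomes a sum of indicators over the fixed range
    \<open>1..n\<close>, so that the range of \<open>j\<close> does not depend on \<open>M\<close>
    and the sums can be exchanged.\<close>
  also have "\<dots> = (\<Sum>M\<in>msets_of T s n. \<Sum>t\<in>A. \<Sum>j=1..n. if j \<le> count M t then s t else 0)"
  proof (intro sum.cong refl)
    fix M t assume M: "M \<in> msets_of T s n" and t: "t \<in> A"
    have "count M t \<le> s t * count M t" using pA[OF t] by simp
    also have "\<dots> \<le> n" by (rule msets_of_count_le[OF M])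
    finally have "{j \<in> {1..n}. j \<le> count M t} = {1..count M t}" by auto
    then show "s t * count M t = (\<Sum>j=1..n. if j \<le> count M t then s t else 0)"
      by (simp add: sum.inter_filter[symmetric])
  qed
  also have "\<dots> = (\<Sum>t\<in>A. \<Sum>j=1..n. \<Sum>M\<in>msets_of T s n. if j \<le> count M t then s t else 0)"
    by (subst sum.swap) (intro sum.cong refl sum.swap)
  also have "\<dots> = (\<Sum>t\<in>A. \<Sum>k=1..n. if s t dvd k then s t * P (n - k) else 0)"
  proof (rule sum.cong[OF refl])
    fix t assume t: "t \<in> A"
    have tT: "t \<in> T" using t by (simp add: A_def)
    have "(\<Sum>j=1..n. \<Sum>M\<in>msets_of T s n. if j \<le> count M t then s t else 0) =
        (\<Sum>j=1..n. s t * card {M \<in> msets_of T s n. j \<le> count M t})"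
      using finite_msets_of by (simp add: sum.inter_filter[symmetric] mult.commute)
    also have "\<dots> = (\<Sum>j | j \<in> {1..n} \<and> j * s t \<le> n. s t * card {M \<in> msets_of T s n. j \<le> count M t})"
    proof (rule sum.mono_neutral_right)
      show "\<forall>j\<in>{1..n} - {j. j \<in> {1..n} \<and> j * s t \<le> n}. s t * card {M \<in> msets_of T s n. j \<le> count M t} = 0"
      proof
        fix j assume j: "j \<in> {1..n} - {j. j \<in> {1..n} \<and> j * s t \<le> n}"
        have "\<not> j \<le> count M t" if M: "M \<in> msets_of T s n" for M
        proof
          assume "j \<le> count M t"
          then have "s t * j \<le> s t * count M t" by (rule mult_le_mono2)
          then have "s t * j \<le> n" using msets_of_count_le[OF M, of t] by (rule order_trans)
          then have "j * s t \<le> n" by (simp only: mult.commute)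
          then show False using j by blast
        qed
        then have "{M \<in> msets_of T s n. j \<le> count M t} = {}" by blast
        then show "s t * card {M \<in> msets_of T s n. j \<le> count M t} = 0" by (simp only: card.empty mult_0_right)
      qed
    qed auto
    also have "\<dots> = (\<Sum>j | j \<in> {1..n} \<and> j * s t \<le> n. s t * P (n - j * s t))"
      using card_msets_of_count_ge[OF tT] by (intro sum.cong refl) (simp add: P_def)
    \<comment> \<open>For fixed \<open>t\<close> the products \<open>k = j * s t\<close> run through
      the positive multiples of \<open>s t\<close> up to \<open>n\<close>.\<close>
    also have "\<dots> = (\<Sum>k | k \<in> {1..n} \<and> s t dvd k. s t * P (n - k))"
    proof (rule sum.reindex_bij_witness[of _ "\<lambda>k. k div s t" "\<lambda>j. j * s t"])
      fix j assume j: "j \<in> {j. j \<in> {1..n} \<and> j * s t \<le> n}"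
      show "j * s t div s t = j" using pA[OF t] by simp
      have "0 < j * s t" using pA[OF t] j by simp
      then show "j * s t \<in> {k. k \<in> {1..n} \<and> s t dvd k}" using j by (simp add: Suc_le_eq)
    next
      fix k assume k: "k \<in> {k. k \<in> {1..n} \<and> s t dvd k}"
      then show kk: "k div s t * s t = k" by simp
      have "k div s t \<le> n" using k order_trans[OF div_le_dividend[of k "s t"], of n] by simp
      moreover have "k div s t \<noteq> 0" using kk k by (intro notI) simp
      ultimately show "k div s t \<in> {j. j \<in> {1..n} \<and> j * s t \<le> n}" using k kk by simp
    qed simp
    also have "\<dots> = (\<Sum>k=1..n. if s t dvd k then s t * P (n - k) else 0)"
      by (rule sum.inter_filter) simp
    finally show "(\<Sum>j=1..n. \<Sum>M\<in>msets_of T s n. if j \<le> count M t then s t else 0) =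
      (\<Sum>k=1..n. if s t dvd k then s t * P (n - k) else 0)" .
  qed
  also have "\<dots> = (\<Sum>k=1..n. \<Sum>t\<in>A. if s t dvd k then s t * P (n - k) else 0)"
    by (rule sum.swap)
  also have "\<dots> = (\<Sum>k=1..n. (\<Sum>d | d dvd k. d * card {t \<in> T. s t = d}) * P (n - k))"
  proof (intro sum.cong refl)
    fix k assume k: "k \<in> {1..n}"
    have "(\<Sum>t\<in>A. if s t dvd k then s t * P (n - k) else 0) = (\<Sum>t | t \<in> A \<and> s t dvd k. s t) * P (n - k)"
      using fA by (simp add: sum.inter_filter[symmetric] sum_distrib_right)
    also have "(\<Sum>t | t \<in> A \<and> s t dvd k. s t) = (\<Sum>d | d dvd k. \<Sum>t | t \<in> {t \<in> A. s t dvd k} \<and> s t = d. s t)"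
      using fA k by (intro sum.group[symmetric]) auto
    also have "\<dots> = (\<Sum>d | d dvd k. d * card {t \<in> T. s t = d})"
    proof (intro sum.cong refl)
      fix d assume d: "d \<in> {d. d dvd k}"
      then have "d \<le> n" using k dvd_imp_le[of d k] by auto
      then have "{t. t \<in> {t \<in> A. s t dvd k} \<and> s t = d} = {t \<in> T. s t = d}" using d by (auto simp: A_def)
      then show "(\<Sum>t | t \<in> {t \<in> A. s t dvd k} \<and> s t = d. s t) = d * card {t \<in> T. s t = d}"
        by (simp add: mult.commute)
    qed
    finally show "(\<Sum>t\<in>A. if s t dvd k then s t * P (n - k) else 0) =
      (\<Sum>d | d dvd k. d * card {t \<in> T. s t = d}) * P (n - k)" .
  qed
  finally show ?thesis by (simp add: P_def)
qed

end

section \<open>The plethystic logarithm\<close>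

lemma prime_factorization_eq_mset_set_if_squarefree:
  fixes d :: nat
  assumes "squarefree d"
  shows "prime_factorization d = mset_set (prime_factors d)"
proof (rule multiset_eqI)
  fix p
  have d: "d \<noteq> 0" using assms by (metis not_squarefree_0)
  show "count (prime_factorization d) p = count (mset_set (prime_factors d)) p"
  proof (cases "p \<in> prime_factors d")
    case True
    then have "multiplicity p d = 1" using assms squarefree_factorial_semiring'[OF d] by blast
    then show ?thesis using True by (simp add: count_prime_factorization_prime in_prime_factors_iff)
  next
    case False
    then show ?thesis by (simp add: not_in_iff)
  qed
qed

text \<open>Squarefree divisors correspond to sets of prime factors, so the sum expands the product
  of \<open>1 - 1\<close> over the primes dividing \<open>n\<close>; this product is empty exactly
  for \<open>n = 1\<close>.\<close>

lemma sum_moebius_divisors: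
  assumes "n > 0"
  shows "(\<Sum>d | d dvd n. moebius d) = (if n = 1 then 1 else 0)"
proof -
  have fin: "finite {d. d dvd n}" using assms by simp
  have pf: "prime_factorization (\<Prod>S) = mset_set S" if S: "S \<subseteq> prime_factors n" for S
  proof -
    have "finite S" using S finite_subset by blast
    then have "prime_factorization (prod_mset (mset_set S)) = mset_set S"
      using S by (intro prime_factorization_prod_mset_primes) auto
    then show ?thesis by (simp add: prod_unfold_prod_mset)
  qed
  have "(\<Sum>d | d dvd n. moebius d) = (\<Sum>d | d dvd n \<and> squarefree d. moebius d)"
    using fin by (intro sum.mono_neutral_right) (auto simp: moebius_def)
  also have "\<dots> = (\<Sum>S\<in>Pow (prime_factors n). (-1) ^ card S)"
  proof (rule sum.reindex_bij_witness[of _ "\<lambda>S. \<Prod>S" prime_factors])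
    fix d assume d: "d \<in> {d. d dvd n \<and> squarefree d}"
    then have d0: "d \<noteq> 0" by (metis (mono_tags, lifting) mem_Collect_eq not_squarefree_0)
    show "\<Prod>(prime_factors d) = d"
      using prime_factorization_eq_mset_set_if_squarefree[of d] d d0
        prod_mset_prime_factorization_nat[of d]
      by (simp add: prod_unfold_prod_mset)
    show "prime_factors d \<in> Pow (prime_factors n)" using d assms dvd_prime_factors[of n d] by simp
    show "(-1) ^ card (prime_factors d) = moebius d" using d by (simp add: moebius_def)
  next
    fix S assume S: "S \<in> Pow (prime_factors n)"
    then have fS: "finite S" using finite_subset by blast
    have pS: "prime p" if "p \<in> S" for p using S that by auto
    have "0 \<notin> S" using pS not_prime_0 by blast
    then have S0: "\<Prod>S \<noteq> 0" using fS by simp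
    have pfS: "prime_factorization (\<Prod>S) = mset_set S" using pf S by simp
    show "prime_factors (\<Prod>S) = S" using pfS fS by simp
    have "prime_factorization (\<Prod>S) \<subseteq># prime_factorization n"
      unfolding pfS
    proof (rule mset_subset_eqI)
      show "count (mset_set S) p \<le> count (prime_factorization n) p" for p
      proof (cases "p \<in> S")
        case True
        then have "p \<in># prime_factorization n" using S by blast
        then show ?thesis using fS True by (simp add: Suc_le_eq)
      qed (use fS in simp)
    qed
    then have "\<Prod>S dvd n" using S0 assms by (simp add: prime_factorization_subset_iff_dvd)
    moreover have "multiplicity p (\<Prod>S) \<le> 1" if "prime p" for p
    proof -
      have "multiplicity p (\<Prod>S) = count (mset_set S) p"
        unfolding pfS[symmetric] by (rule count_prime_factorization_prime[OF that, symmetric])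
      then show ?thesis using fS by (simp add: count_mset_set')
    qed
    then have "squarefree (\<Prod>S)" using squarefree_factorial_semiring''[OF S0] by blast
    ultimately show "\<Prod>S \<in> {d. d dvd n \<and> squarefree d}" by simp
  qed
  also have "\<dots> = (\<Prod>p\<in>prime_factors n. 1 - 1)"
    by (subst prod_diff_conv_sum) simp_all
  also have "\<dots> = (if n = 1 then 1 else 0)"
    using assms by (simp add: power_0_left card_gt_0_iff prime_factorization_empty_iff)
  finally show ?thesis .
qed

text \<open>After exchanging the sums, the coefficient of \<open>f d\<close> is the sum of the
  Moebius function over the divisors of \<open>n div d\<close>, which vanishes unless
  \<open>d = n\<close>.\<close>

lemma moebius_inversion:
  fixes f :: "nat \<Rightarrow> 'a::comm_ring_1"
  assumes n: "n > 0"
  shows "(\<Sum>k | k dvd n. of_int (moebius k) * (\<Sum>d | d dvd n div k. f d)) = f n"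
proof -
  have fin: "finite {d. d dvd n}" using n by simp
  have "(\<Sum>k | k dvd n. of_int (moebius k) * (\<Sum>d | d dvd n div k. f d)) =
      (\<Sum>k | k dvd n. \<Sum>d | d dvd n. if k * d dvd n then of_int (moebius k) * f d else 0)"
  proof (rule sum.cong[OF refl])
    fix k assume k: "k \<in> {k. k dvd n}"
    then have "k \<noteq> 0" using n by auto
    then have "{d. d dvd n div k} = {d \<in> {d. d dvd n}. k * d dvd n}"
      using k by (auto simp: dvd_div_iff_mult mult.commute dest: dvd_mult_left)
    then show "of_int (moebius k) * (\<Sum>d | d dvd n div k. f d) =
        (\<Sum>d | d dvd n. if k * d dvd n then of_int (moebius k) * f d else 0)"
      using sum.inter_filter[OF fin] by (simp only: sum_distrib_left)
  qed
  also have "\<dots> = (\<Sum>d | d dvd n. \<Sum>k | k dvd n. if k * d dvd n then of_int (moebius k) * f d else 0)"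
    by (rule sum.swap)
  also have "\<dots> = (\<Sum>d | d dvd n. if d = n then f d else 0)"
  proof (rule sum.cong[OF refl])
    fix d assume d: "d \<in> {d. d dvd n}"
    then have d0: "d \<noteq> 0" using n by auto
    then have eq: "{k \<in> {k. k dvd n}. k * d dvd n} = {k. k dvd n div d}"
      using d by (auto simp: dvd_div_iff_mult dest: dvd_mult_left)
    have nd: "n div d > 0" using d n d0 by (auto simp: div_greater_zero_iff dest: dvd_imp_le)
    have "(\<Sum>k | k dvd n. if k * d dvd n then of_int (moebius k) * f d else 0) =
        of_int (\<Sum>k | k dvd n div d. moebius k) * f d"
      unfolding sum.inter_filter[OF fin, symmetric] eq by (simp add: sum_distrib_right)
    also have "\<dots> = (if d = n then f d else 0)"
    proof -
      have "n div d = 1 \<longleftrightarrow> d = n" using d n by auto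
      then show ?thesis by (simp add: sum_moebius_divisors[OF nd])
    qed
    finally show "(\<Sum>k | k dvd n. if k * d dvd n then of_int (moebius k) * f d else 0) =
        (if d = n then f d else 0)" .
  qed
  also have "\<dots> = f n" using fin by simp
  finally show ?thesis .
qed

context
  includes fps_syntax
begin

section \<open>Logarithms and convergence of formal power series\<close>

lemma fps_compose_X_power_nth:
  fixes a :: "'a::comm_ring_1 fps"
  assumes "k > 0"
  shows "(a oo fps_X ^ k) $ n = (if k dvd n then a $ (n div k) else 0)"
proof -
  have "(a oo fps_X ^ k) $ n = (\<Sum>i=0..n. if n = k * i then a $ i else 0)"
    by (simp add: fps_compose_nth power_mult[symmetric] fps_X_power_nth if_distrib cong: if_cong)
  also have "\<dots> = (if k dvd n then a $ (n div k) else 0)"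
  proof (cases "k dvd n")
    case True
    then have "n = k * i \<longleftrightarrow> i = n div k" for i using assms by auto
    then show ?thesis using True by simp
  next
    case False
    then show ?thesis by (auto intro!: sum.neutral)
  qed
  finally show ?thesis .
qed

text \<open>The partial sum of \<open>N\<close> terms has its final coefficients up to index
  \<open>N\<close>, so the difference from the limit has subdegree at least \<open>N\<close> and the
  distance is at most \<open>(1/2) ^ N\<close>.\<close>

lemma fps_sumsI:
  fixes g :: "nat \<Rightarrow> 'a::comm_ring_1 fps"
  assumes "\<And>n m. n \<le> m \<Longrightarrow> g m $ n = 0"
  shows "g sums Abs_fps (\<lambda>n. \<Sum>m<n. g m $ n)"
proof -
  define S where "S = Abs_fps (\<lambda>n. \<Sum>m<n. g m $ n)"
  have eq: "(\<Sum>m<N. g m) $ n = S $ n" if "n \<le> N" for n N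
  proof -
    have "(\<Sum>m<N. g m $ n) = (\<Sum>m<n. g m $ n)"
      using that assms by (intro sum.mono_neutral_right) auto
    then show ?thesis by (simp add: S_def fps_sum_nth)
  qed
  have "dist (\<Sum>m<N. g m) S \<le> (1 / 2) ^ N" for N
  proof (cases "(\<Sum>m<N. g m) = S")
    case False
    then have "(\<Sum>m<N. g m) - S \<noteq> 0" by simp
    then have "N \<le> subdegree ((\<Sum>m<N. g m) - S)"
      using eq[of _ N] by (intro subdegree_geI) auto
    then have "(2::real) ^ N \<le> 2 ^ subdegree ((\<Sum>m<N. g m) - S)" by simp
    then show ?thesis using False by (simp add: dist_fps_def field_simps power_divide)
  qed (simp add: dist_fps_def)
  then have "(\<lambda>N. dist (\<Sum>m<N. g m) S) \<longlonglongrightarrow> 0"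
    by (intro real_tendsto_sandwich[OF _ _ tendsto_const LIMSEQ_power_zero[of "1/2 :: real"]])
       (auto simp: dist_fps_ge0)
  then show ?thesis unfolding sums_def S_def[symmetric] by (subst tendsto_dist_iff)
qed

lemma fps_log_compose_X_power:
  fixes f :: "'a::field_char_0 fps"
  assumes "f $ 0 = 1" "k > 0"
  shows "fps_log (f oo fps_X ^ k) = fps_log f oo fps_X ^ k"
proof -
  have "(f oo fps_X ^ k) - 1 = (f - 1) oo fps_X ^ k"
    by (simp add: fps_compose_sub_distrib)
  then show ?thesis
    using assms by (simp add: fps_log_def fps_compose_assoc fps_X_power_nth)
qed

text \<open>This is the logarithmic derivative. The hypothesis is stated as a product, because
  comparing coefficients then turns it into the counting recursion.\<close>

lemma fps_X_mult_deriv_fps_log: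
  fixes f :: "'a::field_char_0 fps"
  assumes f: "f $ 0 = 1" and b: "fps_X * fps_deriv f = b * f"
  shows "fps_X * fps_deriv (fps_log f) = b"
proof -
  have "fps_deriv (fps_log f) = (inverse (1 + fps_X) oo (f - 1)) * fps_deriv f"
    unfolding fps_log_def using f by (simp add: fps_compose_deriv fps_ln_deriv)
  also have "inverse (1 + fps_X) oo (f - 1) = inverse ((1 + fps_X) oo (f - 1))"
    using f by (intro fps_inverse_compose) simp_all
  also have "(1 + fps_X) oo (f - 1) = f"
    using f by (simp add: fps_compose_add_distrib)
  finally have "fps_X * fps_deriv (fps_log f) = b * (inverse f * f)"
    using b by (simp add: algebra_simps)
  then show ?thesis using inverse_mult_eq_1[of f] f by simp
qed

text \<open>The recursion says that the logarithm of the series has coefficients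
  \<open>b m / m\<close> with \<open>b\<close> the divisor sums of \<open>d * c d\<close>; the
  Moebius function undoes the sum over divisors.\<close>

lemma Plog_nth:
  fixes Z b c :: "nat \<Rightarrow> nat"
  assumes Z0: "Z 0 = 1"
    and rec: "\<And>n. n * Z n = (\<Sum>k=1..n. (\<Sum>d | d dvd k. d * c d) * Z (n - k))"
  shows "Plog (Abs_fps (\<lambda>n. of_nat (Z n)) :: 'a::field_char_0 fps) $ n = (if n = 0 then 0 else of_nat (c n))"
proof -
  define f :: "'a fps" where "f = Abs_fps (\<lambda>n. of_nat (Z n))"
  define b where "b k = (\<Sum>d | d dvd k. d * c d)" for k
  define B :: "'a fps" where "B = Abs_fps (\<lambda>k. if k = 0 then 0 else of_nat (b k))"
  have f0: "f $ 0 = 1" by (simp add: f_def Z0)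
  have "fps_X * fps_deriv f = B * f"
  proof (rule fps_ext)
    fix n
    have "(fps_X * fps_deriv f) $ n = of_nat (n * Z n)"
      by (cases n) (simp_all add: f_def algebra_simps)
    also have "\<dots> = (\<Sum>k=1..n. of_nat (b k) * of_nat (Z (n - k)))"
      unfolding rec b_def by simp
    also have "\<dots> = (\<Sum>k=0..n. B $ k * f $ (n - k))"
      by (rule sum.mono_neutral_cong_left) (auto simp: B_def f_def)
    finally show "(fps_X * fps_deriv f) $ n = (B * f) $ n" by (simp add: fps_mult_nth)
  qed
  then have "fps_X * fps_deriv (fps_log f) = B" by (rule fps_X_mult_deriv_fps_log[OF f0])
  then have XL: "(fps_X * fps_deriv (fps_log f)) $ m = B $ m" for m by (rule arg_cong)
  have L: "fps_log f $ m = of_nat (b m) / of_nat m" if m: "m > 0" for m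
  proof -
    obtain j where j: "m = Suc j" using m by (cases m) auto
    have "of_nat m * fps_log f $ m = of_nat (b m)"
      using XL[of m] unfolding j by (simp add: B_def del: of_nat_Suc)
    then show ?thesis using m by (simp add: field_simps)
  qed
  have L0: "fps_log f $ 0 = 0" by (simp add: fps_log_def)
  define g :: "nat \<Rightarrow> 'a fps" where
    "g m = (let k = Suc m in fps_const (of_int (moebius k) / of_nat k) * fps_log (f oo fps_X ^ k))" for m
  have g: "g m $ n = (if Suc m dvd n then of_int (moebius (Suc m)) / of_nat (Suc m) * fps_log f $ (n div Suc m) else 0)"
    for m n
    by (simp add: g_def Let_def fps_log_compose_X_power[OF f0] fps_compose_X_power_nth del: of_nat_Suc power_Suc)
  \<comment> \<open>The summand \<open>g m\<close> belongs to \<open>k = m + 1\<close>. For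
    \<open>0 < n \<le> m\<close> this \<open>k\<close> cannot divide \<open>n\<close>; at
    \<open>n = 0\<close> it does, but the logarithm has no constant term.\<close>
  have "g m $ n = 0" if "n \<le> m" for n m
    using that L0 dvd_imp_le[of "Suc m" n] by (cases "n = 0") (auto simp: g)
  then have "g sums Abs_fps (\<lambda>n. \<Sum>m<n. g m $ n)" by (rule fps_sumsI)
  then have "Plog f = Abs_fps (\<lambda>n. \<Sum>m<n. g m $ n)"
    unfolding Plog_def g_def by (rule sums_unique[symmetric])
  then have "Plog f $ n = (\<Sum>m<n. g m $ n)" by simp
  also have "\<dots> = (if n = 0 then 0 else of_nat (c n))"
  proof (cases "n = 0")
    case False
    then have n: "n > 0" by simp
    have "(\<Sum>m<n. g m $ n) = (\<Sum>m | m \<in> {..<n} \<and> Suc m dvd n. of_int (moebius (Suc m)) / of_nat (Suc m) * fps_log f $ (n div Suc m))"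
      unfolding g by (rule sum.inter_filter[symmetric, OF finite_lessThan])
    also have "\<dots> = (\<Sum>k | k dvd n. of_int (moebius k) / of_nat k * fps_log f $ (n div k))"
    proof (rule sum.reindex_bij_witness[of _ "\<lambda>k. k - 1" Suc])
      fix k assume k: "k \<in> {k. k dvd n}"
      then have "k > 0" using n by (auto intro!: Nat.gr0I)
      then show "Suc (k - 1) = k" "k - 1 \<in> {m. m \<in> {..<n} \<and> Suc m dvd n}"
        using k n dvd_imp_le[of k n] by auto
    qed auto
    \<comment> \<open>With \<open>n = k * j\<close> the factor \<open>1 / k\<close> and the factor
      \<open>1 / j\<close> from the logarithm combine to \<open>1 / n\<close>, which is the same for
      all \<open>k\<close>.\<close>
    also have "\<dots> = (\<Sum>k | k dvd n. of_int (moebius k) * (\<Sum>d | d dvd n div k. of_nat (d * c d)) / of_nat n)"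
    proof (rule sum.cong[OF refl])
      fix k assume k: "k \<in> {k. k dvd n}"
      then obtain j where j: "n = k * j" by auto
      then have kj: "k > 0" "j > 0" using n by auto
      then have "fps_log f $ (n div k) = of_nat (b j) / of_nat j" using L[of j] j by simp
      then show "of_int (moebius k) / of_nat k * fps_log f $ (n div k) =
          of_int (moebius k) * (\<Sum>d | d dvd n div k. of_nat (d * c d)) / of_nat n"
        using j kj by (simp add: b_def)
    qed
    also have "\<dots> = of_nat (n * c n) / of_nat n"
      unfolding sum_divide_distrib[symmetric] moebius_inversion[OF n] ..
    finally show ?thesis using n by simp
  qed simp
  finally show ?thesis by (simp add: f_def)
qed

end

section \<open>Burnside counting for simultaneous conjugation\<close>

text \<open>For one permutation this is its centralizer in the symmetric group; for a family it is
  the stabilizer under simultaneous conjugation.\<close>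

definition Aut :: "'a set \<Rightarrow> ('i \<Rightarrow> 'a \<Rightarrow> 'a) \<Rightarrow> ('a \<Rightarrow> 'a) set" where
  "Aut X F = {\<tau>. \<tau> permutes X \<and> (\<forall>i. \<forall>x\<in>X. \<tau> (F i x) = F i (\<tau> x))}"

lemma finite_Aut: "finite X \<Longrightarrow> finite (Aut X F)"
  by (rule finite_subset[OF _ finite_permutations[of X]]) (auto simp: Aut_def)

lemma iso_map_Aut: "\<tau> \<in> Aut X F \<Longrightarrow> iso_map \<tau> X F X F"
  by (simp add: Aut_def iso_map_def permutes_imp_bij)

lemma Aut_comp:
  assumes "\<sigma> \<in> Aut X F" "\<tau> \<in> Aut X F"
  shows "\<sigma> \<circ> \<tau> \<in> Aut X F"
proof -
  have s: "\<sigma> permutes X" "\<tau> permutes X" using assms by (auto simp: Aut_def)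
  moreover have "\<sigma> (\<tau> (F i x)) = F i (\<sigma> (\<tau> x))" if "x \<in> X" for i x
    using assms that permutes_in_image[OF s(2), of x] by (simp add: Aut_def)
  ultimately show ?thesis by (simp add: Aut_def permutes_compose)
qed

lemma Aut_inv:
  assumes X: "perm_family X F" and t: "\<tau> \<in> Aut X F"
  shows "inv \<tau> \<in> Aut X F"
proof -
  have p: "\<tau> permutes X" using t by (simp add: Aut_def)
  have "inv \<tau> (F i x) = F i (inv \<tau> x)" if x: "x \<in> X" for i x
  proof -
    have y: "inv \<tau> x \<in> X" using permutes_in_image[OF permutes_inv[OF p]] x by blast
    then have "\<tau> (F i (inv \<tau> x)) = F i (\<tau> (inv \<tau> x))" using t by (simp add: Aut_def)
    then have "\<tau> (F i (inv \<tau> x)) = F i x" by (simp add: permutes_inverses(1)[OF p])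
    then show ?thesis using permutes_inverses(2)[OF p] by metis
  qed
  then show ?thesis using permutes_inv[OF p] by (simp add: Aut_def)
qed

lemma card_eq_card_image_mult:
  assumes "finite S" "\<And>x. x \<in> S \<Longrightarrow> card {y \<in> S. f y = f x} = k"
  shows "card S = card (f ` S) * k"
proof -
  have "card S = (\<Sum>v\<in>f ` S. \<Sum>x | x \<in> S \<and> f x = v. 1)"
    using sum.image_gen[OF assms(1), of "\<lambda>_. 1 :: nat" f] by simp
  also have "\<dots> = (\<Sum>v\<in>f ` S. k)" using assms(2) by (intro sum.cong) auto
  finally show ?thesis by simp
qed

text \<open>Orbit-stabilizer: two permutations conjugate \<open>\<sigma>\<close> to the same family
  exactly when they differ on the right by an element of \<open>Aut\<close>. So every fibre of the
  conjugation map is a coset of \<open>Aut\<close>.\<close>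

lemma conj_class_card:
  assumes s: "\<sigma> \<in> std_families n"
  shows "card {\<sigma>' \<in> std_families n. isom {1..n} \<sigma> {1..n} \<sigma>'} * card (Aut {1..n} \<sigma>) = fact n"
proof -
  define S where "S = {\<gamma>. \<gamma> permutes {1..n}}"
  define \<phi> where "\<phi> \<gamma> i = \<gamma> \<circ> \<sigma> i \<circ> inv \<gamma>" for \<gamma> :: "nat \<Rightarrow> nat" and i
  have sp: "\<sigma> i permutes {1..n}" for i using s by (simp add: std_families_def)
  have fin: "finite S" by (simp add: S_def finite_permutations)
  have fiber: "{\<gamma> \<in> S. \<phi> \<gamma> = \<phi> \<gamma>0} = (\<lambda>\<tau>. \<gamma>0 \<circ> \<tau>) ` Aut {1..n} \<sigma>" if g0: "\<gamma>0 \<in> S" for \<gamma>0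
  proof (intro equalityI subsetI)
    have p0: "\<gamma>0 permutes {1..n}" using g0 by (simp add: S_def)
    fix \<gamma> assume "\<gamma> \<in> {\<gamma> \<in> S. \<phi> \<gamma> = \<phi> \<gamma>0}"
    then have p: "\<gamma> permutes {1..n}" and eq: "\<phi> \<gamma> = \<phi> \<gamma>0" by (auto simp: S_def)
    have "inv \<gamma>0 (\<gamma> (\<sigma> i x)) = \<sigma> i (inv \<gamma>0 (\<gamma> x))" for i x
    proof -
      have "\<phi> \<gamma> i (\<gamma> x) = \<phi> \<gamma>0 i (\<gamma> x)" using eq by simp
      then have "\<gamma> (\<sigma> i x) = \<gamma>0 (\<sigma> i (inv \<gamma>0 (\<gamma> x)))" by (simp add: \<phi>_def permutes_inverses(2)[OF p])
      then show ?thesis by (simp add: permutes_inverses(2)[OF p0])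
    qed
    then have "inv \<gamma>0 \<circ> \<gamma> \<in> Aut {1..n} \<sigma>"
      using permutes_compose[OF p permutes_inv[OF p0]] by (simp add: Aut_def)
    moreover have "\<gamma> = \<gamma>0 \<circ> (inv \<gamma>0 \<circ> \<gamma>)" by (simp add: fun_eq_iff permutes_inverses(1)[OF p0])
    ultimately show "\<gamma> \<in> (\<lambda>\<tau>. \<gamma>0 \<circ> \<tau>) ` Aut {1..n} \<sigma>" by blast
  next
    have p0: "\<gamma>0 permutes {1..n}" using g0 by (simp add: S_def)
    fix \<gamma> assume "\<gamma> \<in> (\<lambda>\<tau>. \<gamma>0 \<circ> \<tau>) ` Aut {1..n} \<sigma>"
    then obtain \<tau> where t: "\<tau> \<in> Aut {1..n} \<sigma>" "\<gamma> = \<gamma>0 \<circ> \<tau>" by blast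
    have pt: "\<tau> permutes {1..n}" using t(1) by (simp add: Aut_def)
    have comm: "\<tau> (\<sigma> i x) = \<sigma> i (\<tau> x)" for i x
    proof (cases "x \<in> {1..n}")
      case True
      then show ?thesis using t(1) unfolding Aut_def by blast
    next
      case False
      then show ?thesis using permutes_not_in[OF pt False] permutes_not_in[OF sp False] by simp
    qed
    have "inv \<gamma> = inv \<tau> \<circ> inv \<gamma>0" unfolding t(2)
      by (rule o_inv_distrib[OF permutes_bij[OF p0] permutes_bij[OF pt]])
    then have "\<phi> \<gamma> i x = \<phi> \<gamma>0 i x" for i x
      by (simp add: \<phi>_def t(2) comm permutes_inverses(1)[OF pt])
    then have "\<phi> \<gamma> = \<phi> \<gamma>0" by (simp add: fun_eq_iff)
    then show "\<gamma> \<in> {\<gamma> \<in> S. \<phi> \<gamma> = \<phi> \<gamma>0}"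
      using permutes_compose[OF pt p0] t(2) by (simp add: S_def)
  qed
  have "card {\<gamma> \<in> S. \<phi> \<gamma> = \<phi> \<gamma>0} = card (Aut {1..n} \<sigma>)" if g0: "\<gamma>0 \<in> S" for \<gamma>0
  proof -
    have "inj \<gamma>0" using g0 by (simp add: S_def permutes_inj)
    then have "inj_on (\<lambda>\<tau>. \<gamma>0 \<circ> \<tau>) (Aut {1..n} \<sigma>)"
      using inj_on_subset[OF fun.inj_map subset_UNIV] by blast
    then show ?thesis unfolding fiber[OF g0] by (rule card_image)
  qed
  then have "card S = card (\<phi> ` S) * card (Aut {1..n} \<sigma>)"
    by (rule card_eq_card_image_mult[OF fin])
  moreover have "card S = fact n" unfolding S_def by (rule card_permutations) auto
  moreover have "\<phi> ` S = {\<sigma>' \<in> std_families n. isom {1..n} \<sigma> {1..n} \<sigma>'}"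
  proof (intro equalityI subsetI)
    fix \<sigma>' assume "\<sigma>' \<in> \<phi> ` S"
    then obtain \<gamma> where g: "\<gamma> permutes {1..n}" "\<sigma>' = \<phi> \<gamma>" by (auto simp: S_def)
    have "\<sigma>' \<in> std_families n" unfolding std_families_def g(2) \<phi>_def
      using permutes_compose[OF permutes_inv[OF g(1)] permutes_compose[OF sp g(1)]] by simp
    moreover have "iso_map \<gamma> {1..n} \<sigma> {1..n} \<sigma>'"
      unfolding iso_map_def g(2) \<phi>_def using permutes_imp_bij[OF g(1)] by (simp add: permutes_inverses(2)[OF g(1)])
    ultimately show "\<sigma>' \<in> {\<sigma>' \<in> std_families n. isom {1..n} \<sigma> {1..n} \<sigma>'}" unfolding isom_def by blast
  next
    fix \<sigma>' assume "\<sigma>' \<in> {\<sigma>' \<in> std_families n. isom {1..n} \<sigma> {1..n} \<sigma>'}"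
    then obtain f where s': "\<sigma>' \<in> std_families n" and f: "iso_map f {1..n} \<sigma> {1..n} \<sigma>'" by (auto simp: isom_def)
    \<comment> \<open>An isomorphism is constrained only on \<open>{1..n}\<close>; continuing it by
      the identity makes it a conjugating permutation.\<close>
    define \<gamma> where "\<gamma> x = (if x \<in> {1..n} then f x else x)" for x
    have "bij_betw \<gamma> {1..n} {1..n} \<longleftrightarrow> bij_betw f {1..n} {1..n}"
      by (rule bij_betw_cong) (simp only: \<gamma>_def if_True)
    then have p: "\<gamma> permutes {1..n}"
      using f by (intro bij_imp_permutes) (simp_all only: iso_map_def \<gamma>_def if_False)
    have "\<phi> \<gamma> i y = \<sigma>' i y" for i y
    proof (cases "y \<in> {1..n}")
      case True
      define x where "x = inv \<gamma> y"
      have y: "y = \<gamma> x" by (simp add: x_def permutes_inverses(1)[OF p])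
      have x: "x \<in> {1..n}" using permutes_in_image[OF permutes_inv[OF p], of y] True x_def by blast
      have "\<sigma> i x \<in> {1..n}" using permutes_in_image[OF sp] x by blast
      then have "\<gamma> (\<sigma> i x) = f (\<sigma> i x)" by (simp only: \<gamma>_def if_True)
      also have "\<dots> = \<sigma>' i (f x)" using f x unfolding iso_map_def by blast
      also have "f x = y" using x by (simp only: y \<gamma>_def if_True)
      finally show ?thesis by (simp add: \<phi>_def x_def)
    next
      case False
      have "\<sigma>' i permutes {1..n}" using s' by (simp add: std_families_def)
      then have "\<sigma>' i y = y" using False by (rule permutes_not_in)
      then show ?thesis
        using permutes_not_in[OF p False] permutes_not_in[OF permutes_inv[OF p] False]
          permutes_not_in[OF sp False] by (simp add: \<phi>_def)
    qed
    then have "\<sigma>' = \<phi> \<gamma>" by (simp add: fun_eq_iff)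
    then show "\<sigma>' \<in> \<phi> ` S" using p by (auto simp: S_def)
  qed
  ultimately show ?thesis by simp
qed

lemma finite_std_families: "finite (std_families n :: ('i::finite \<Rightarrow> nat \<Rightarrow> nat) set)"
proof -
  have "std_families n = (PiE UNIV (\<lambda>_::'i. {\<gamma>. \<gamma> permutes {1..n}}))" by (auto simp: std_families_def PiE_def)
  then show ?thesis by (simp add: finite_PiE finite_permutations)
qed

text \<open>Class size times order of \<open>Aut\<close> is \<open>fact n\<close>, so each class
  contributes its weight \<open>fact n\<close> times. Weight 1 counts classes; the centralizer order
  as weight turns a sum of squares over permutations into a sum over cycle types.\<close>

lemma weighted_burnside:
  fixes k :: "('i::finite \<Rightarrow> nat \<Rightarrow> nat) \<Rightarrow> 'b"
  assumes k: "\<And>\<sigma> \<tau>. \<sigma> \<in> std_families n \<Longrightarrow> \<tau> \<in> std_families n \<Longrightarrow> k \<sigma> = k \<tau> \<longleftrightarrow> isom {1..n} \<sigma> {1..n} \<tau>"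
  shows "(\<Sum>\<sigma>\<in>std_families n. h (k \<sigma>) * card (Aut {1..n} \<sigma>)) = fact n * (\<Sum>t\<in>k ` std_families n. h t)"
proof -
  have "(\<Sum>\<sigma>\<in>std_families n. h (k \<sigma>) * card (Aut {1..n} \<sigma>)) =
      (\<Sum>t\<in>k ` std_families n. \<Sum>\<sigma> | \<sigma> \<in> std_families n \<and> k \<sigma> = t. h (k \<sigma>) * card (Aut {1..n} \<sigma>))"
    by (rule sum.image_gen[OF finite_std_families])
  also have "\<dots> = (\<Sum>t\<in>k ` std_families n. fact n * h t)"
  proof (rule sum.cong[OF refl])
    fix t assume "t \<in> k ` std_families n"
    then obtain \<sigma>0 where s0: "\<sigma>0 \<in> std_families n" "t = k \<sigma>0" by blast
    define K where "K = {\<sigma> \<in> std_families n. k \<sigma> = t}"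
    have K: "finite K" "\<sigma>0 \<in> K" using s0 by (simp_all add: K_def finite_std_families)
    then have cK: "card K > 0" using card_gt_0_iff by blast
    have "h (k \<sigma>) * card (Aut {1..n} \<sigma>) = h t * (fact n div card K)" if s: "\<sigma> \<in> K" for \<sigma>
    proof -
      have s': "\<sigma> \<in> std_families n" "k \<sigma> = t" using s by (auto simp: K_def)
      have "isom {1..n} \<sigma> {1..n} \<sigma>' \<longleftrightarrow> k \<sigma>' = t" if "\<sigma>' \<in> std_families n" for \<sigma>'
        using k[OF s'(1) that] s'(2) by metis
      then have "{\<sigma>' \<in> std_families n. isom {1..n} \<sigma> {1..n} \<sigma>'} = K" unfolding K_def by blast
      then have "card K * card (Aut {1..n} \<sigma>) = fact n" using conj_class_card[OF s'(1)] by simp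
      then have "card (Aut {1..n} \<sigma>) = fact n div card K" using cK by (metis nonzero_mult_div_cancel_left less_irrefl)
      then show ?thesis using s' by simp
    qed
    then have "(\<Sum>\<sigma>\<in>K. h (k \<sigma>) * card (Aut {1..n} \<sigma>)) = card K * (h t * (fact n div card K))"
      by simp
    moreover have "card K dvd fact n"
    proof -
      have "isom {1..n} \<sigma>0 {1..n} \<sigma>' \<longleftrightarrow> k \<sigma>' = t" if "\<sigma>' \<in> std_families n" for \<sigma>'
        using k[OF s0(1) that] s0(2) by metis
      then have "{\<sigma>' \<in> std_families n. isom {1..n} \<sigma>0 {1..n} \<sigma>'} = K" unfolding K_def by blast
      then have "card K * card (Aut {1..n} \<sigma>0) = fact n" using conj_class_card[OF s0(1)] by simp
      then show ?thesis by (rule dvdI[OF sym])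
    qed
    ultimately show "(\<Sum>\<sigma> | \<sigma> \<in> std_families n \<and> k \<sigma> = t. h (k \<sigma>) * card (Aut {1..n} \<sigma>)) = fact n * h t"
      unfolding K_def[symmetric] by (simp add: mult.left_commute)
  qed
  finally show ?thesis by (simp add: sum_distrib_left)
qed

section \<open>Orders of centralizers\<close>

text \<open>The standard cycle of length \<open>n\<close>; the dummy argument makes it a family
  indexed by \<open>unit\<close>.\<close>

definition succ_mod :: "nat \<Rightarrow> unit \<Rightarrow> nat \<Rightarrow> nat" where
  "succ_mod n u m = Suc m mod n"

lemma perm_family_succ_mod: "n > 0 \<Longrightarrow> perm_family {..<n} (succ_mod n)"
proof -
  assume n: "n > 0"
  have "inj_on (\<lambda>m. Suc m mod n) {..<n}"
  proof (rule inj_onI)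
    fix x y assume xy: "x \<in> {..<n}" "y \<in> {..<n}" "Suc x mod n = Suc y mod n"
    then show "x = y" by (cases "Suc x = n"; cases "Suc y = n") (auto simp: mod_less)
  qed
  moreover have "(\<lambda>m. Suc m mod n) ` {..<n} \<subseteq> {..<n}" using n by auto
  ultimately have "bij_betw (\<lambda>m. Suc m mod n) {..<n} {..<n}"
    by (simp add: bij_betw_def endo_inj_surj)
  moreover have "succ_mod n i = (\<lambda>m. Suc m mod n)" for i by (simp add: fun_eq_iff succ_mod_def)
  ultimately show ?thesis by (simp add: perm_family_def)
qed

lemma transitive_succ_mod:
  assumes n: "n > 0"
  shows "transitive {..<n} (succ_mod n)"
proof -
  have "S = {..<n}" if S: "S \<subseteq> {..<n}" "S \<noteq> {}" "\<forall>i. \<forall>x\<in>{..<n}. x \<in> S \<longleftrightarrow> succ_mod n i x \<in> S" for S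
  proof -
    obtain x where x: "x \<in> S" using S(2) by blast
    have step: "(x + k) mod n \<in> S" for k
    proof (induction k)
      case 0
      then show ?case using x S(1) by auto
    next
      case (Suc k)
      have "(x + k) mod n \<in> {..<n}" using n by simp
      then have "succ_mod n () ((x + k) mod n) \<in> S" using S(3) Suc by blast
      then show ?case by (simp add: succ_mod_def mod_Suc_eq)
    qed
    \<comment> \<open>From \<open>x\<close>, \<open>n - x\<close> steps wrap round to
      \<open>0\<close>, and \<open>y\<close> further steps end at \<open>y\<close>.\<close>
    have "y \<in> S" if y: "y < n" for y
    proof -
      have "x < n" using x S(1) by auto
      then have "(x + (y + (n - x))) mod n = y" using y by simp
      then show ?thesis using step[of "y + (n - x)"] by simp
    qed
    then show ?thesis using S(1) by auto
  qed
  then show ?thesis using n unfolding transitive_iff_closed[OF perm_family_succ_mod[OF n]] by blast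
qed

text \<open>The isomorphism is \<open>m\<close> mapped to the \<open>m\<close>-th iterate at
  \<open>x\<close>. The free choice of the base point later yields centralizer elements with a
  prescribed value at a point.\<close>

lemma cycle_iso_map:
  fixes F :: "unit \<Rightarrow> 'a \<Rightarrow> 'a"
  assumes X: "perm_family X F" and c: "transitive X F" and x: "x \<in> X"
  obtains h where "iso_map h {..<card X} (succ_mod (card X)) X F" "h 0 = x"
proof -
  define f where "f = F ()"
  define h where "h m = (f ^^ m) x" for m
  define n where "n = card X"
  have bf: "bij_betw f X X" unfolding f_def by (rule perm_familyD(2)[OF X])
  have hX: "h m \<in> X" for m
    by (induction m) (use x bij_betw_apply[OF bf] in \<open>simp_all add: h_def\<close>)
  \<comment> \<open>An injective self-map of a finite set is onto, so forward invariance already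
    gives the two-sided closedness that transitivity is tested with.\<close>
  have closed: "S = X" if S: "S \<subseteq> X" "S \<noteq> {}" "f ` S \<subseteq> S" for S
  proof (rule transitive_closed_subset[OF c S(1,2)])
    fix i y assume y: "y \<in> X"
    have "finite S" using S(1) perm_familyD(1)[OF X] finite_subset by blast
    moreover have "inj_on f S" using bf S(1) inj_on_subset unfolding bij_betw_def by blast
    ultimately have fS: "f ` S = S" using S(3) endo_inj_surj by blast
    have "y \<in> S" if "f y \<in> S"
    proof -
      obtain z where z: "z \<in> S" "f y = f z" using fS \<open>f y \<in> S\<close> by (metis imageE)
      then have "y = z" using bij_betw_imp_inj_on[OF bf] y S(1) unfolding inj_on_def by blast
      then show ?thesis using z by simp
    qed
    then show "y \<in> S \<longleftrightarrow> F i y \<in> S" using S(3) by (auto simp: f_def)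
  qed
  \<comment> \<open>If the \<open>j\<close>-th iterate repeated an earlier one, the first
    \<open>j\<close> iterates would form a nonempty invariant set, hence all of \<open>X\<close>,
    although \<open>j < n\<close>.\<close>
  have notin: "h j \<notin> h ` {..<j}" if j: "j < n" for j
  proof
    assume a: "h j \<in> h ` {..<j}"
    then have j0: "j > 0" by (cases j) auto
    have "f ` h ` {..<j} \<subseteq> h ` {..<j}"
    proof
      fix y assume "y \<in> f ` h ` {..<j}"
      then obtain m where m: "m < j" "y = h (Suc m)" by (auto simp: h_def)
      then show "y \<in> h ` {..<j}" using a by (cases "Suc m = j") auto
    qed
    then have "h ` {..<j} = X" using j0 hX by (intro closed) auto
    then have "n \<le> j" using card_image_le[of "{..<j}" h] by (simp add: n_def)
    then show False using j by simp
  qed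
  have inj: "inj_on h {..<n}"
  proof (rule linorder_inj_onI)
    fix i j assume ij: "i < j" "i \<in> {..<n}" "j \<in> {..<n}"
    then have "h i \<in> h ` {..<j}" by simp
    moreover have "h j \<notin> h ` {..<j}" using notin[of j] ij(3) by simp
    ultimately show "h i \<noteq> h j" by metis
  qed auto
  have img: "h ` {..<n} = X"
    using hX card_image[OF inj] by (intro card_subset_eq[OF perm_familyD(1)[OF X]]) (auto simp: n_def)
  \<comment> \<open>The cycle closes at its starting point: if \<open>h n = h m\<close> with
    \<open>m > 0\<close>, cancelling one application of the permutation makes
    \<open>h (n - 1)\<close> and \<open>h (m - 1)\<close> equal, against injectivity.\<close>
  have "h n = x"
  proof -
    obtain m where m: "m < n" "h n = h m" using hX[of n] img by blast
    have "m = 0"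
    proof (rule ccontr)
      assume "m \<noteq> 0"
      then obtain m' n' where mn: "m = Suc m'" "n = Suc n'" using m(1) by (metis not0_implies_Suc not_less_zero)
      then have "f (h n') = f (h m')" using m(2) by (simp add: h_def)
      then have "h n' = h m'" using bij_betw_imp_inj_on[OF bf] hX unfolding inj_on_def by blast
      then show False using inj_onD[OF inj, of n' m'] m(1) mn by simp
    qed
    then show ?thesis using m by (simp add: h_def)
  qed
  have "iso_map h {..<n} (succ_mod n) X F"
    unfolding iso_map_def
  proof (intro conjI allI ballI)
    show "bij_betw h {..<n} X" using inj img by (simp add: bij_betw_def)
    fix i m assume "m \<in> {..<n}"
    then show "h (succ_mod n i m) = F i (h m)"
      using \<open>h n = x\<close> by (cases "Suc m = n") (auto simp: succ_mod_def h_def f_def)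
  qed
  then show thesis using that[of h] by (simp add: n_def h_def)
qed

lemma cycles_iso_map:
  fixes F :: "unit \<Rightarrow> 'a \<Rightarrow> 'a" and G :: "unit \<Rightarrow> 'b \<Rightarrow> 'b"
  assumes X: "perm_family X F" "transitive X F" "x \<in> X" and Y: "perm_family Y G" "transitive Y G" "y \<in> Y" and eq: "card X = card Y"
  obtains g where "iso_map g X F Y G" "g x = y"
proof -
  obtain h where h: "iso_map h {..<card X} (succ_mod (card X)) X F" "h 0 = x"
    using cycle_iso_map[OF X] by blast
  obtain k where k: "iso_map k {..<card X} (succ_mod (card X)) Y G" "k 0 = y"
    using cycle_iso_map[OF Y] unfolding eq by blast
  have "X \<noteq> {}" using X(3) by blast
  then have n: "card X > 0" using perm_familyD(1)[OF X(1)] by (simp add: card_gt_0_iff)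
  have "bij_betw h {..<card X} X" using h(1) by (simp add: iso_map_def)
  then have "inv_into {..<card X} h x = 0"
    using h(2) n bij_betw_inv_into_left[of h "{..<card X}" X 0] by simp
  then have "(k \<circ> inv_into {..<card X} h) x = y" using k(2) by simp
  moreover have "iso_map (k \<circ> inv_into {..<card X} h) X F Y G"
    by (rule iso_map_comp[OF iso_map_inv[OF h(1) perm_family_succ_mod[OF n]] k(1)])
  ultimately show thesis using that by blast
qed

definition cycle_type :: "'a set \<Rightarrow> (unit \<Rightarrow> 'a \<Rightarrow> 'a) \<Rightarrow> nat multiset" where
  "cycle_type X F = image_mset card (mset_set (orbits X F))"

lemma cycle_type_eq_image_iso_type_mset: "cycle_type X F = image_mset fst (iso_type_mset X F)"
  by (simp add: cycle_type_def iso_type_mset_def image_mset.compositionality o_def fst_iso_type)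

text \<open>For one permutation, transitive systems of equal size are isomorphic, so orbit
  cardinalities are a sufficient key.\<close>

lemma cycle_type_eq_iff:
  assumes X: "perm_family X F" and Y: "perm_family Y G"
  shows "cycle_type X F = cycle_type Y G \<longleftrightarrow> isom X F Y G"
proof
  assume "isom X F Y G"
  then show "cycle_type X F = cycle_type Y G" using iso_type_mset_eq_iff[OF X Y] by (simp add: cycle_type_eq_image_iso_type_mset)
next
  assume eq: "cycle_type X F = cycle_type Y G"
  show "isom X F Y G"
  proof (rule isom_if_image_mset_orbits_eq[OF X Y eq[unfolded cycle_type_def]])
    fix C D assume C: "C \<in> orbits X F" and D: "D \<in> orbits Y G" and c: "card C = card D"
    obtain x y where "x \<in> C" "y \<in> D" using orbits_nonempty[OF C] orbits_nonempty[OF D] by blast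
    then obtain g where "iso_map g C F D G"
      using cycles_iso_map[OF perm_family_orbit[OF X C] transitive_orbit[OF X C] _ perm_family_orbit[OF Y D] transitive_orbit[OF Y D] _ c] by blast
    then show "isom C F D G" unfolding isom_def by blast
  qed
qed

lemma orbits_Diff_orbit:
  assumes X: "perm_family X F" and C: "C \<in> orbits X F"
  shows "perm_family (X - C) F" "orbits (X - C) F = orbits X F - {C}"
proof -
  show f: "perm_family (X - C) F"
  proof (rule perm_family_subset[OF X])
    fix i x assume "x \<in> X - C"
    then show "F i x \<in> X - C" using perm_familyD(3)[OF X] orbits_closed_rev[OF X C] by blast
  qed blast
  show "orbits (X - C) F = orbits X F - {C}"
  proof (rule orbits_eqI[OF f])
    show "\<Union>(orbits X F - {C}) = X - C"
    proof (intro equalityI subsetI)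
      fix x assume "x \<in> \<Union>(orbits X F - {C})"
      then obtain D where "D \<in> orbits X F" "D \<noteq> C" "x \<in> D" by blast
      then show "x \<in> X - C" using orbits_disjoint[OF C, of D] orbits_subset[of D X F] by auto
    next
      fix x assume x: "x \<in> X - C"
      then obtain D where "D \<in> orbits X F" "x \<in> D" using Union_orbits[of X F] by auto
      then show "x \<in> \<Union>(orbits X F - {C})" using x by auto
    qed
    show "D = E \<or> D \<inter> E = {}" if "D \<in> orbits X F - {C}" "E \<in> orbits X F - {C}" for D E
      using orbits_disjoint[of D X F E] that by simp
    show "F i x \<in> D" if "D \<in> orbits X F - {C}" "x \<in> D" for D i x
      using orbits_closed[OF X, of D x i] that by simp
    show "transitive D F" if "D \<in> orbits X F - {C}" for D using transitive_orbit[OF X, of D] that by simp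
  qed
qed

lemma cycle_type_Diff_orbit:
  assumes X: "perm_family X F" and C: "C \<in> orbits X F"
  shows "cycle_type X F = add_mset (card C) (cycle_type (X - C) F)"
proof -
  have "mset_set (orbits X F) = add_mset C (mset_set (orbits X F - {C}))"
    using C finite_orbits[OF perm_familyD(1)[OF X], of F] mset_set.remove by metis
  then show ?thesis by (simp add: cycle_type_def orbits_Diff_orbit(2)[OF X C])
qed

text \<open>A centralizer element maps a cycle onto a cycle of the same length. Conversely, an
  isomorphism from \<open>C\<close> to \<open>D\<close> taking \<open>x\<close> to \<open>y\<close>
  extends to \<open>X\<close>: removing equal lengths leaves complements of equal cycle type, which
  are therefore isomorphic.\<close>

lemma Aut_orbit:
  fixes F :: "unit \<Rightarrow> 'a \<Rightarrow> 'a"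
  assumes X: "perm_family X F" and C: "C \<in> orbits X F" and x: "x \<in> C"
  shows "(\<lambda>\<tau>. \<tau> x) ` Aut X F = \<Union>{D \<in> orbits X F. card D = card C}"
proof (intro equalityI subsetI)
  fix y assume "y \<in> (\<lambda>\<tau>. \<tau> x) ` Aut X F"
  then obtain \<tau> where t: "\<tau> \<in> Aut X F" "y = \<tau> x" by blast
  have i: "iso_map \<tau> X F X F" by (rule iso_map_Aut[OF t(1)])
  have "\<tau> ` C \<in> orbits X F" using orbits_iso_map[OF X i] C by blast
  moreover have "card (\<tau> ` C) = card C"
    using i orbits_subset[OF C] inj_on_subset unfolding iso_map_def bij_betw_def by (blast intro: card_image)
  ultimately show "y \<in> \<Union>{D \<in> orbits X F. card D = card C}" using t(2) x by blast
next
  fix y assume "y \<in> \<Union>{D \<in> orbits X F. card D = card C}"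
  then obtain D where D: "D \<in> orbits X F" "card D = card C" "y \<in> D" by blast
  obtain g where g: "iso_map g C F D F" "g x = y"
    using cycles_iso_map[OF perm_family_orbit[OF X C] transitive_orbit[OF X C] x perm_family_orbit[OF X D(1)] transitive_orbit[OF X D(1)] D(3)] D(2)
    by metis
  have "add_mset (card C) (cycle_type (X - C) F) = add_mset (card D) (cycle_type (X - D) F)"
    using cycle_type_Diff_orbit[OF X C] cycle_type_Diff_orbit[OF X D(1)] by simp
  then have "cycle_type (X - C) F = cycle_type (X - D) F" using D(2) by simp
  then obtain k where k: "iso_map k (X - C) F (X - D) F"
    using cycle_type_eq_iff[OF orbits_Diff_orbit(1)[OF X C] orbits_Diff_orbit(1)[OF X D(1)]] by (auto simp: isom_def)
  define \<tau> where "\<tau> z = (if z \<in> C then g z else if z \<in> X - C then k z else z)" for z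
  have CX: "C \<union> (X - C) = X" "D \<union> (X - D) = X" using orbits_subset[OF C] orbits_subset[OF D(1)] by auto
  have "bij_betw (\<lambda>z. if z \<in> C then g z else k z) (C \<union> (X - C)) (D \<union> (X - D))"
    using g(1) k by (intro bij_betw_disjoint_Un) (auto simp: iso_map_def)
  then have "bij_betw (\<lambda>z. if z \<in> C then g z else k z) X X" unfolding CX .
  moreover have "bij_betw \<tau> X X \<longleftrightarrow> bij_betw (\<lambda>z. if z \<in> C then g z else k z) X X"
    by (rule bij_betw_cong) (simp add: \<tau>_def)
  ultimately have "\<tau> permutes X"
    using orbits_subset[OF C] by (intro bij_imp_permutes) (auto simp: \<tau>_def)
  moreover have "\<tau> (F i z) = F i (\<tau> z)" if z: "z \<in> X" for i z
  proof (cases "z \<in> C")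
    case True
    then have "F i z \<in> C" by (rule orbits_closed[OF X C])
    then show ?thesis using True g(1) by (simp add: \<tau>_def iso_map_def)
  next
    case False
    then have "F i z \<in> X - C" using perm_familyD(3)[OF orbits_Diff_orbit(1)[OF X C]] z by blast
    then show ?thesis using False z k by (simp add: \<tau>_def iso_map_def)
  qed
  ultimately have "\<tau> \<in> Aut X F" by (simp add: Aut_def)
  moreover have "\<tau> x = y" using x g(2) by (simp add: \<tau>_def)
  ultimately show "y \<in> (\<lambda>\<tau>. \<tau> x) ` Aut X F" by blast
qed

text \<open>The points of an orbit fixed by an automorphism form a closed set, so fixing one point
  means fixing the whole orbit; only the action on the complement remains.\<close>

lemma Aut_stabilizer:
  assumes X: "perm_family X F" and C: "C \<in> orbits X F" and x: "x \<in> C"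
  shows "{\<tau> \<in> Aut X F. \<tau> x = x} = Aut (X - C) F"
proof (intro equalityI subsetI)
  fix \<tau> assume "\<tau> \<in> {\<tau> \<in> Aut X F. \<tau> x = x}"
  then have p: "\<tau> permutes X" and comm: "\<And>i z. z \<in> X \<Longrightarrow> \<tau> (F i z) = F i (\<tau> z)" and fx: "\<tau> x = x"
    by (auto simp: Aut_def)
  have CX: "C \<subseteq> X" by (rule orbits_subset[OF C])
  have "{z \<in> C. \<tau> z = z} = C"
  proof (rule transitive_closed_subset[OF transitive_orbit[OF X C]])
    fix i z assume z: "z \<in> C" "F i z \<in> C"
    have zX: "z \<in> X" using z(1) CX by (rule rev_subsetD)
    then have "\<tau> z \<in> X" by (simp only: permutes_in_image[OF p])
    then have "F i (\<tau> z) = F i z \<longleftrightarrow> \<tau> z = z"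
      using zX by (rule inj_on_eq_iff[OF bij_betw_imp_inj_on[OF perm_familyD(2)[OF X]]])
    moreover have "\<tau> (F i z) = F i (\<tau> z)" by (rule comm[OF zX])
    ultimately show "z \<in> {z \<in> C. \<tau> z = z} \<longleftrightarrow> F i z \<in> {z \<in> C. \<tau> z = z}"
      using z by simp
  qed (use x fx in auto)
  then have fixC: "\<tau> z = z" if "z \<in> C" for z using that by blast
  have "\<tau> permutes (X - C)" by (rule permutes_superset[OF p]) (simp add: fixC)
  then show "\<tau> \<in> Aut (X - C) F" using comm by (simp add: Aut_def)
next
  fix \<tau> assume t: "\<tau> \<in> Aut (X - C) F"
  then have p: "\<tau> permutes (X - C)" by (simp add: Aut_def)
  have fixC: "\<tau> z = z" if "z \<in> C" for z using permutes_not_in[OF p] that by simp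
  have "\<tau> (F i z) = F i (\<tau> z)" if z: "z \<in> X" for i z
  proof (cases "z \<in> C")
    case True
    then show ?thesis using fixC orbits_closed[OF X C True] by simp
  next
    case False
    then show ?thesis using t z by (simp add: Aut_def)
  qed
  then show "\<tau> \<in> {\<tau> \<in> Aut X F. \<tau> x = x}"
    using permutes_subset[OF p] fixC[OF x] by (simp add: Aut_def)
qed

text \<open>The classical number \<open>z\<close> of a partition: the product of
  \<open>i ^ m_i * m_i!\<close> over the parts \<open>i\<close> with multiplicities
  \<open>m_i\<close>.\<close>

definition centralizer_order :: "nat multiset \<Rightarrow> nat" where
  "centralizer_order M = (\<Prod>i\<in>set_mset M. i ^ count M i * fact (count M i))"

lemma centralizer_order_superset: "finite A \<Longrightarrow> set_mset M \<subseteq> A \<Longrightarrow> centralizer_order M = (\<Prod>i\<in>A. i ^ count M i * fact (count M i))"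
  unfolding centralizer_order_def by (rule prod.mono_neutral_left) (auto simp: not_in_iff)

lemma centralizer_order_add_mset: "centralizer_order (add_mset i M) = i * Suc (count M i) * centralizer_order M"
proof -
  define A where "A = set_mset (add_mset i M)"
  have A: "finite A" "i \<in> A" and sub: "set_mset M \<subseteq> A" "set_mset (add_mset i M) \<subseteq> A"
    by (auto simp: A_def)
  have zM: "centralizer_order M = i ^ count M i * fact (count M i) * (\<Prod>j\<in>A - {i}. j ^ count M j * fact (count M j))"
    unfolding centralizer_order_superset[OF A(1) sub(1)] by (rule prod.remove[OF A])
  have "centralizer_order (add_mset i M) = i ^ count (add_mset i M) i * fact (count (add_mset i M) i) *
      (\<Prod>j\<in>A - {i}. j ^ count (add_mset i M) j * fact (count (add_mset i M) j))"
    unfolding centralizer_order_superset[OF A(1) sub(2)] by (rule prod.remove[OF A])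
  also have "(\<Prod>j\<in>A - {i}. j ^ count (add_mset i M) j * fact (count (add_mset i M) j)) =
      (\<Prod>j\<in>A - {i}. j ^ count M j * fact (count M j))"
    by (rule prod.cong) auto
  finally show ?thesis unfolding zM by (simp add: algebra_simps)
qed

text \<open>Orbit-stabilizer at a point of a cycle \<open>C\<close>: its orbit consists of all
  cycles of length \<open>card C\<close>, and its stabilizer is the centralizer on
  \<open>X - C\<close>. This is the recursion satisfied by \<open>centralizer_order\<close> when one
  part is added.\<close>

lemma card_Aut_eq_centralizer_order:
  fixes F :: "unit \<Rightarrow> 'a \<Rightarrow> 'a"
  assumes "perm_family X F"
  shows "card (Aut X F) = centralizer_order (cycle_type X F)"
  using assms
proof (induction "card X" arbitrary: X rule: less_induct)
  case less
  note X = less.prems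
  show ?case
  proof (cases "X = {}")
    case True
    have "Aut {} F = {id}" by (auto simp: Aut_def)
    moreover have "orbits {} F = {}" using Union_orbits[of "{}" F] orbits_nonempty[of _ "{}" F] by blast
    ultimately show ?thesis using True by (simp add: cycle_type_def centralizer_order_def)
  next
    case False
    then obtain x C where x: "x \<in> C" and C: "C \<in> orbits X F" using Union_orbits[of X F] by blast
    have CX: "C \<subseteq> X" by (rule orbits_subset[OF C])
    have fin: "finite X" by (rule perm_familyD(1)[OF X])
    have "card (X - C) < card X" using x CX fin by (intro psubset_card_mono) auto
    then have IH: "card (Aut (X - C) F) = centralizer_order (cycle_type (X - C) F)"
      using less.hyps orbits_Diff_orbit(1)[OF X C] by blast
    have fib: "card {\<tau> \<in> Aut X F. \<tau> x = \<tau>0 x} = card (Aut (X - C) F)" if t0: "\<tau>0 \<in> Aut X F" for \<tau>0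
    proof -
      have p0: "\<tau>0 permutes X" using t0 by (simp add: Aut_def)
      have "{\<tau> \<in> Aut X F. \<tau> x = \<tau>0 x} = (\<lambda>\<rho>. \<tau>0 \<circ> \<rho>) ` {\<rho> \<in> Aut X F. \<rho> x = x}"
      proof (intro equalityI subsetI)
        fix \<tau> assume t: "\<tau> \<in> {\<tau> \<in> Aut X F. \<tau> x = \<tau>0 x}"
        then have "inv \<tau>0 \<circ> \<tau> \<in> {\<rho> \<in> Aut X F. \<rho> x = x}"
          using Aut_comp[OF Aut_inv[OF X t0]] by (simp add: permutes_inverses(2)[OF p0])
        moreover have "\<tau> = \<tau>0 \<circ> (inv \<tau>0 \<circ> \<tau>)" by (simp add: fun_eq_iff permutes_inverses(1)[OF p0])
        ultimately show "\<tau> \<in> (\<lambda>\<rho>. \<tau>0 \<circ> \<rho>) ` {\<rho> \<in> Aut X F. \<rho> x = x}" by blast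
      next
        fix \<tau> assume "\<tau> \<in> (\<lambda>\<rho>. \<tau>0 \<circ> \<rho>) ` {\<rho> \<in> Aut X F. \<rho> x = x}"
        then show "\<tau> \<in> {\<tau> \<in> Aut X F. \<tau> x = \<tau>0 x}" using Aut_comp[OF t0] by auto
      qed
      moreover have "inj_on (\<lambda>\<rho>. \<tau>0 \<circ> \<rho>) {\<rho> \<in> Aut X F. \<rho> x = x}"
        using inj_on_subset[OF fun.inj_map[OF permutes_inj[OF p0]] subset_UNIV] by blast
      ultimately show ?thesis using Aut_stabilizer[OF X C x] by (simp add: card_image)
    qed
    have "card (Aut X F) = card ((\<lambda>\<tau>. \<tau> x) ` Aut X F) * card (Aut (X - C) F)"
      using card_eq_card_image_mult[OF finite_Aut[OF fin], of F "\<lambda>\<tau>. \<tau> x"] fib by simp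
    also have "card ((\<lambda>\<tau>. \<tau> x) ` Aut X F) = (\<Sum>D | D \<in> orbits X F \<and> card D = card C. card D)"
      unfolding Aut_orbit[OF X C x]
      using orbits_disjoint[of _ X F] finite_subset[OF orbits_subset fin]
      by (intro card_Union_disjoint) (auto simp: pairwise_def disjnt_def)
    also have "\<dots> = card C * count (cycle_type X F) (card C)"
      using finite_orbits[OF fin, of F] by (simp add: cycle_type_def count_image_mset_eq_card_vimage)
    also have "\<dots> = card C * Suc (count (cycle_type (X - C) F) (card C))"
      by (simp add: cycle_type_Diff_orbit[OF X C])
    finally show ?thesis by (simp add: IH cycle_type_Diff_orbit[OF X C] centralizer_order_add_mset)
  qed
qed

section \<open>Number of pairs of permutations up to conjugation\<close>

text \<open>Every partition occurs: its parts are replaced by the types of standard cycles, and the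
  resulting multiset of transitive types is realised.\<close>

lemma cycle_type_image_std_families: "cycle_type {1..n} ` std_families n = {M. 0 \<notin># M \<and> sum_mset M = n}"
proof (intro equalityI subsetI)
  fix M assume "M \<in> cycle_type {1..n} ` std_families n"
  then obtain \<sigma> where s: "\<sigma> \<in> std_families n" "M = cycle_type {1..n} \<sigma>" by blast
  note f = perm_family_std_families[OF s(1)]
  have "card C \<noteq> 0" if C: "C \<in> orbits {1..n} \<sigma>" for C
    using orbits_nonempty[OF C] finite_subset[OF orbits_subset[OF C]] by simp
  then have "0 \<notin># M" using finite_orbits[of "{1..n}" \<sigma>] unfolding s(2) cycle_type_def by fastforce
  moreover have "sum_mset M = n" using sum_iso_type_mset[OF f] by (simp add: s(2) cycle_type_eq_image_iso_type_mset)
  ultimately show "M \<in> {M. 0 \<notin># M \<and> sum_mset M = n}" by simp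
next
  fix M :: "nat multiset" assume M: "M \<in> {M. 0 \<notin># M \<and> sum_mset M = n}"
  define M' where "M' = image_mset (\<lambda>k. iso_type {..<k} (succ_mod k)) M"
  have fst: "image_mset fst M' = M" by (simp add: M'_def image_mset.compositionality o_def fst_iso_type)
  have "iso_type {..<k} (succ_mod k) \<in> (\<Union>k. transitive_types k)" if k: "k \<in># M" for k
  proof -
    have "k > 0" using M k by (cases k) auto
    then show ?thesis using iso_type_transitive_in_transitive_types[OF perm_family_succ_mod transitive_succ_mod] by blast
  qed
  then have "set_mset M' \<subseteq> (\<Union>k. transitive_types k)" by (auto simp: M'_def)
  then obtain \<sigma> where s: "\<sigma> \<in> std_families (sum_mset (image_mset fst M'))"
      "iso_type_mset {1..sum_mset (image_mset fst M')} \<sigma> = M'"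
    by (rule ex_iso_type_mset)
  have n: "sum_mset (image_mset fst M') = n" using M fst by simp
  have "cycle_type {1..n} \<sigma> = M" using s(2) unfolding n cycle_type_eq_image_iso_type_mset by (simp only: fst)
  then show "M \<in> cycle_type {1..n} ` std_families n" using s(1) unfolding n by blast
qed

text \<open>Commuting with a pair means commuting with each component independently, so the
  admissible pairs form the square of the centralizer of \<open>\<tau>\<close>.\<close>

lemma card_commuting_pairs:
  assumes t: "\<tau> permutes {1..n}"
  shows "card {\<sigma> :: bool \<Rightarrow> nat \<Rightarrow> nat. \<sigma> \<in> std_families n \<and> \<tau> \<in> Aut {1..n} \<sigma>} =
    card (Aut {1..n} (\<lambda>_::unit. \<tau>)) * card (Aut {1..n} (\<lambda>_::unit. \<tau>))"
proof -
  define A where "A = Aut {1..n} (\<lambda>_::unit. \<tau>)"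
  have A: "\<alpha> \<in> A \<longleftrightarrow> \<alpha> permutes {1..n} \<and> (\<forall>x\<in>{1..n}. \<tau> (\<alpha> x) = \<alpha> (\<tau> x))" for \<alpha>
    unfolding A_def Aut_def mem_Collect_eq by metis
  have "bij_betw (\<lambda>\<sigma> :: bool \<Rightarrow> nat \<Rightarrow> nat. (\<sigma> True, \<sigma> False)) {\<sigma>. \<sigma> \<in> std_families n \<and> \<tau> \<in> Aut {1..n} \<sigma>} (A \<times> A)"
  proof (rule bij_betw_byWitness[of _ "\<lambda>(\<alpha>, \<beta>) b. if b then \<alpha> else \<beta>"])
    show "\<forall>\<sigma>\<in>{\<sigma>. \<sigma> \<in> std_families n \<and> \<tau> \<in> Aut {1..n} \<sigma>}. (\<lambda>(\<alpha>, \<beta>) b. if b then \<alpha> else \<beta>) (\<sigma> True, \<sigma> False) = \<sigma>"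
      by (simp add: fun_eq_iff)
    show "(\<lambda>\<sigma>. (\<sigma> True, \<sigma> False)) ` {\<sigma>. \<sigma> \<in> std_families n \<and> \<tau> \<in> Aut {1..n} \<sigma>} \<subseteq> A \<times> A"
    proof (rule image_subsetI)
      fix \<sigma> :: "bool \<Rightarrow> nat \<Rightarrow> nat" assume "\<sigma> \<in> {\<sigma>. \<sigma> \<in> std_families n \<and> \<tau> \<in> Aut {1..n} \<sigma>}"
      then have "\<sigma> b \<in> A" for b unfolding A std_families_def Aut_def by blast
      then show "(\<sigma> True, \<sigma> False) \<in> A \<times> A" by simp
    qed
    show "(\<lambda>(\<alpha>, \<beta>) b. if b then \<alpha> else \<beta>) ` (A \<times> A) \<subseteq> {\<sigma>. \<sigma> \<in> std_families n \<and> \<tau> \<in> Aut {1..n} \<sigma>}"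
    proof (rule image_subsetI)
      fix p assume "p \<in> A \<times> A"
      then obtain \<alpha> \<beta> where p: "p = (\<alpha>, \<beta>)" "\<alpha> \<in> A" "\<beta> \<in> A" by blast
      have "(\<lambda>b. if b then \<alpha> else \<beta>) \<in> std_families n" using p(2,3) unfolding A std_families_def by simp
      moreover have "\<tau> \<in> Aut {1..n} (\<lambda>b. if b then \<alpha> else \<beta>)" using p(2,3) t unfolding A Aut_def by simp
      ultimately show "(\<lambda>(\<alpha>, \<beta>) b. if b then \<alpha> else \<beta>) p \<in> {\<sigma>. \<sigma> \<in> std_families n \<and> \<tau> \<in> Aut {1..n} \<sigma>}"
        by (simp add: p(1))
    qed
  qed auto
  then have "card {\<sigma> :: bool \<Rightarrow> nat \<Rightarrow> nat. \<sigma> \<in> std_families n \<and> \<tau> \<in> Aut {1..n} \<sigma>} = card (A \<times> A)"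
    by (rule bij_betw_same_card)
  then show ?thesis by (simp add: card_cartesian_product A_def)
qed

text \<open>The pairs together with a permutation commuting with both components are counted twice:
  by pairs, which gives \<open>fact n\<close> for each class, and by permutations, which gives
  squares of centralizer orders.\<close>

lemma card_iso_types_bool:
  "card (iso_types n :: (nat \<times> (bool \<Rightarrow> nat \<Rightarrow> nat) set) set) = (\<Sum>M | 0 \<notin># M \<and> sum_mset M = n. centralizer_order M)"
proof -
  define S where "S = {\<tau>. \<tau> permutes {1..n}}"
  have fS: "finite S" by (simp add: S_def finite_permutations)
  have "fact n * card (iso_types n :: (nat \<times> (bool \<Rightarrow> nat \<Rightarrow> nat) set) set) =
      (\<Sum>\<sigma>\<in>std_families n. card (Aut {1..n} (\<sigma> :: bool \<Rightarrow> nat \<Rightarrow> nat)))"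
    using weighted_burnside[of n "iso_type {1..n} :: (bool \<Rightarrow> nat \<Rightarrow> nat) \<Rightarrow> _" "\<lambda>_. 1", OF iso_type_eq_iff[OF perm_family_std_families perm_family_std_families]]
    by (simp add: iso_types_def)
  also have "\<dots> = (\<Sum>\<sigma>\<in>std_families n. \<Sum>\<tau>\<in>S. if \<tau> \<in> Aut {1..n} (\<sigma> :: bool \<Rightarrow> nat \<Rightarrow> nat) then 1 else 0)"
  proof (rule sum.cong[OF refl])
    fix \<sigma> :: "bool \<Rightarrow> nat \<Rightarrow> nat"
    have "Aut {1..n} \<sigma> = {\<tau> \<in> S. \<tau> \<in> Aut {1..n} \<sigma>}" by (auto simp: S_def Aut_def)
    then have "card (Aut {1..n} \<sigma>) = (\<Sum>\<tau>\<in>{\<tau> \<in> S. \<tau> \<in> Aut {1..n} \<sigma>}. 1)" by simp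
    then show "card (Aut {1..n} \<sigma>) = (\<Sum>\<tau>\<in>S. if \<tau> \<in> Aut {1..n} \<sigma> then 1 else 0)"
      by (simp only: sum.inter_filter[OF fS])
  qed
  also have "\<dots> = (\<Sum>\<tau>\<in>S. \<Sum>\<sigma>\<in>std_families n. if \<tau> \<in> Aut {1..n} (\<sigma> :: bool \<Rightarrow> nat \<Rightarrow> nat) then 1 else 0)"
    by (rule sum.swap)
  also have "\<dots> = (\<Sum>\<tau>\<in>S. card (Aut {1..n} (\<lambda>_::unit. \<tau>)) * card (Aut {1..n} (\<lambda>_::unit. \<tau>)))"
  proof (rule sum.cong[OF refl])
    fix \<tau> assume "\<tau> \<in> S"
    then have t: "\<tau> permutes {1..n}" by (simp add: S_def)
    have "(\<Sum>\<sigma>\<in>std_families n. if \<tau> \<in> Aut {1..n} (\<sigma> :: bool \<Rightarrow> nat \<Rightarrow> nat) then 1 else 0) =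
        (\<Sum>\<sigma>\<in>{\<sigma> :: bool \<Rightarrow> nat \<Rightarrow> nat. \<sigma> \<in> std_families n \<and> \<tau> \<in> Aut {1..n} \<sigma>}. 1::nat)"
      by (rule sum.inter_filter[OF finite_std_families, symmetric])
    then show "(\<Sum>\<sigma>\<in>std_families n. if \<tau> \<in> Aut {1..n} (\<sigma> :: bool \<Rightarrow> nat \<Rightarrow> nat) then 1 else 0) =
        card (Aut {1..n} (\<lambda>_::unit. \<tau>)) * card (Aut {1..n} (\<lambda>_::unit. \<tau>))"
      using card_commuting_pairs[OF t] by simp
  qed
  \<comment> \<open>One factor of the square becomes a weight depending only on the cycle type; the
    other is kept as \<open>card (Aut ...)\<close>, so that \<open>weighted_burnside\<close> applies
    again, now to single permutations.\<close>
  also have "\<dots> = (\<Sum>\<sigma>\<in>std_families n. centralizer_order (cycle_type {1..n} \<sigma>) * card (Aut {1..n} \<sigma>))"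
  proof (rule sum.reindex_bij_witness[of _ "\<lambda>\<sigma>. \<sigma> ()" "\<lambda>\<tau> _. \<tau>"])
    fix \<tau> assume "\<tau> \<in> S"
    then show t: "(\<lambda>_::unit. \<tau>) \<in> std_families n" by (simp add: S_def std_families_def)
    show "centralizer_order (cycle_type {1..n} (\<lambda>_. \<tau>)) * card (Aut {1..n} (\<lambda>_::unit. \<tau>)) =
        card (Aut {1..n} (\<lambda>_::unit. \<tau>)) * card (Aut {1..n} (\<lambda>_::unit. \<tau>))"
      using card_Aut_eq_centralizer_order[OF perm_family_std_families[OF t]] by simp
  next
    fix \<sigma> :: "unit \<Rightarrow> nat \<Rightarrow> nat" assume "\<sigma> \<in> std_families n"
    then show "\<sigma> () \<in> S" "(\<lambda>_. \<sigma> ()) = \<sigma>" by (simp_all add: S_def std_families_def fun_eq_iff)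
  qed simp
  also have "\<dots> = fact n * (\<Sum>M\<in>cycle_type {1..n} ` std_families n. centralizer_order M)"
    by (rule weighted_burnside[OF cycle_type_eq_iff[OF perm_family_std_families perm_family_std_families]])
  finally show ?thesis unfolding cycle_type_image_std_families by simp
qed

text \<open>The sum of the centralizer orders over partitions of \<open>n\<close> into parts of size
  at most \<open>K\<close>, in a form that rewriting can evaluate; \<open>m\<close> is the
  multiplicity of the largest part \<open>Suc K\<close>.\<close>

primrec wsum :: "nat \<Rightarrow> nat \<Rightarrow> nat" where
  "wsum 0 n = (if n = 0 then 1 else 0)"
| "wsum (Suc K) n = (\<Sum>m\<le>n div Suc K. Suc K ^ m * fact m * wsum K (n - m * Suc K))"

lemma centralizer_order_add_replicate:
  assumes "k \<notin># M"
  shows "centralizer_order (M + replicate_mset m k) = k ^ m * fact m * centralizer_order M"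
proof (induction m)
  case (Suc m)
  have "count (M + replicate_mset m k) k = m" using assms by (simp add: not_in_iff)
  then show ?case by (simp add: centralizer_order_add_mset Suc algebra_simps)
qed simp

text \<open>All copies of the largest admissible part are split off at once; the centralizer order
  is a product over distinct parts, so they contribute a separate factor.\<close>

lemma sum_centralizer_order_eq_wsum: "(\<Sum>M\<in>msets_of {1..K} (\<lambda>x. x) n. centralizer_order M) = wsum K n"
proof (induction K arbitrary: n)
  case 0
  have "msets_of {1..0::nat} (\<lambda>x. x) n = (if n = 0 then {{#}} else {})"
    by (auto simp: msets_of_def)
  then show ?case by (simp add: centralizer_order_def)
next
  case (Suc K)
  define k where "k = Suc K"
  define P where "P = (SIGMA m:{..n div k}. msets_of {1..K} (\<lambda>x. x) (n - m * k))"
  have fin: "finite (msets_of {1..K} (\<lambda>x. x) l)" for l by (rule finite_msets_of) auto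
  have notin: "k \<notin># M" if "M \<in> msets_of {1..K} (\<lambda>x. x) l" for M l
    using that by (auto simp: msets_of_def k_def)
  have "(\<Sum>M\<in>msets_of {1..Suc K} (\<lambda>x. x) n. centralizer_order M) = (\<Sum>(m, M)\<in>P. k ^ m * fact m * centralizer_order M)"
  proof (rule sum.reindex_bij_witness[of _ "\<lambda>(m, M). M + replicate_mset m k" "\<lambda>M. (count M k, filter_mset (\<lambda>x. x \<noteq> k) M)"])
    fix M assume M: "M \<in> msets_of {1..Suc K} (\<lambda>x. x) n"
    have split: "filter_mset (\<lambda>x. x \<noteq> k) M + replicate_mset (count M k) k = M"
      by (rule multiset_eqI) auto
    then show "(case (count M k, filter_mset (\<lambda>x. x \<noteq> k) M) of (m, M) \<Rightarrow> M + replicate_mset m k) = M" by simp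
    have "sum_mset (filter_mset (\<lambda>x. x \<noteq> k) M) + count M k * k = sum_mset M"
      using arg_cong[OF split, of sum_mset] by simp
    then have s: "sum_mset (filter_mset (\<lambda>x. x \<noteq> k) M) + count M k * k = n" using M by (simp add: msets_of_def)
    have "count M k \<le> n div k" using s by (simp add: less_eq_div_iff_mult_less_eq k_def)
    moreover have "set_mset (filter_mset (\<lambda>x. x \<noteq> k) M) \<subseteq> {1..K}"
      using M by (auto simp: msets_of_def k_def le_Suc_eq)
    ultimately show "(count M k, filter_mset (\<lambda>x. x \<noteq> k) M) \<in> P"
      using s by (simp add: P_def msets_of_def)
    have "k \<notin># filter_mset (\<lambda>x. x \<noteq> k) M" by simp
    then show "(case (count M k, filter_mset (\<lambda>x. x \<noteq> k) M) of (m, M) \<Rightarrow> k ^ m * fact m * centralizer_order M) = centralizer_order M"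
      using centralizer_order_add_replicate[of k "filter_mset (\<lambda>x. x \<noteq> k) M" "count M k"] split by simp
  next
    fix p assume "p \<in> P"
    then obtain m M where p: "p = (m, M)" "m \<le> n div k" "M \<in> msets_of {1..K} (\<lambda>x. x) (n - m * k)"
      by (auto simp: P_def)
    have k: "k \<notin># M" by (rule notin[OF p(3)])
    have "filter_mset (\<lambda>x. x \<noteq> k) (M + replicate_mset m k) = M"
      using k by (intro multiset_eqI) (auto simp: not_in_iff)
    then show "(count (case p of (m, M) \<Rightarrow> M + replicate_mset m k) k,
        filter_mset (\<lambda>x. x \<noteq> k) (case p of (m, M) \<Rightarrow> M + replicate_mset m k)) = p"
      using k by (simp add: p(1) not_in_iff)
    have "m * k \<le> n" using p(2) by (simp add: less_eq_div_iff_mult_less_eq k_def)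
    then show "(case p of (m, M) \<Rightarrow> M + replicate_mset m k) \<in> msets_of {1..Suc K} (\<lambda>x. x) n"
      using p(3) by (auto simp: p(1) msets_of_def k_def)
  qed
  also have "\<dots> = (\<Sum>m\<le>n div k. \<Sum>M\<in>msets_of {1..K} (\<lambda>x. x) (n - m * k). k ^ m * fact m * centralizer_order M)"
    unfolding P_def by (rule sum.Sigma[OF finite_atMost, symmetric]) (intro ballI fin)
  also have "\<dots> = (\<Sum>m\<le>n div k. k ^ m * fact m * wsum K (n - m * k))"
    unfolding sum_distrib_left[symmetric] Suc ..
  also have "\<dots> = wsum (Suc K) n" by (simp add: k_def)
  finally show ?case .
qed

lemma card_iso_types_bool_eq_wsum: "card (iso_types n :: (nat \<times> (bool \<Rightarrow> nat \<Rightarrow> nat) set) set) = wsum n n"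
proof -
  have "{M. 0 \<notin># M \<and> sum_mset M = n} = msets_of {1..n} (\<lambda>x. x) n"
  proof (intro equalityI subsetI)
    fix M assume M: "M \<in> {M. 0 \<notin># M \<and> sum_mset M = n}"
    have "x \<in> {1..n}" if x: "x \<in># M" for x
    proof -
      obtain N where "M = add_mset x N" using multi_member_split[OF x] by blast
      then have "x \<le> n" using M by auto
      moreover have "x \<noteq> 0" using M x by (cases x) auto
      ultimately show ?thesis by simp
    qed
    then show "M \<in> msets_of {1..n} (\<lambda>x. x) n" using M by (auto simp: msets_of_def)
  qed (auto simp: msets_of_def)
  then show ?thesis unfolding card_iso_types_bool by (simp only: sum_centralizer_order_eq_wsum)
qed

lemma wsum_numeral:
  "wsum (numeral k) n =
    (\<Sum>m\<le>n div numeral k. numeral k ^ m * fact m * wsum (pred_numeral k) (n - m * numeral k))"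
  unfolding numeral_eq_Suc wsum.simps ..

text \<open>Only the partition into ones is left. The closed form ends the numerical unfolding one
  level early.\<close>

lemma wsum_1: "wsum (Suc 0) n = fact n"
proof -
  have "wsum (Suc 0) n = (\<Sum>m\<le>n. if m = n then fact n else 0)"
    unfolding wsum.simps by (rule sum.cong) auto
  then show ?thesis by simp
qed

lemma wsum_values:
  "wsum 1 1 = 1" "wsum 2 2 = 4" "wsum 3 3 = 11" "wsum 4 4 = 43" "wsum 5 5 = 161" "wsum 6 6 = 901" "wsum 7 7 = 5579"
  by (simp_all add: wsum_numeral wsum_1 atMost_nat_numeral fact_numeral del: wsum.simps)

lemma iso_types_recursion:
  "n * card (iso_types n :: (nat \<times> ('i::finite \<Rightarrow> nat \<Rightarrow> nat) set) set) =
    (\<Sum>k=1..n. (\<Sum>d | d dvd k. d * card (transitive_types d :: (nat \<times> ('i \<Rightarrow> nat \<Rightarrow> nat) set) set)) *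
       card (iso_types (n - k) :: (nat \<times> ('i \<Rightarrow> nat \<Rightarrow> nat) set) set))"
proof -
  define T where "T = (\<Union>k. transitive_types k :: (nat \<times> ('i \<Rightarrow> nat \<Rightarrow> nat) set) set)"
  have T: "{t \<in> T. fst t = d} = transitive_types d" for d using fst_transitive_types by (auto simp: T_def)
  have pos: "fst t > 0" if "t \<in> T" for t
    using that by (auto simp: T_def transitive_types_def fst_iso_type transitive_def)
  have fin: "finite {t \<in> T. fst t = d}" for d unfolding T transitive_types_def by (simp add: finite_std_families)
  have P: "card (iso_types m :: (nat \<times> ('i \<Rightarrow> nat \<Rightarrow> nat) set) set) = card (msets_of T fst m)" for m
    unfolding card_iso_types_eq_card_msets msets_of_def T_def ..
  show ?thesis using euler_transform_recursion[of T fst n, OF pos fin] unfolding P T .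
qed

section \<open>Separating tensor invariants\<close>

definition index_fun :: "nat \<Rightarrow> nat \<Rightarrow> ((nat \<Rightarrow> nat) \<times> (nat \<Rightarrow> nat) \<times> (nat \<Rightarrow> nat)) set" where
  "index_fun N n = ({1..n} \<rightarrow>\<^sub>E {1..N}) \<times> ({1..n} \<rightarrow>\<^sub>E {1..N}) \<times> ({1..n} \<rightarrow>\<^sub>E {1..N})"

lemma finite_index_fun: "finite (index_fun N n)"
  by (simp add: index_fun_def finite_PiE)

lemma tensor_invariant_altdef:
  "tensor_invariant N n (\<sigma>1, \<sigma>2, \<sigma>3) \<Phi> =
    (\<Sum>(i1, i2, i3)\<in>index_fun N n. (\<Prod>j\<in>{1..n}. \<Phi> (i1 j) (i2 j) (i3 j)) *
      (\<Prod>j\<in>{1..n}. cnj (\<Phi> (i1 (\<sigma>1 j)) (i2 (\<sigma>2 j)) (i3 (\<sigma>3 j)))))"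
  unfolding tensor_invariant_def index_fun_def prod.case
  by (simp add: sum.cartesian_product split_beta)

lemma comp_permutes_PiE:
  assumes "f \<in> A \<rightarrow>\<^sub>E B" "\<gamma> permutes A"
  shows "f \<circ> \<gamma> \<in> A \<rightarrow>\<^sub>E B"
proof (rule PiE_I)
  show "(f \<circ> \<gamma>) x \<in> B" if "x \<in> A" for x
    using PiE_mem[OF assms(1), of "\<gamma> x"] that by (simp add: permutes_in_image[OF assms(2)])
  show "(f \<circ> \<gamma>) x = undefined" if "x \<notin> A" for x
    using PiE_arb[OF assms(1) that] permutes_not_in[OF assms(2) that] by simp
qed

text \<open>The permutation \<open>\<gamma>1\<close> is absorbed by substituting
  \<open>i \<circ> \<gamma>1\<close> for the index functions, which renames the copies of the
  tensor; \<open>\<gamma>2\<close> only reorders the factors of the conjugate product.\<close>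

lemma tensor_invariant_cong_equiv:
  assumes g1: "\<gamma>1 permutes {1..n}" and g2: "\<gamma>2 permutes {1..n}"
  shows "tensor_invariant N n (\<gamma>1 \<circ> \<sigma>1 \<circ> \<gamma>2, \<gamma>1 \<circ> \<sigma>2 \<circ> \<gamma>2, \<gamma>1 \<circ> \<sigma>3 \<circ> \<gamma>2) = tensor_invariant N n (\<sigma>1, \<sigma>2, \<sigma>3)"
proof
  fix \<Phi> :: tensor3
  show "tensor_invariant N n (\<gamma>1 \<circ> \<sigma>1 \<circ> \<gamma>2, \<gamma>1 \<circ> \<sigma>2 \<circ> \<gamma>2, \<gamma>1 \<circ> \<sigma>3 \<circ> \<gamma>2) \<Phi> = tensor_invariant N n (\<sigma>1, \<sigma>2, \<sigma>3) \<Phi>"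
    unfolding tensor_invariant_altdef
  proof (rule sum.reindex_bij_witness[of _ "\<lambda>(i1, i2, i3). (i1 \<circ> inv \<gamma>1, i2 \<circ> inv \<gamma>1, i3 \<circ> inv \<gamma>1)"
        "\<lambda>(i1, i2, i3). (i1 \<circ> \<gamma>1, i2 \<circ> \<gamma>1, i3 \<circ> \<gamma>1)"])
    fix p assume "p \<in> index_fun N n"
    then obtain i1 i2 i3 where p: "p = (i1, i2, i3)" "i1 \<in> {1..n} \<rightarrow>\<^sub>E {1..N}" "i2 \<in> {1..n} \<rightarrow>\<^sub>E {1..N}" "i3 \<in> {1..n} \<rightarrow>\<^sub>E {1..N}"
      unfolding index_fun_def by blast
    have cancel: "f \<circ> \<gamma>1 \<circ> inv \<gamma>1 = f" "f \<circ> inv \<gamma>1 \<circ> \<gamma>1 = f" for f :: "nat \<Rightarrow> nat"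
      by (simp_all add: o_assoc[symmetric] permutes_inv_o[OF g1])
    show "(case case p of (i1, i2, i3) \<Rightarrow> (i1 \<circ> \<gamma>1, i2 \<circ> \<gamma>1, i3 \<circ> \<gamma>1) of
        (i1, i2, i3) \<Rightarrow> (i1 \<circ> inv \<gamma>1, i2 \<circ> inv \<gamma>1, i3 \<circ> inv \<gamma>1)) = p"
      "(case case p of (i1, i2, i3) \<Rightarrow> (i1 \<circ> inv \<gamma>1, i2 \<circ> inv \<gamma>1, i3 \<circ> inv \<gamma>1) of
        (i1, i2, i3) \<Rightarrow> (i1 \<circ> \<gamma>1, i2 \<circ> \<gamma>1, i3 \<circ> \<gamma>1)) = p"
      by (simp_all add: p(1) cancel)
    show "(case p of (i1, i2, i3) \<Rightarrow> (i1 \<circ> \<gamma>1, i2 \<circ> \<gamma>1, i3 \<circ> \<gamma>1)) \<in> index_fun N n"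
      unfolding p(1) prod.case index_fun_def using p(2-4) by (intro SigmaI comp_permutes_PiE[OF _ g1])
    show "(case p of (i1, i2, i3) \<Rightarrow> (i1 \<circ> inv \<gamma>1, i2 \<circ> inv \<gamma>1, i3 \<circ> inv \<gamma>1)) \<in> index_fun N n"
      unfolding p(1) prod.case index_fun_def using p(2-4) by (intro SigmaI comp_permutes_PiE[OF _ permutes_inv[OF g1]])
    have "(\<Prod>j\<in>{1..n}. \<Phi> (i1 j) (i2 j) (i3 j)) = (\<Prod>j\<in>{1..n}. \<Phi> (i1 (\<gamma>1 j)) (i2 (\<gamma>1 j)) (i3 (\<gamma>1 j)))"
      using prod.permute[OF g1, of "\<lambda>j. \<Phi> (i1 j) (i2 j) (i3 j)"] by (simp add: o_def)
    moreover have "(\<Prod>j\<in>{1..n}. cnj (\<Phi> (i1 (\<gamma>1 (\<sigma>1 j))) (i2 (\<gamma>1 (\<sigma>2 j))) (i3 (\<gamma>1 (\<sigma>3 j))))) =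
        (\<Prod>j\<in>{1..n}. cnj (\<Phi> (i1 (\<gamma>1 (\<sigma>1 (\<gamma>2 j)))) (i2 (\<gamma>1 (\<sigma>2 (\<gamma>2 j)))) (i3 (\<gamma>1 (\<sigma>3 (\<gamma>2 j))))))"
      using prod.permute[OF g2, of "\<lambda>j. cnj (\<Phi> (i1 (\<gamma>1 (\<sigma>1 j))) (i2 (\<gamma>1 (\<sigma>2 j))) (i3 (\<gamma>1 (\<sigma>3 j))))"]
      by (simp add: o_def)
    ultimately show "(case case p of (i1, i2, i3) \<Rightarrow> (i1 \<circ> \<gamma>1, i2 \<circ> \<gamma>1, i3 \<circ> \<gamma>1) of
        (i1, i2, i3) \<Rightarrow> (\<Prod>j\<in>{1..n}. \<Phi> (i1 j) (i2 j) (i3 j)) *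
          (\<Prod>j\<in>{1..n}. cnj (\<Phi> (i1 (\<sigma>1 j)) (i2 (\<sigma>2 j)) (i3 (\<sigma>3 j))))) =
      (case p of (i1, i2, i3) \<Rightarrow> (\<Prod>j\<in>{1..n}. \<Phi> (i1 j) (i2 j) (i3 j)) *
          (\<Prod>j\<in>{1..n}. cnj (\<Phi> (i1 ((\<gamma>1 \<circ> \<sigma>1 \<circ> \<gamma>2) j)) (i2 ((\<gamma>1 \<circ> \<sigma>2 \<circ> \<gamma>2) j)) (i3 ((\<gamma>1 \<circ> \<sigma>3 \<circ> \<gamma>2) j)))))"
      unfolding p(1) prod.case o_apply by simp
  qed
qed

section \<open>Recovering exponents from sums of monomials\<close>

lemma poly_eq_if_infinite:
  fixes p q :: "complex poly"
  assumes "infinite S" "\<And>x. x \<in> S \<Longrightarrow> poly p x = poly q x"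
  shows "p = q"
proof (rule ccontr)
  assume "p \<noteq> q"
  then have "finite {x. poly (p - q) x = 0}" by (intro poly_roots_finite) simp
  moreover have "S \<subseteq> {x. poly (p - q) x = 0}" using assms(2) by auto
  ultimately show False using assms(1) finite_subset by blast
qed

lemma infinite_unit_circle: "infinite {w :: complex. w * cnj w = 1}"
proof -
  have "inj_on (\<lambda>x. Complex x (sqrt (1 - x\<^sup>2))) {0..1}" by (rule inj_onI) simp
  then have "infinite ((\<lambda>x. Complex x (sqrt (1 - x\<^sup>2))) ` {0..1})"
    by (simp add: finite_image_iff infinite_Icc)
  moreover have "(\<lambda>x. Complex x (sqrt (1 - x\<^sup>2))) ` {0..1} \<subseteq> {w. w * cnj w = 1}"
  proof (rule image_subsetI)
    fix x :: real assume "x \<in> {0..1}"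
    then have "x\<^sup>2 \<le> 1" by (simp add: power_le_one)
    then show "Complex x (sqrt (1 - x\<^sup>2)) \<in> {w. w * cnj w = 1}"
      by (simp add: complex_eq_iff power2_eq_square)
  qed
  ultimately show ?thesis using finite_subset by blast
qed

text \<open>Monomials in \<open>z\<close> and its conjugate are linearly independent as functions:
  real scaling separates the total degrees, and on the unit circle the exponents within one degree
  become distinct powers.\<close>

lemma card_eq_if_bipower_sums_eq:
  fixes p q :: "'a \<Rightarrow> nat" and p' q' :: "'b \<Rightarrow> nat"
  assumes fin: "finite A" "finite B"
    and eq: "\<And>z :: complex. (\<Sum>a\<in>A. z ^ p a * cnj z ^ q a) = (\<Sum>b\<in>B. z ^ p' b * cnj z ^ q' b)"
  shows "card {a \<in> A. p a = P \<and> q a = Q} = card {b \<in> B. p' b = P \<and> q' b = Q}"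
proof -
  define D where "D = P + Q"
  \<comment> \<open>Put \<open>z = t * w\<close> with \<open>t\<close> real: both sides are
    polynomials in \<open>t\<close>, and their coefficients at \<open>D\<close> are
    compared.\<close>
  have step1: "(\<Sum>a | a \<in> A \<and> p a + q a = D. w ^ p a * cnj w ^ q a) =
      (\<Sum>b | b \<in> B \<and> p' b + q' b = D. w ^ p' b * cnj w ^ q' b)" for w
  proof -
    define f where "f = (\<Sum>a\<in>A. monom (w ^ p a * cnj w ^ q a) (p a + q a))"
    define g where "g = (\<Sum>b\<in>B. monom (w ^ p' b * cnj w ^ q' b) (p' b + q' b))"
    have "f = g"
    proof (rule poly_eq_if_infinite)
      show "infinite (range (of_real :: real \<Rightarrow> complex))"
        using infinite_UNIV_char_0[where 'a = real] by (simp add: finite_image_iff inj_of_real)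
      fix x assume "x \<in> range (of_real :: real \<Rightarrow> complex)"
      then obtain t :: real where x: "x = of_real t" by blast
      have "poly f x = (\<Sum>a\<in>A. (x * w) ^ p a * cnj (x * w) ^ q a)"
        unfolding f_def poly_sum by (rule sum.cong) (simp_all add: poly_monom x power_mult_distrib power_add)
      also have "\<dots> = (\<Sum>b\<in>B. (x * w) ^ p' b * cnj (x * w) ^ q' b)" by (rule eq)
      also have "\<dots> = poly g x"
        unfolding g_def poly_sum by (rule sum.cong) (simp_all add: poly_monom x power_mult_distrib power_add)
      finally show "poly f x = poly g x" .
    qed
    then have "coeff f D = coeff g D" by simp
    then show ?thesis using fin by (simp add: f_def g_def coeff_sum sum.inter_filter)
  qed
  \<comment> \<open>On the unit circle the conjugate is the inverse, so a monomial is
    \<open>w\<close> to the possibly negative power \<open>p - q\<close>. Multiplying by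
    \<open>w ^ D\<close> with \<open>D = p + q\<close> makes the exponent
    \<open>2 * p\<close>.\<close>
  define f where "f = (\<Sum>a | a \<in> A \<and> p a + q a = D. monom (1::complex) (2 * p a))"
  define g where "g = (\<Sum>b | b \<in> B \<and> p' b + q' b = D. monom (1::complex) (2 * p' b))"
  have shift: "w ^ D * (w ^ i * cnj w ^ j) = w ^ (2 * i)" if "w * cnj w = 1" "i + j = D" for w :: complex and i j
  proof -
    have "w ^ D * (w ^ i * cnj w ^ j) = w ^ (2 * i) * (w * cnj w) ^ j"
      by (simp add: that(2)[symmetric] power_add power_mult_distrib mult_2)
    then show ?thesis by (simp add: that(1))
  qed
  have "f = g"
  proof (rule poly_eq_if_infinite[OF infinite_unit_circle])
    fix w :: complex assume "w \<in> {w. w * cnj w = 1}"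
    then have w: "w * cnj w = 1" by simp
    have "poly f w = w ^ D * (\<Sum>a | a \<in> A \<and> p a + q a = D. w ^ p a * cnj w ^ q a)"
      unfolding f_def poly_sum sum_distrib_left by (rule sum.cong) (simp_all add: poly_monom shift[OF w])
    also have "\<dots> = w ^ D * (\<Sum>b | b \<in> B \<and> p' b + q' b = D. w ^ p' b * cnj w ^ q' b)" by (simp only: step1)
    also have "\<dots> = poly g w"
      unfolding g_def poly_sum sum_distrib_left by (rule sum.cong) (simp_all add: poly_monom shift[OF w])
    finally show "poly f w = poly g w" .
  qed
  then have c: "coeff f (2 * P) = coeff g (2 * P)" by simp
  have "coeff f (2 * P) = of_nat (card {a \<in> {a. a \<in> A \<and> p a + q a = D}. p a = P})"
    using fin by (simp add: f_def coeff_sum sum.inter_filter[symmetric])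
  moreover have "coeff g (2 * P) = of_nat (card {b \<in> {b. b \<in> B \<and> p' b + q' b = D}. p' b = P})"
    using fin by (simp add: g_def coeff_sum sum.inter_filter[symmetric])
  moreover have "{a \<in> {a. a \<in> A \<and> p a + q a = D}. p a = P} = {a \<in> A. p a = P \<and> q a = Q}"
    "{b \<in> {b. b \<in> B \<and> p' b + q' b = D}. p' b = P} = {b \<in> B. p' b = P \<and> q' b = Q}"
    by (auto simp: D_def)
  ultimately show ?thesis using c by simp
qed

lemma digits_unique:
  fixes c d :: "nat \<Rightarrow> nat"
  assumes "\<And>x. c x < M" "\<And>x. d x < M" "(\<Sum>x<K. M ^ x * c x) = (\<Sum>x<K. M ^ x * d x)" "x < K"
  shows "c x = d x"
  using assms
proof (induction K arbitrary: c d x)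
  case (Suc K)
  have split: "(\<Sum>x<Suc K. M ^ x * c x) = c 0 + M * (\<Sum>x<K. M ^ x * c (Suc x))" for c :: "nat \<Rightarrow> nat"
    by (subst sum.lessThan_Suc_shift) (simp add: sum_distrib_left mult.assoc)
  have eq: "c 0 + M * (\<Sum>x<K. M ^ x * c (Suc x)) = d 0 + M * (\<Sum>x<K. M ^ x * d (Suc x))"
    using Suc.prems(3) unfolding split .
  then have "(c 0 + M * (\<Sum>x<K. M ^ x * c (Suc x))) mod M = (d 0 + M * (\<Sum>x<K. M ^ x * d (Suc x))) mod M"
    by simp
  then have c0: "c 0 = d 0" using Suc.prems(1)[of 0] Suc.prems(2)[of 0] by simp
  have "M > 0" using Suc.prems(1)[of 0] by simp
  then have "(\<Sum>x<K. M ^ x * c (Suc x)) = (\<Sum>x<K. M ^ x * d (Suc x))" using eq c0 by simp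
  then have "c (Suc y) = d (Suc y)" if "y < K" for y
    using Suc.IH[of "\<lambda>x. c (Suc x)" "\<lambda>x. d (Suc x)" y] Suc.prems(1,2) that by blast
  then show ?case using c0 Suc.prems(4) by (cases x) auto
qed simp

text \<open>The multiplicities are below \<open>M\<close>, so they are the digits of the sum in base
  \<open>M\<close>.\<close>

lemma mset_eq_if_power_sums_eq:
  fixes A B :: "nat multiset"
  assumes "size A < M" "size B < M"
    and eq: "sum_mset (image_mset (\<lambda>x. M ^ x) A) = sum_mset (image_mset (\<lambda>x. M ^ x) B)"
  shows "A = B"
proof (rule multiset_eqI)
  fix x
  define K where "K = Suc (Max (insert x (set_mset A \<union> set_mset B)))"
  have K: "y < K" if "y \<in> insert x (set_mset A \<union> set_mset B)" for y
    using that unfolding K_def by (intro le_imp_less_Suc Max_ge) auto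
  have sub: "set_mset A \<subseteq> {..<K}" "set_mset B \<subseteq> {..<K}" using K by auto
  have "(\<Sum>y<K. M ^ y * count A y) = (\<Sum>y<K. M ^ y * count B y)"
    using eq sum_mset_image_eq_sum_count[OF finite_lessThan sub(1), of "\<lambda>x. M ^ x"]
      sum_mset_image_eq_sum_count[OF finite_lessThan sub(2), of "\<lambda>x. M ^ x"] by simp
  moreover have "count A y < M" "count B y < M" for y
    using assms(1,2) count_le_size[of A y] count_le_size[of B y] by (auto intro: le_less_trans)
  ultimately show "count A x = count B x" using digits_unique[of "count A" M "count B" K x] K by blast
qed

lemma obtain_bij_if_power_sums_eq:
  fixes f g :: "'a \<Rightarrow> nat"
  assumes J: "finite J" "card J < M" and eq: "(\<Sum>j\<in>J. M ^ f j) = (\<Sum>j\<in>J. M ^ g j)"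
  obtains h where "bij_betw h J J" "\<And>j. j \<in> J \<Longrightarrow> g (h j) = f j"
proof -
  have "image_mset f (mset_set J) = image_mset g (mset_set J)"
    by (rule mset_eq_if_power_sums_eq[of _ M])
       (use J eq in \<open>simp_all add: image_mset.compositionality o_def sum_unfold_sum_mset\<close>)
  then show thesis using image_mset_eq_obtain_bij[OF J(1) J(1)] that by blast
qed

lemma permutes_extend:
  assumes "bij_betw h A A"
  shows "(\<lambda>x. if x \<in> A then h x else x) permutes A"
proof (rule bij_imp_permutes)
  have "bij_betw (\<lambda>x. if x \<in> A then h x else x) A A \<longleftrightarrow> bij_betw h A A" by (rule bij_betw_cong) simp
  then show "bij_betw (\<lambda>x. if x \<in> A then h x else x) A A" using assms by simp
qed simp

lemma equiv_if_tensor_invariant_eq: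
  assumes nN: "n \<le> N" and s: "\<sigma>1 permutes {1..n}" "\<sigma>2 permutes {1..n}" "\<sigma>3 permutes {1..n}"
    and t: "\<tau>1 permutes {1..n}" "\<tau>2 permutes {1..n}" "\<tau>3 permutes {1..n}"
    and eq: "tensor_invariant N n (\<sigma>1, \<sigma>2, \<sigma>3) = tensor_invariant N n (\<tau>1, \<tau>2, \<tau>3)"
  obtains \<gamma>1 \<gamma>2 where "\<gamma>1 permutes {1..n}" "\<gamma>2 permutes {1..n}"
    "\<sigma>1 = \<gamma>1 \<circ> \<tau>1 \<circ> \<gamma>2" "\<sigma>2 = \<gamma>1 \<circ> \<tau>2 \<circ> \<gamma>2" "\<sigma>3 = \<gamma>1 \<circ> \<tau>3 \<circ> \<gamma>2"
proof -
  \<comment> \<open>The base exceeds the number \<open>n\<close> of summands, so sums of powers of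
    \<open>M\<close> have no carries and determine the multiset of exponents.\<close>
  define M where "M = Suc n"
  define e :: "nat \<Rightarrow> nat \<Rightarrow> nat \<Rightarrow> nat" where "e a b c = prod_encode (a, prod_encode (b, c))" for a b c
  have e_inj: "e a b c = e a' b' c' \<longleftrightarrow> a = a' \<and> b = b' \<and> c = c'" for a b c a' b' c'
    by (simp add: e_def)
  define p :: "(nat \<Rightarrow> nat) \<times> (nat \<Rightarrow> nat) \<times> (nat \<Rightarrow> nat) \<Rightarrow> nat" where
    "p = (\<lambda>(i1, i2, i3). \<Sum>j\<in>{1..n}. M ^ e (i1 j) (i2 j) (i3 j))"
  define q :: "perm_triple \<Rightarrow> (nat \<Rightarrow> nat) \<times> (nat \<Rightarrow> nat) \<times> (nat \<Rightarrow> nat) \<Rightarrow> nat" where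
    "q = (\<lambda>(\<sigma>1, \<sigma>2, \<sigma>3) (i1, i2, i3). \<Sum>j\<in>{1..n}. M ^ e (i1 (\<sigma>1 j)) (i2 (\<sigma>2 j)) (i3 (\<sigma>3 j)))"
  \<comment> \<open>On the test tensor every index assignment contributes one monomial:
    \<open>p\<close> encodes the multiset of index triples at the tensors, \<open>q\<close> the one
    at their conjugates.\<close>
  have ev: "tensor_invariant N n (\<sigma>1, \<sigma>2, \<sigma>3) (\<lambda>a b c. z ^ (M ^ e a b c)) =
      (\<Sum>i\<in>index_fun N n. z ^ p i * cnj z ^ q (\<sigma>1, \<sigma>2, \<sigma>3) i)" for z \<sigma>1 \<sigma>2 \<sigma>3
    unfolding tensor_invariant_altdef by (rule sum.cong) (auto simp: p_def q_def power_sum)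
  \<comment> \<open>The identity assignment gives the \<open>j\<close>-th copy the triple
    \<open>(j, j, j)\<close>, so that all copies are distinguishable; these values are legal indices
    since \<open>n \<le> N\<close>.\<close>
  define i0 where "i0 = restrict id {1..n}"
  define P where "P = p (i0, i0, i0)"
  define Q where "Q = q (\<sigma>1, \<sigma>2, \<sigma>3) (i0, i0, i0)"
  have i0: "(i0, i0, i0) \<in> index_fun N n" using nN by (auto simp: index_fun_def i0_def)
  \<comment> \<open>The monomial of the identity assignment occurs for the first pattern. Its
    coefficient is the same for the second, so some assignment produces it there too.\<close>
  have "card {i \<in> index_fun N n. p i = P \<and> q (\<sigma>1, \<sigma>2, \<sigma>3) i = Q} =
      card {i \<in> index_fun N n. p i = P \<and> q (\<tau>1, \<tau>2, \<tau>3) i = Q}"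
    by (rule card_eq_if_bipower_sums_eq[OF finite_index_fun finite_index_fun])
       (simp only: ev[symmetric] eq)
  moreover have "card {i \<in> index_fun N n. p i = P \<and> q (\<sigma>1, \<sigma>2, \<sigma>3) i = Q} > 0"
    unfolding card_gt_0_iff using i0 finite_index_fun by (auto simp: P_def Q_def)
  ultimately have "card {i \<in> index_fun N n. p i = P \<and> q (\<tau>1, \<tau>2, \<tau>3) i = Q} > 0" by simp
  then have "{i \<in> index_fun N n. p i = P \<and> q (\<tau>1, \<tau>2, \<tau>3) i = Q} \<noteq> {}" unfolding card_gt_0_iff by blast
  then obtain i1 i2 i3 where i: "p (i1, i2, i3) = P" "q (\<tau>1, \<tau>2, \<tau>3) (i1, i2, i3) = Q" by fastforce
  have J: "finite {1..n}" "card {1..n} < M" by (simp_all add: M_def)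
  \<comment> \<open>Equal exponents of \<open>z\<close> force the three index functions of that
    assignment to agree on \<open>{1..n}\<close> with one bijection \<open>h\<close>, which becomes
    \<open>\<gamma>1\<close>. The exponents of the conjugate will give \<open>k\<close>, which
    becomes \<open>\<gamma>2\<close>.\<close>
  have "(\<Sum>j\<in>{1..n}. M ^ e (i1 j) (i2 j) (i3 j)) = (\<Sum>j\<in>{1..n}. M ^ e j j j)"
    using i(1) by (simp add: P_def p_def i0_def)
  then obtain h where h: "bij_betw h {1..n} {1..n}" "\<And>j. j \<in> {1..n} \<Longrightarrow> e (h j) (h j) (h j) = e (i1 j) (i2 j) (i3 j)"
    using obtain_bij_if_power_sums_eq[OF J, of "\<lambda>j. e (i1 j) (i2 j) (i3 j)" "\<lambda>j. e j j j"] by blast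
  have hi: "i1 j = h j" "i2 j = h j" "i3 j = h j" if "j \<in> {1..n}" for j
    using h(2)[OF that] by (simp_all add: e_inj)
  have "q (\<sigma>1, \<sigma>2, \<sigma>3) (i0, i0, i0) = (\<Sum>j\<in>{1..n}. M ^ e (\<sigma>1 j) (\<sigma>2 j) (\<sigma>3 j))"
    unfolding q_def prod.case
  proof (rule sum.cong[OF refl])
    fix j assume j: "j \<in> {1..n}"
    have "\<sigma>1 j \<in> {1..n}" "\<sigma>2 j \<in> {1..n}" "\<sigma>3 j \<in> {1..n}" using j s by (simp_all only: permutes_in_image)
    then show "M ^ e (i0 (\<sigma>1 j)) (i0 (\<sigma>2 j)) (i0 (\<sigma>3 j)) = M ^ e (\<sigma>1 j) (\<sigma>2 j) (\<sigma>3 j)"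
      by (simp only: i0_def restrict_apply if_True id_apply)
  qed
  then have "(\<Sum>j\<in>{1..n}. M ^ e (\<sigma>1 j) (\<sigma>2 j) (\<sigma>3 j)) = (\<Sum>j\<in>{1..n}. M ^ e (i1 (\<tau>1 j)) (i2 (\<tau>2 j)) (i3 (\<tau>3 j)))"
    using i(2) by (simp add: Q_def q_def)
  then obtain k where k: "bij_betw k {1..n} {1..n}"
      "\<And>j. j \<in> {1..n} \<Longrightarrow> e (i1 (\<tau>1 (k j))) (i2 (\<tau>2 (k j))) (i3 (\<tau>3 (k j))) = e (\<sigma>1 j) (\<sigma>2 j) (\<sigma>3 j)"
    using obtain_bij_if_power_sums_eq[OF J, of "\<lambda>j. e (\<sigma>1 j) (\<sigma>2 j) (\<sigma>3 j)" "\<lambda>j. e (i1 (\<tau>1 j)) (i2 (\<tau>2 j)) (i3 (\<tau>3 j))"]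
    by blast
  define \<gamma>1 where "\<gamma>1 = (\<lambda>x. if x \<in> {1..n} then h x else x)"
  define \<gamma>2 where "\<gamma>2 = (\<lambda>x. if x \<in> {1..n} then k x else x)"
  have g: "\<gamma>1 permutes {1..n}" "\<gamma>2 permutes {1..n}"
    unfolding \<gamma>1_def \<gamma>2_def by (rule permutes_extend[OF h(1)], rule permutes_extend[OF k(1)])
  have eqI: "\<sigma> = \<gamma>1 \<circ> \<tau> \<circ> \<gamma>2" if st: "\<sigma> permutes {1..n}" "\<tau> permutes {1..n}"
    and w: "\<And>j. j \<in> {1..n} \<Longrightarrow> \<sigma> j = h (\<tau> (k j))" for \<sigma> \<tau>
  proof
    fix j
    show "\<sigma> j = (\<gamma>1 \<circ> \<tau> \<circ> \<gamma>2) j"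
    proof (cases "j \<in> {1..n}")
      case True
      have "k j \<in> {1..n}" by (rule bij_betw_apply[OF k(1) True])
      then have "\<tau> (k j) \<in> {1..n}" by (simp only: permutes_in_image[OF st(2)])
      then show ?thesis using w[OF True] True by (simp only: \<gamma>1_def \<gamma>2_def o_apply if_True)
    next
      case False
      then show ?thesis
        using permutes_not_in[OF st(1) False] permutes_not_in[OF st(2) False]
          permutes_not_in[OF g(1) False] permutes_not_in[OF g(2) False] by simp
    qed
  qed
  have kin: "\<tau> (k j) \<in> {1..n}" if "\<tau> permutes {1..n}" "j \<in> {1..n}" for \<tau> j
    using permutes_in_image[OF that(1), of "k j"] bij_betw_apply[OF k(1) that(2)] by blast
  have w: "\<sigma>1 j = h (\<tau>1 (k j))" "\<sigma>2 j = h (\<tau>2 (k j))" "\<sigma>3 j = h (\<tau>3 (k j))" if j: "j \<in> {1..n}" for j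
    using k(2)[OF j] hi(1)[OF kin[OF t(1) j]] hi(2)[OF kin[OF t(2) j]] hi(3)[OF kin[OF t(3) j]]
    by (simp_all add: e_inj)
  show thesis
    using that[OF g eqI[OF s(1) t(1) w(1)] eqI[OF s(2) t(2) w(2)] eqI[OF s(3) t(3) w(3)]] by blast
qed

section \<open>Triples, coloured graphs and invariants\<close>

definition perm_pair :: "perm_triple \<Rightarrow> bool \<Rightarrow> nat \<Rightarrow> nat" where
  "perm_pair = (\<lambda>(\<sigma>1, \<sigma>2, \<sigma>3) b. (if b then \<sigma>2 else \<sigma>3) \<circ> inv \<sigma>1)"

lemma perm_triples_iff:
  "(\<sigma>1, \<sigma>2, \<sigma>3) \<in> perm_triples n \<longleftrightarrow> \<sigma>1 permutes {1..n} \<and> \<sigma>2 permutes {1..n} \<and> \<sigma>3 permutes {1..n}"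
  by (simp add: perm_triples_def sym_group_def)

lemma perm_pair_std_families: "s \<in> perm_triples n \<Longrightarrow> perm_pair s \<in> std_families n"
  by (cases s) (auto simp: perm_triples_iff perm_pair_def std_families_def intro!: permutes_compose permutes_inv)

lemma perm_pair_image: "perm_pair ` perm_triples n = std_families n"
proof (intro equalityI subsetI)
  fix \<sigma> :: "bool \<Rightarrow> nat \<Rightarrow> nat" assume s: "\<sigma> \<in> std_families n"
  have "\<sigma> = perm_pair (id, \<sigma> True, \<sigma> False)" by (auto simp: perm_pair_def fun_eq_iff)
  moreover have "(id, \<sigma> True, \<sigma> False) \<in> perm_triples n"
    using s by (simp add: perm_triples_iff std_families_def permutes_id)
  ultimately show "\<sigma> \<in> perm_pair ` perm_triples n" by blast
qed (use perm_pair_std_families in blast)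

definition triple_type :: "nat \<Rightarrow> perm_triple \<Rightarrow> nat \<times> (bool \<Rightarrow> nat \<Rightarrow> nat) set" where
  "triple_type n s = iso_type {1..n} (perm_pair s)"

lemma triple_equiv_iff:
  assumes s: "s \<in> perm_triples n"
  shows "(s, s') \<in> triple_equiv n \<longleftrightarrow> s' \<in> perm_triples n \<and> triple_type n s = triple_type n s'"
proof -
  obtain \<sigma>1 \<sigma>2 \<sigma>3 where s_eq: "s = (\<sigma>1, \<sigma>2, \<sigma>3)" by (cases s) auto
  obtain \<tau>1 \<tau>2 \<tau>3 where s'_eq: "s' = (\<tau>1, \<tau>2, \<tau>3)" by (cases s') auto
  have p: "\<sigma>1 permutes {1..n}" "\<sigma>2 permutes {1..n}" "\<sigma>3 permutes {1..n}"
    using s unfolding s_eq perm_triples_iff by blast+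
  show ?thesis
  proof
    assume "(s, s') \<in> triple_equiv n"
    then obtain \<gamma>1 \<gamma>2 where g: "\<gamma>1 permutes {1..n}" "\<gamma>2 permutes {1..n}"
      and t: "\<tau>1 = \<gamma>1 \<circ> \<sigma>1 \<circ> \<gamma>2" "\<tau>2 = \<gamma>1 \<circ> \<sigma>2 \<circ> \<gamma>2" "\<tau>3 = \<gamma>1 \<circ> \<sigma>3 \<circ> \<gamma>2"
      unfolding triple_equiv_def s_eq s'_eq sym_group_def by blast
    have s': "s' \<in> perm_triples n"
      unfolding s'_eq perm_triples_iff t by (intro conjI permutes_compose p g)
    \<comment> \<open>Multiplying \<open>\<tau>2\<close> or \<open>\<tau>3\<close> by the inverse of
      \<open>\<tau>1\<close> cancels \<open>\<gamma>2\<close>, which leaves conjugation by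
      \<open>\<gamma>1\<close>.\<close>
    have "inv \<tau>1 = inv \<gamma>2 \<circ> (inv \<sigma>1 \<circ> inv \<gamma>1)"
      unfolding t(1) using permutes_bij[OF p(1)] permutes_bij[OF g(1)] permutes_bij[OF g(2)]
      by (simp add: o_inv_distrib bij_comp)
    then have "\<gamma>1 (perm_pair s b x) = perm_pair s' b (\<gamma>1 x)" for b x
      by (simp add: perm_pair_def s_eq s'_eq t(2,3) permutes_inverses[OF g(1)] permutes_inverses[OF g(2)])
    then have "iso_map \<gamma>1 {1..n} (perm_pair s) {1..n} (perm_pair s')"
      unfolding iso_map_def using permutes_imp_bij[OF g(1)] by blast
    then have "triple_type n s = triple_type n s'"
      unfolding triple_type_def iso_type_eq_iff[OF perm_family_std_families[OF perm_pair_std_families[OF s]] perm_family_std_families[OF perm_pair_std_families[OF s']]] isom_def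
      by blast
    then show "s' \<in> perm_triples n \<and> triple_type n s = triple_type n s'" using s' by blast
  next
    assume a: "s' \<in> perm_triples n \<and> triple_type n s = triple_type n s'"
    then have s': "s' \<in> perm_triples n" by blast
    have t: "\<tau>1 permutes {1..n}" "\<tau>2 permutes {1..n}" "\<tau>3 permutes {1..n}"
      using s' unfolding s'_eq perm_triples_iff by blast+
    have "isom {1..n} (perm_pair s) {1..n} (perm_pair s')"
      using a unfolding triple_type_def iso_type_eq_iff[OF perm_family_std_families[OF perm_pair_std_families[OF s]] perm_family_std_families[OF perm_pair_std_families[OF s']]]
      by blast
    then obtain f where f: "iso_map f {1..n} (perm_pair s) {1..n} (perm_pair s')" by (auto simp: isom_def)
    define \<gamma>1 where "\<gamma>1 = (\<lambda>x. if x \<in> {1..n} then f x else x)"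
    have g1: "\<gamma>1 permutes {1..n}" unfolding \<gamma>1_def by (rule permutes_extend) (use f in \<open>simp add: iso_map_def\<close>)
    \<comment> \<open>The equation for the first components leaves no other choice.\<close>
    define \<gamma>2 where "\<gamma>2 = inv \<sigma>1 \<circ> inv \<gamma>1 \<circ> \<tau>1"
    have g2: "\<gamma>2 permutes {1..n}"
      unfolding \<gamma>2_def by (intro permutes_compose permutes_inv p g1 t)
    have comm: "\<gamma>1 (perm_pair s b x) = perm_pair s' b (\<gamma>1 x)" for b x
    proof (cases "x \<in> {1..n}")
      case True
      have "perm_pair s b x \<in> {1..n}" by (rule perm_familyD(3)[OF perm_family_std_families[OF perm_pair_std_families[OF s]] True])
      then show ?thesis using f True unfolding iso_map_def by (simp only: \<gamma>1_def if_True)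
    next
      case False
      have "perm_pair s b permutes {1..n}" "perm_pair s' b permutes {1..n}"
        using perm_pair_std_families[OF s] perm_pair_std_families[OF s'] by (simp_all add: std_families_def)
      then show ?thesis using permutes_not_in[OF _ False] g1 by metis
    qed
    have key: "\<gamma>1 \<circ> (if b then \<sigma>2 else \<sigma>3) \<circ> \<gamma>2 = (if b then \<tau>2 else \<tau>3)" for b
    proof
      fix x
      have "(\<gamma>1 \<circ> (if b then \<sigma>2 else \<sigma>3) \<circ> \<gamma>2) x = \<gamma>1 (perm_pair s b (inv \<gamma>1 (\<tau>1 x)))"
        by (simp add: perm_pair_def s_eq \<gamma>2_def)
      also have "\<dots> = perm_pair s' b (\<tau>1 x)" by (simp only: comm permutes_inverses(1)[OF g1])
      also have "\<dots> = (if b then \<tau>2 else \<tau>3) x" by (simp add: perm_pair_def s'_eq permutes_inverses(2)[OF t(1)])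
      finally show "(\<gamma>1 \<circ> (if b then \<sigma>2 else \<sigma>3) \<circ> \<gamma>2) x = (if b then \<tau>2 else \<tau>3) x" .
    qed
    have "\<tau>1 = \<gamma>1 \<circ> \<sigma>1 \<circ> \<gamma>2"
      by (simp add: fun_eq_iff \<gamma>2_def permutes_inverses(1)[OF p(1)] permutes_inverses(1)[OF g1])
    moreover have "\<tau>2 = \<gamma>1 \<circ> \<sigma>2 \<circ> \<gamma>2" "\<tau>3 = \<gamma>1 \<circ> \<sigma>3 \<circ> \<gamma>2" using key[of True] key[of False] by simp_all
    ultimately show "(s, s') \<in> triple_equiv n"
      using s g1 g2 unfolding triple_equiv_def s_eq s'_eq sym_group_def by blast
  qed
qed

text \<open>Membership of \<open>y\<close> is on the right-hand side, so the relation may live on a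
  larger set in which \<open>A\<close> is closed; connected graphs among all graphs are such a
  case.\<close>

lemma card_quotient_eq_card_image:
  assumes "\<And>x y. x \<in> A \<Longrightarrow> (x, y) \<in> r \<longleftrightarrow> y \<in> A \<and> f x = f y"
  shows "card (A // r) = card (f ` A)"
proof -
  have cls: "r `` {x} = {y \<in> A. f x = f y}" if "x \<in> A" for x
    using assms[OF that] by blast
  have "A // r = (\<lambda>x. r `` {x}) ` A" by (auto simp: quotient_def)
  also have "card \<dots> = card (f ` A)"
  proof (rule card_image_eq_if_kernel_eq)
    fix x y assume x: "x \<in> A" and y: "y \<in> A"
    show "r `` {x} = r `` {y} \<longleftrightarrow> f x = f y"
      unfolding cls[OF x] cls[OF y] using x y by auto
  qed
  finally show ?thesis .
qed

lemma triple_type_image: "triple_type n ` perm_triples n = iso_types n"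
  unfolding iso_types_def perm_pair_image[symmetric] by (simp add: triple_type_def image_image)

lemma Z3_eq_card_iso_types: "Z3 n = card (iso_types n :: (nat \<times> (bool \<Rightarrow> nat \<Rightarrow> nat) set) set)"
proof (cases "n = 0")
  case True
  \<comment> \<open>The convention for \<open>Z3 0\<close> agrees with the single empty system,
    counted by \<open>wsum 0 0 = 1\<close>.\<close>
  then show ?thesis unfolding card_iso_types_bool_eq_wsum by (simp add: Z3_def)
next
  case False
  then have "Z3 n = card (triple_type n ` perm_triples n)"
    unfolding Z3_def using card_quotient_eq_card_image[OF triple_equiv_iff] by simp
  then show ?thesis by (simp only: triple_type_image)
qed

lemma tensor_invariant_eq_iff:
  assumes nN: "n \<le> N" and s: "s \<in> perm_triples n" and t: "t \<in> perm_triples n"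
  shows "tensor_invariant N n s = tensor_invariant N n t \<longleftrightarrow> triple_type n s = triple_type n t"
proof -
  obtain \<sigma>1 \<sigma>2 \<sigma>3 where s_eq: "s = (\<sigma>1, \<sigma>2, \<sigma>3)" by (cases s) auto
  obtain \<tau>1 \<tau>2 \<tau>3 where t_eq: "t = (\<tau>1, \<tau>2, \<tau>3)" by (cases t) auto
  have p: "\<sigma>1 permutes {1..n}" "\<sigma>2 permutes {1..n}" "\<sigma>3 permutes {1..n}"
    using s unfolding s_eq perm_triples_iff by blast+
  have q: "\<tau>1 permutes {1..n}" "\<tau>2 permutes {1..n}" "\<tau>3 permutes {1..n}"
    using t unfolding t_eq perm_triples_iff by blast+
  show ?thesis
  proof
    assume eq: "tensor_invariant N n s = tensor_invariant N n t"
    obtain \<gamma>1 \<gamma>2 where "\<gamma>1 permutes {1..n}" "\<gamma>2 permutes {1..n}"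
        "\<tau>1 = \<gamma>1 \<circ> \<sigma>1 \<circ> \<gamma>2" "\<tau>2 = \<gamma>1 \<circ> \<sigma>2 \<circ> \<gamma>2" "\<tau>3 = \<gamma>1 \<circ> \<sigma>3 \<circ> \<gamma>2"
      by (rule equiv_if_tensor_invariant_eq[OF nN q p eq[unfolded s_eq t_eq, symmetric]])
    then have "(s, t) \<in> triple_equiv n"
      using s unfolding triple_equiv_def s_eq t_eq sym_group_def by blast
    then show "triple_type n s = triple_type n t" using triple_equiv_iff[OF s] by blast
  next
    assume "triple_type n s = triple_type n t"
    then have "(s, t) \<in> triple_equiv n" using triple_equiv_iff[OF s] t by blast
    then obtain \<gamma>1 \<gamma>2 where g: "\<gamma>1 permutes {1..n}" "\<gamma>2 permutes {1..n}"
        "\<tau>1 = \<gamma>1 \<circ> \<sigma>1 \<circ> \<gamma>2" "\<tau>2 = \<gamma>1 \<circ> \<sigma>2 \<circ> \<gamma>2" "\<tau>3 = \<gamma>1 \<circ> \<sigma>3 \<circ> \<gamma>2"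
      unfolding triple_equiv_def s_eq t_eq sym_group_def by blast
    show "tensor_invariant N n s = tensor_invariant N n t"
      unfolding s_eq t_eq g(3-5) by (rule tensor_invariant_cong_equiv[OF g(1,2), symmetric])
  qed
qed

lemma card_invariants: "n \<le> N \<Longrightarrow> card (invariants N n) = Z3 n"
  unfolding invariants_def Z3_eq_card_iso_types triple_type_image[symmetric]
  by (rule card_image_eq_if_kernel_eq[OF tensor_invariant_eq_iff])

text \<open>The vertices reachable from a given one form a closed set. This is the graph counterpart
  of \<open>transitive_iff_closed\<close>.\<close>

lemma rtrancl_on_all_iff_closed:
  assumes "R \<subseteq> V \<times> V"
  shows "(\<forall>u\<in>V. \<forall>v\<in>V. (u, v) \<in> rtrancl_on V R) \<longleftrightarrow>
    (\<forall>S\<subseteq>V. S \<noteq> {} \<longrightarrow> (\<forall>(u, v)\<in>R. u \<in> S \<longrightarrow> v \<in> S) \<longrightarrow> S = V)"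
proof (intro iffI allI impI ballI)
  fix S assume a: "\<forall>u\<in>V. \<forall>v\<in>V. (u, v) \<in> rtrancl_on V R" "S \<subseteq> V" "S \<noteq> {}" "\<forall>(u, v)\<in>R. u \<in> S \<longrightarrow> v \<in> S"
  obtain u where u: "u \<in> S" using a(3) by blast
  have "v \<in> S" if v: "v \<in> V" for v
  proof -
    have "(u, v) \<in> rtrancl_on V R" using a(1,2) u v by blast
    then show ?thesis by (induction rule: rtrancl_on_induct) (use u a(4) in blast)+
  qed
  then show "S = V" using a(2) by blast
next
  fix u v assume a: "\<forall>S\<subseteq>V. S \<noteq> {} \<longrightarrow> (\<forall>(u, v)\<in>R. u \<in> S \<longrightarrow> v \<in> S) \<longrightarrow> S = V" and u: "u \<in> V" and v: "v \<in> V"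
  define S where "S = {w \<in> V. (u, w) \<in> rtrancl_on V R}"
  have "u \<in> S" using u by (simp add: S_def)
  moreover have "\<forall>(w, w')\<in>R. w \<in> S \<longrightarrow> w' \<in> S"
    using assms by (auto simp: S_def intro: rtrancl_on_into_rtrancl_on)
  moreover have "S \<subseteq> V" by (auto simp: S_def)
  ultimately have "S = V" using a by blast
  then show "(u, v) \<in> rtrancl_on V R" using v by (auto simp: S_def)
qed

text \<open>Closed vertex sets correspond to closed sets \<open>W\<close> of white labels; the edges
  of colour 1 dictate which black vertices belong to them.\<close>

lemma graph_connected_triple_graph_iff:
  assumes s: "s \<in> perm_triples n"
  shows "graph_connected n (triple_graph n s) \<longleftrightarrow> transitive {1..n} (perm_pair s)"
proof -
  obtain \<sigma>1 \<sigma>2 \<sigma>3 where s_eq: "s = (\<sigma>1, \<sigma>2, \<sigma>3)" by (cases s) auto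
  have p: "\<sigma>1 permutes {1..n}" "\<sigma>2 permutes {1..n}" "\<sigma>3 permutes {1..n}"
    using s unfolding s_eq perm_triples_iff by blast+
  note im = permutes_in_image[OF p(1)] permutes_in_image[OF p(2)] permutes_in_image[OF p(3)]
  define V where "V = White ` {1..n} \<union> Black ` {1..n}"
  define R where "R = parcs (mk_symmetric (to_digraph n (triple_graph n s)))"
  have R: "R = (\<Union>j\<in>{1..n}. \<Union>\<sigma>\<in>{\<sigma>1, \<sigma>2, \<sigma>3}. {(White (\<sigma> j), Black j), (Black j, White (\<sigma> j))})"
    unfolding R_def mk_symmetric_def to_digraph_def triple_graph_def s_eq by auto
  have RV: "R \<subseteq> V \<times> V"
  proof -
    have "White (\<sigma> j) \<in> V" "Black j \<in> V" if "j \<in> {1..n}" "\<sigma> \<in> {\<sigma>1, \<sigma>2, \<sigma>3}" for j \<sigma>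
      using that im[of j] unfolding V_def by blast+
    then show ?thesis unfolding R by blast
  qed
  have V0: "V \<noteq> {} \<longleftrightarrow> {1..n} \<noteq> {}" unfolding V_def by blast
  have "graph_connected n (triple_graph n s) \<longleftrightarrow> V \<noteq> {} \<and> (\<forall>u\<in>V. \<forall>v\<in>V. (u, v) \<in> rtrancl_on V R)"
    unfolding graph_connected_def connected_def strongly_connected_def reachable_def R_def
    by (simp add: V_def to_digraph_def)
  also have "\<dots> \<longleftrightarrow> V \<noteq> {} \<and> (\<forall>S\<subseteq>V. S \<noteq> {} \<longrightarrow> (\<forall>(u, v)\<in>R. u \<in> S \<longrightarrow> v \<in> S) \<longrightarrow> S = V)"
    by (simp only: rtrancl_on_all_iff_closed[OF RV])
  also have "\<dots> \<longleftrightarrow> transitive {1..n} (perm_pair s)"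
    unfolding transitive_iff_closed[OF perm_family_std_families[OF perm_pair_std_families[OF s]]] V0
  proof (rule conj_cong[OF refl], rule iffI; intro allI impI)
    fix W assume cl: "\<forall>S\<subseteq>V. S \<noteq> {} \<longrightarrow> (\<forall>(u, v)\<in>R. u \<in> S \<longrightarrow> v \<in> S) \<longrightarrow> S = V"
      and W: "W \<subseteq> {1..n}" "W \<noteq> {}" "\<forall>b. \<forall>x\<in>{1..n}. x \<in> W \<longleftrightarrow> perm_pair s b x \<in> W"
    have eq: "\<sigma>2 j \<in> W \<longleftrightarrow> \<sigma>1 j \<in> W" "\<sigma>3 j \<in> W \<longleftrightarrow> \<sigma>1 j \<in> W" if j: "j \<in> {1..n}" for j
    proof -
      have "\<sigma>1 j \<in> {1..n}" using j im(1) by blast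
      then have "\<sigma>1 j \<in> W \<longleftrightarrow> perm_pair s b (\<sigma>1 j) \<in> W" for b using W(3) by blast
      from this[of True] this[of False] show "\<sigma>2 j \<in> W \<longleftrightarrow> \<sigma>1 j \<in> W" "\<sigma>3 j \<in> W \<longleftrightarrow> \<sigma>1 j \<in> W"
        by (simp_all add: perm_pair_def s_eq permutes_inverses(2)[OF p(1)])
    qed
    \<comment> \<open>A black vertex joins together with its neighbour of colour 1; closedness of
      \<open>W\<close> says that its neighbours of colours 2 and 3 are in \<open>W\<close> at the
      same time.\<close>
    define S where "S = White ` W \<union> Black ` {j \<in> {1..n}. \<sigma>1 j \<in> W}"
    have mem: "White w \<in> S \<longleftrightarrow> w \<in> W" "Black j \<in> S \<longleftrightarrow> j \<in> {1..n} \<and> \<sigma>1 j \<in> W" for w j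
      by (auto simp: S_def)
    have "\<forall>(u, v)\<in>R. u \<in> S \<longrightarrow> v \<in> S"
    proof (intro ballI, clarify)
      fix u v assume uv: "(u, v) \<in> R" "u \<in> S"
      then obtain j \<sigma> where j: "j \<in> {1..n}" and sg: "\<sigma> \<in> {\<sigma>1, \<sigma>2, \<sigma>3}"
        and c: "(u, v) = (White (\<sigma> j), Black j) \<or> (u, v) = (Black j, White (\<sigma> j))"
        unfolding R by blast
      have "\<sigma> j \<in> W \<longleftrightarrow> \<sigma>1 j \<in> W" using eq[OF j] sg by blast
      then show "v \<in> S" using c uv(2) j mem by (metis prod.inject)
    qed
    moreover have "S \<subseteq> V" using W(1) by (auto simp: S_def V_def)
    moreover have "S \<noteq> {}" using W(2) by (auto simp: S_def)
    ultimately have "S = V" using cl by blast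
    then have "White w \<in> S" if "w \<in> {1..n}" for w using that unfolding V_def by blast
    then show "W = {1..n}" using W(1) mem(1) by blast
  next
    fix S assume cl: "\<forall>W\<subseteq>{1..n}. W \<noteq> {} \<longrightarrow> (\<forall>b. \<forall>x\<in>{1..n}. x \<in> W \<longleftrightarrow> perm_pair s b x \<in> W) \<longrightarrow> W = {1..n}"
      and S: "S \<subseteq> V" "S \<noteq> {}" "\<forall>(u, v)\<in>R. u \<in> S \<longrightarrow> v \<in> S"
    have eq: "White (\<sigma> j) \<in> S \<longleftrightarrow> Black j \<in> S" if "j \<in> {1..n}" "\<sigma> \<in> {\<sigma>1, \<sigma>2, \<sigma>3}" for j \<sigma>
    proof -
      have "(White (\<sigma> j), Black j) \<in> R" "(Black j, White (\<sigma> j)) \<in> R" unfolding R using that by blast+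
      then show ?thesis using S(3) by blast
    qed
    define W where "W = {w \<in> {1..n}. White w \<in> S}"
    have WS: "W \<subseteq> {1..n}" by (auto simp: W_def)
    have Wc: "\<forall>b. \<forall>x\<in>{1..n}. x \<in> W \<longleftrightarrow> perm_pair s b x \<in> W"
    proof (intro allI ballI)
      fix b x assume x: "x \<in> {1..n}"
      \<comment> \<open>One step of the pair is a path of two edges: from the white vertex
        \<open>x\<close> along colour 1 to the black vertex \<open>j\<close>, then along colour 2 or
        3 to a white vertex.\<close>
      define j where "j = inv \<sigma>1 x"
      define \<sigma> where "\<sigma> = (if b then \<sigma>2 else \<sigma>3)"
      have j: "j \<in> {1..n}" unfolding j_def using x by (simp only: permutes_in_image[OF permutes_inv[OF p(1)]])
      have xj: "x = \<sigma>1 j" by (simp add: j_def permutes_inverses(1)[OF p(1)])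
      have sg: "\<sigma> \<in> {\<sigma>1, \<sigma>2, \<sigma>3}" by (simp add: \<sigma>_def)
      have in_n: "\<sigma> j \<in> {1..n}" using j im[of j] sg by blast
      have "perm_pair s b x = \<sigma> j" by (simp add: perm_pair_def s_eq \<sigma>_def j_def)
      moreover have "White x \<in> S \<longleftrightarrow> White (\<sigma> j) \<in> S" using eq[OF j, of \<sigma>1] eq[OF j sg] xj by simp
      ultimately show "x \<in> W \<longleftrightarrow> perm_pair s b x \<in> W" using x in_n unfolding W_def by simp
    qed
    have "W \<noteq> {}"
    proof -
      obtain v where v: "v \<in> S" using S(2) by blast
      then have "v \<in> White ` {1..n} \<union> Black ` {1..n}" using S(1) unfolding V_def by (rule rev_subsetD)
      then show ?thesis
      proof (elim UnE imageE)
        fix w assume "v = White w" "w \<in> {1..n}"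
        then have "w \<in> W" using v by (simp only: W_def mem_Collect_eq simp_thms)
        then show ?thesis by blast
      next
        fix j assume j: "v = Black j" "j \<in> {1..n}"
        then have "White (\<sigma>1 j) \<in> S" using eq[of j \<sigma>1] v by simp
        moreover have "\<sigma>1 j \<in> {1..n}" using j(2) by (simp only: im(1))
        ultimately have "\<sigma>1 j \<in> W" by (simp only: W_def mem_Collect_eq simp_thms)
        then show ?thesis by blast
      qed
    qed
    then have W: "W = {1..n}" by (rule cl[THEN spec, THEN mp, THEN mp, THEN mp, OF WS _ Wc])
    have "Black j \<in> S" if j: "j \<in> {1..n}" for j
    proof -
      have "\<sigma>1 j \<in> W" using j im(1)[of j] unfolding W by blast
      then show ?thesis using eq[OF j, of \<sigma>1] unfolding W_def by simp
    qed
    moreover have "White w \<in> S" if "w \<in> {1..n}" for w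
    proof -
      have "w \<in> W" using that by (simp only: W)
      then show ?thesis by (simp only: W_def mem_Collect_eq)
    qed
    ultimately have "V \<subseteq> S" unfolding V_def by blast
    then show "S = V" using S(1) by (rule equalityI[rotated])
  qed
  finally show ?thesis .
qed

section \<open>Coloured graphs and their relabellings as triples\<close>

lemma triple_graph_iff:
  "(a, w, b) \<in> triple_graph n (\<sigma>1, \<sigma>2, \<sigma>3) \<longleftrightarrow>
    b \<in> {1..n} \<and> (a = 1 \<and> w = \<sigma>1 b \<or> a = 2 \<and> w = \<sigma>2 b \<or> a = 3 \<and> w = \<sigma>3 b)"
  unfolding triple_graph_def prod.case by auto

lemma inj_on_triple_graph: "inj_on (triple_graph n) (perm_triples n)"
proof (rule inj_onI)
  fix s t assume s: "s \<in> perm_triples n" and t: "t \<in> perm_triples n" and eq: "triple_graph n s = triple_graph n t"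
  obtain \<sigma>1 \<sigma>2 \<sigma>3 where s_eq: "s = (\<sigma>1, \<sigma>2, \<sigma>3)" by (cases s) auto
  obtain \<tau>1 \<tau>2 \<tau>3 where t_eq: "t = (\<tau>1, \<tau>2, \<tau>3)" by (cases t) auto
  have p: "\<sigma>1 permutes {1..n}" "\<sigma>2 permutes {1..n}" "\<sigma>3 permutes {1..n}"
    using s unfolding s_eq perm_triples_iff by blast+
  have q: "\<tau>1 permutes {1..n}" "\<tau>2 permutes {1..n}" "\<tau>3 permutes {1..n}"
    using t unfolding t_eq perm_triples_iff by blast+
  have E: "(a, w, b) \<in> triple_graph n (\<sigma>1, \<sigma>2, \<sigma>3) \<longleftrightarrow> (a, w, b) \<in> triple_graph n (\<tau>1, \<tau>2, \<tau>3)" for a w b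
    using eq unfolding s_eq t_eq by simp
  have "\<sigma>1 b = \<tau>1 b \<and> \<sigma>2 b = \<tau>2 b \<and> \<sigma>3 b = \<tau>3 b" for b
  proof (cases "b \<in> {1..n}")
    case True
    then show ?thesis
      using E[of 1 "\<sigma>1 b" b] E[of 2 "\<sigma>2 b" b] E[of 3 "\<sigma>3 b" b] unfolding triple_graph_iff by simp
  next
    case False
    then show ?thesis
      using permutes_not_in[OF p(1) False] permutes_not_in[OF p(2) False] permutes_not_in[OF p(3) False]
        permutes_not_in[OF q(1) False] permutes_not_in[OF q(2) False] permutes_not_in[OF q(3) False] by simp
  qed
  then show "s = t" unfolding s_eq t_eq by (simp add: fun_eq_iff)
qed

text \<open>Each colour is a perfect matching: unique white ends make it a function of the black
  label, and unique black ends make this function bijective.\<close>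

lemma colored_graphs_eq: "colored_graphs n = triple_graph n ` perm_triples n"
proof (intro equalityI subsetI)
  fix E assume "E \<in> triple_graph n ` perm_triples n"
  then obtain \<sigma>1 \<sigma>2 \<sigma>3 where E: "E = triple_graph n (\<sigma>1, \<sigma>2, \<sigma>3)" and "(\<sigma>1, \<sigma>2, \<sigma>3) \<in> perm_triples n"
    by auto
  then have p: "\<sigma>1 permutes {1..n}" "\<sigma>2 permutes {1..n}" "\<sigma>3 permutes {1..n}"
    unfolding perm_triples_iff by blast+
  define \<sigma> where "\<sigma> a = (if a = 1 then \<sigma>1 else if a = 2 then \<sigma>2 else \<sigma>3)" for a :: nat
  have ps: "\<sigma> a permutes {1..n}" for a using p by (simp add: \<sigma>_def)
  have three: "a \<in> {1..3} \<longleftrightarrow> a = 1 \<or> a = 2 \<or> a = 3" for a :: nat by auto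
  have mem: "(a, w, b) \<in> E \<longleftrightarrow> a \<in> {1..3} \<and> b \<in> {1..n} \<and> w = \<sigma> a b" for a w b
    unfolding E triple_graph_iff three \<sigma>_def by (cases "a = 1"; cases "a = 2"; cases "a = 3") simp_all
  have sub: "E \<subseteq> {1..3} \<times> {1..n} \<times> {1..n}"
  proof
    fix x assume x: "x \<in> E"
    obtain a w b where abc: "x = (a, w, b)" by (cases x) auto
    have a: "a \<in> {1..3} \<and> b \<in> {1..n} \<and> w = \<sigma> a b" using x unfolding abc mem .
    then have "w \<in> {1..n}" by (simp only: permutes_in_image[OF ps])
    then show "x \<in> {1..3} \<times> {1..n} \<times> {1..n}" using a unfolding abc by blast
  qed
  have b1: "\<exists>!b. (a, w, b) \<in> E" if a: "a \<in> {1..3}" and w: "w \<in> {1..n}" for a w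
  proof (rule ex1I[of _ "inv (\<sigma> a) w"])
    have "inv (\<sigma> a) w \<in> {1..n}" using w by (simp only: permutes_in_image[OF permutes_inv[OF ps]])
    then show "(a, w, inv (\<sigma> a) w) \<in> E" using a unfolding mem by (simp add: permutes_inverses(1)[OF ps])
    show "b = inv (\<sigma> a) w" if "(a, w, b) \<in> E" for b
      using that unfolding mem by (simp add: permutes_inverses(2)[OF ps])
  qed
  have w1: "\<exists>!w. (a, w, b) \<in> E" if ab: "a \<in> {1..3}" "b \<in> {1..n}" for a b
  proof (rule ex1I[of _ "\<sigma> a b"])
    show "(a, \<sigma> a b, b) \<in> E" using ab unfolding mem by blast
    show "w = \<sigma> a b" if "(a, w, b) \<in> E" for w using that unfolding mem by blast
  qed
  show "E \<in> colored_graphs n"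
    unfolding colored_graphs_def mem_Collect_eq by (intro conjI ballI sub b1 w1)
next
  fix E assume "E \<in> colored_graphs n"
  then have sub: "E \<subseteq> {1..3} \<times> {1..n} \<times> {1..n}"
    and b1: "\<And>a w. a \<in> {1..3} \<Longrightarrow> w \<in> {1..n} \<Longrightarrow> \<exists>!b. (a, w, b) \<in> E"
    and w1: "\<And>a b. a \<in> {1..3} \<Longrightarrow> b \<in> {1..n} \<Longrightarrow> \<exists>!w. (a, w, b) \<in> E"
    unfolding colored_graphs_def by blast+
  define \<sigma> where "\<sigma> a b = (if b \<in> {1..n} then THE w. (a, w, b) \<in> E else b)" for a b
  have mem: "(a, w, b) \<in> E \<longleftrightarrow> a \<in> {1..3} \<and> b \<in> {1..n} \<and> w = \<sigma> a b" for a w b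
  proof
    assume E: "(a, w, b) \<in> E"
    then have ab: "a \<in> {1..3}" "b \<in> {1..n}" using sub by blast+
    have "(THE w. (a, w, b) \<in> E) = w" by (rule the1_equality[OF w1[OF ab] E])
    then show "a \<in> {1..3} \<and> b \<in> {1..n} \<and> w = \<sigma> a b" using ab by (simp only: \<sigma>_def if_True simp_thms)
  next
    assume a: "a \<in> {1..3} \<and> b \<in> {1..n} \<and> w = \<sigma> a b"
    then have "w = (THE w. (a, w, b) \<in> E)" by (simp only: \<sigma>_def if_True)
    then show "(a, w, b) \<in> E" using theI'[OF w1[of a b]] a by blast
  qed
  have perm: "\<sigma> a permutes {1..n}" if a: "a \<in> {1..3}" for a
  proof (rule bij_imp_permutes)
    have in_n: "\<sigma> a b \<in> {1..n}" if b: "b \<in> {1..n}" for b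
    proof -
      have "(a, \<sigma> a b, b) \<in> E" using mem a b by blast
      then show ?thesis using sub by blast
    qed
    show "bij_betw (\<sigma> a) {1..n} {1..n}"
    proof (rule bij_betw_imageI)
      show "inj_on (\<sigma> a) {1..n}"
      proof (rule inj_onI)
        fix b b' assume b: "b \<in> {1..n}" "b' \<in> {1..n}" "\<sigma> a b = \<sigma> a b'"
        then have "(a, \<sigma> a b, b) \<in> E" "(a, \<sigma> a b, b') \<in> E" using mem a by blast+
        then show "b = b'" using b1[OF a in_n[OF b(1)]] by blast
      qed
      show "\<sigma> a ` {1..n} = {1..n}"
      proof (intro equalityI subsetI)
        fix w assume "w \<in> {1..n}"
        then obtain b where "(a, w, b) \<in> E" using b1[OF a] by blast
        then show "w \<in> \<sigma> a ` {1..n}" using mem by blast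
      qed (use in_n in blast)
    qed
    show "\<sigma> a x = x" if "x \<notin> {1..n}" for x using that by (simp only: \<sigma>_def if_False)
  qed
  have "(\<sigma> 1, \<sigma> 2, \<sigma> 3) \<in> perm_triples n" using perm by (simp add: perm_triples_iff)
  moreover have "E = triple_graph n (\<sigma> 1, \<sigma> 2, \<sigma> 3)"
  proof (rule set_eqI)
    fix x :: colored_edge
    obtain a w b where x: "x = (a, w, b)" by (cases x) auto
    have three: "a \<in> {1..3} \<longleftrightarrow> a = 1 \<or> a = 2 \<or> a = 3" by auto
    show "x \<in> E \<longleftrightarrow> x \<in> triple_graph n (\<sigma> 1, \<sigma> 2, \<sigma> 3)"
      unfolding x mem triple_graph_iff three by blast
  qed
  ultimately show "E \<in> triple_graph n ` perm_triples n" by blast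
qed

text \<open>The edge at black vertex \<open>j\<close> moves to \<open>\<beta> j\<close>, so the
  white end at a new label is read off at its preimage; relabelling black vertices acts on the right
  by an inverse.\<close>

lemma relabelled_triple_graph:
  assumes b: "\<beta> permutes {1..n}"
  shows "(\<lambda>(a, w, b). (a, \<alpha> w, \<beta> b)) ` triple_graph n (\<sigma>1, \<sigma>2, \<sigma>3) =
    triple_graph n (\<alpha> \<circ> \<sigma>1 \<circ> inv \<beta>, \<alpha> \<circ> \<sigma>2 \<circ> inv \<beta>, \<alpha> \<circ> \<sigma>3 \<circ> inv \<beta>)"
proof -
  have "(\<lambda>(a, w, b). (a, \<alpha> w, \<beta> b)) ` triple_graph n (\<sigma>1, \<sigma>2, \<sigma>3) =
      (\<Union>j\<in>{1..n}. {(1, \<alpha> (\<sigma>1 j), \<beta> j), (2, \<alpha> (\<sigma>2 j), \<beta> j), (3, \<alpha> (\<sigma>3 j), \<beta> j)})"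
    unfolding triple_graph_def by (simp add: image_UN)
  also have "\<dots> = (\<Union>j\<in>\<beta> ` {1..n}. {(1, \<alpha> (\<sigma>1 (inv \<beta> j)), j), (2, \<alpha> (\<sigma>2 (inv \<beta> j)), j), (3, \<alpha> (\<sigma>3 (inv \<beta> j)), j)})"
    by (simp add: permutes_inverses(2)[OF b])
  finally show ?thesis unfolding permutes_image[OF b] triple_graph_def by simp
qed

lemma graph_relabelling_iff:
  assumes s: "s \<in> perm_triples n"
  shows "(triple_graph n s, E) \<in> graph_relabelling n \<longleftrightarrow> (\<exists>t. (s, t) \<in> triple_equiv n \<and> E = triple_graph n t)"
proof -
  obtain \<sigma>1 \<sigma>2 \<sigma>3 where s_eq: "s = (\<sigma>1, \<sigma>2, \<sigma>3)" by (cases s) auto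
  show ?thesis
  proof
    assume "(triple_graph n s, E) \<in> graph_relabelling n"
    then obtain \<alpha> \<beta> where ab: "\<alpha> permutes {1..n}" "\<beta> permutes {1..n}"
      and E: "E = (\<lambda>(a, w, b). (a, \<alpha> w, \<beta> b)) ` triple_graph n s"
      unfolding graph_relabelling_def sym_group_def by blast
    have "(s, (\<alpha> \<circ> \<sigma>1 \<circ> inv \<beta>, \<alpha> \<circ> \<sigma>2 \<circ> inv \<beta>, \<alpha> \<circ> \<sigma>3 \<circ> inv \<beta>)) \<in> triple_equiv n"
      using s ab(1) permutes_inv[OF ab(2)] unfolding triple_equiv_def s_eq sym_group_def by blast
    then show "\<exists>t. (s, t) \<in> triple_equiv n \<and> E = triple_graph n t"
      unfolding E s_eq relabelled_triple_graph[OF ab(2)] by blast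
  next
    assume "\<exists>t. (s, t) \<in> triple_equiv n \<and> E = triple_graph n t"
    then obtain \<gamma>1 \<gamma>2 where g: "\<gamma>1 permutes {1..n}" "\<gamma>2 permutes {1..n}"
      and E: "E = triple_graph n (\<gamma>1 \<circ> \<sigma>1 \<circ> \<gamma>2, \<gamma>1 \<circ> \<sigma>2 \<circ> \<gamma>2, \<gamma>1 \<circ> \<sigma>3 \<circ> \<gamma>2)"
      unfolding triple_equiv_def s_eq sym_group_def by blast
    have "E = (\<lambda>(a, w, b). (a, \<gamma>1 w, inv \<gamma>2 b)) ` triple_graph n s"
      unfolding E s_eq relabelled_triple_graph[OF permutes_inv[OF g(2)]] inv_inv_eq[OF permutes_bij[OF g(2)]] ..
    moreover have "triple_graph n s \<in> colored_graphs n" unfolding colored_graphs_eq using s by blast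
    ultimately show "(triple_graph n s, E) \<in> graph_relabelling n"
      using g(1) permutes_inv[OF g(2)] unfolding graph_relabelling_def sym_group_def by blast
  qed
qed

definition transitive_triples :: "nat \<Rightarrow> perm_triple set" where
  "transitive_triples n = {s \<in> perm_triples n. transitive {1..n} (perm_pair s)}"

lemma transitive_triples_eq: "{s \<in> perm_triples n. graph_connected n (triple_graph n s)} = transitive_triples n"
  unfolding transitive_triples_def using graph_connected_triple_graph_iff by blast

lemma triple_type_transitive_image: "triple_type n ` transitive_triples n = transitive_types n"
proof -
  have "perm_pair ` transitive_triples n = {\<sigma> \<in> std_families n. transitive {1..n} \<sigma>}"
    unfolding transitive_triples_def perm_pair_image[symmetric] by blast
  then have "transitive_types n = iso_type {1..n} ` perm_pair ` transitive_triples n" by (simp add: transitive_types_def)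
  then show ?thesis by (simp add: triple_type_def image_image)
qed

lemma transitive_triples_if_triple_type_eq:
  assumes s: "s \<in> transitive_triples n" and t: "t \<in> perm_triples n" and eq: "triple_type n s = triple_type n t"
  shows "t \<in> transitive_triples n"
proof -
  have s': "s \<in> perm_triples n" "transitive {1..n} (perm_pair s)" using s by (auto simp: transitive_triples_def)
  have "isom {1..n} (perm_pair s) {1..n} (perm_pair t)"
    using eq unfolding triple_type_def iso_type_eq_iff[OF perm_family_std_families[OF perm_pair_std_families[OF s'(1)]] perm_family_std_families[OF perm_pair_std_families[OF t]]] .
  then have "transitive {1..n} (perm_pair t)" using transitive_iso_map[OF s'(2)] unfolding isom_def by blast
  then show ?thesis using t by (simp add: transitive_triples_def)
qed

lemma num_connected_graphs_eq:
  "num_connected_graphs n = card (transitive_types n :: (nat \<times> (bool \<Rightarrow> nat \<Rightarrow> nat) set) set)"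
proof -
  define A where "A = triple_graph n ` transitive_triples n"
  \<comment> \<open>A graph determines its triple, since \<open>triple_graph\<close> is injective on
    permutation triples; the type of the decoded triple classifies the graph up to
    relabelling.\<close>
  define f where "f E = triple_type n (inv_into (perm_triples n) (triple_graph n) E)" for E
  have f: "f (triple_graph n s) = triple_type n s" if "s \<in> perm_triples n" for s
    using inv_into_f_f[OF inj_on_triple_graph that] by (simp add: f_def)
  have CP: "transitive_triples n \<subseteq> perm_triples n" by (auto simp: transitive_triples_def)
  have "{E \<in> colored_graphs n. graph_connected n E} = A"
    unfolding colored_graphs_eq A_def transitive_triples_eq[symmetric] by blast
  then have "num_connected_graphs n = card (A // graph_relabelling n)" by (simp add: num_connected_graphs_def)
  also have "\<dots> = card (f ` A)"
  proof (rule card_quotient_eq_card_image)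
    fix E E' assume "E \<in> A"
    then obtain s where s: "s \<in> transitive_triples n" "E = triple_graph n s" by (auto simp: A_def)
    have sp: "s \<in> perm_triples n" using s(1) CP by blast
    show "(E, E') \<in> graph_relabelling n \<longleftrightarrow> E' \<in> A \<and> f E = f E'"
    proof
      assume "(E, E') \<in> graph_relabelling n"
      then obtain t where t: "(s, t) \<in> triple_equiv n" "E' = triple_graph n t"
        unfolding s(2) graph_relabelling_iff[OF sp] by blast
      then have tp: "t \<in> perm_triples n" "triple_type n s = triple_type n t"
        using triple_equiv_iff[OF sp] by blast+
      then have "t \<in> transitive_triples n" using transitive_triples_if_triple_type_eq[OF s(1)] by blast
      then show "E' \<in> A \<and> f E = f E'" using f[OF sp] f[OF tp(1)] tp(2) s(2) t(2) by (simp add: A_def)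
    next
      assume a: "E' \<in> A \<and> f E = f E'"
      then obtain t where t: "t \<in> transitive_triples n" "E' = triple_graph n t" by (auto simp: A_def)
      have tp: "t \<in> perm_triples n" using t(1) CP by blast
      have "(s, t) \<in> triple_equiv n"
        unfolding triple_equiv_iff[OF sp] using a f[OF sp] f[OF tp] s(2) t(2) tp by simp
      then show "(E, E') \<in> graph_relabelling n"
        unfolding s(2) graph_relabelling_iff[OF sp] using t(2) by blast
    qed
  qed
  also have "f ` A = triple_type n ` transitive_triples n"
    unfolding A_def image_image using f CP by (intro image_cong) auto
  finally show ?thesis by (simp only: triple_type_transitive_image)
qed

lemma card_connected_invariants:
  assumes "n \<le> N"
  shows "card (connected_invariants N n) = num_connected_graphs n"
proof -
  have "card (tensor_invariant N n ` transitive_triples n) = card (triple_type n ` transitive_triples n)"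
    by (rule card_image_eq_if_kernel_eq[OF tensor_invariant_eq_iff[OF assms]]) (auto simp: transitive_triples_def)
  then show ?thesis
    by (simp only: connected_invariants_def transitive_triples_eq triple_type_transitive_image num_connected_graphs_eq)
qed

section \<open>Coefficients of the plethystic logarithm and their values\<close>

lemma Z3_recursion:
  "n * Z3 n = (\<Sum>k=1..n. (\<Sum>d | d dvd k. d * num_connected_graphs d) * Z3 (n - k))"
  unfolding Z3_eq_card_iso_types num_connected_graphs_eq by (rule iso_types_recursion)

text \<open>The exclusion of the empty graph matches the vanishing constant term of the plethystic
  logarithm.\<close>

lemma num_connected_graphs_0: "num_connected_graphs 0 = 0"
proof -
  have "transitive_triples 0 = {}" by (simp add: transitive_triples_def transitive_def)
  then show ?thesis using triple_type_transitive_image[of 0] by (simp add: num_connected_graphs_eq)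
qed

lemma Plog_Z3_series_nth: "fps_nth (Plog Z3_series) n = of_nat (num_connected_graphs n)"
proof -
  have "fps_nth (Plog Z3_series) n = (if n = 0 then 0 else of_nat (num_connected_graphs n))"
    unfolding Z3_series_def by (rule Plog_nth[OF _ Z3_recursion]) (simp add: Z3_def)
  then show ?thesis by (simp add: num_connected_graphs_0)
qed

lemma sum_divisors:
  fixes f :: "nat \<Rightarrow> nat"
  assumes "0 < n"
  shows "(\<Sum>d | d dvd n. f d) = (\<Sum>d=1..n. if d dvd n then f d else 0)"
proof -
  have "{d. d dvd n} = {d \<in> {1..n}. d dvd n}" using assms by (auto dest: dvd_imp_le intro: Nat.gr0I)
  then show ?thesis by (simp only: sum.inter_filter[OF finite_atLeastAtMost])
qed

lemma num_connected_graphs_values: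
  "num_connected_graphs 1 = 1" "num_connected_graphs 2 = 3" "num_connected_graphs 3 = 7"
  "num_connected_graphs 4 = 26" "num_connected_graphs 5 = 97" "num_connected_graphs 6 = 624"
  "num_connected_graphs 7 = 4163"
proof -
  define c where "c = num_connected_graphs"
  have Z: "Z3 0 = 1" "Z3 1 = 1" "Z3 2 = 4" "Z3 3 = 11" "Z3 4 = 43" "Z3 5 = 161" "Z3 6 = 901" "Z3 7 = 5579"
    unfolding Z3_eq_card_iso_types card_iso_types_bool_eq_wsum using wsum_values by simp_all
  have S: "(\<Sum>k=1..1. f k) = f 1" "(\<Sum>k=1..2. f k) = f 1 + f 2" "(\<Sum>k=1..3. f k) = f 1 + f 2 + f 3"
    "(\<Sum>k=1..4. f k) = f 1 + f 2 + f 3 + f 4" "(\<Sum>k=1..5. f k) = f 1 + f 2 + f 3 + f 4 + f 5"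
    "(\<Sum>k=1..6. f k) = f 1 + f 2 + f 3 + f 4 + f 5 + f 6"
    "(\<Sum>k=1..7. f k) = f 1 + f 2 + f 3 + f 4 + f 5 + f 6 + f 7" for f :: "nat \<Rightarrow> nat"
    by (simp_all add: eval_nat_numeral)
  have D: "(\<Sum>d | d dvd 1. d * c d) = c 1" "(\<Sum>d | d dvd 2. d * c d) = c 1 + 2 * c 2"
    "(\<Sum>d | d dvd 3. d * c d) = c 1 + 3 * c 3" "(\<Sum>d | d dvd 4. d * c d) = c 1 + 2 * c 2 + 4 * c 4"
    "(\<Sum>d | d dvd 5. d * c d) = c 1 + 5 * c 5"
    "(\<Sum>d | d dvd 6. d * c d) = c 1 + 2 * c 2 + 3 * c 3 + 6 * c 6"
    "(\<Sum>d | d dvd 7. d * c d) = c 1 + 7 * c 7"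
    unfolding sum_divisors[OF zero_less_one] sum_divisors[OF zero_less_numeral] S by simp_all
  note rec = Z3_recursion[folded c_def]
  \<comment> \<open>In the recursion at \<open>n\<close> the unknown \<open>c n\<close> occurs only
    in the term \<open>k = n\<close>, with factor \<open>n * Z3 0\<close>, so the values are solved
    for one after another.\<close>
  have c1: "c 1 = 1" using rec[of 1] unfolding S D by (simp add: Z[unfolded One_nat_def])
  have c2: "c 2 = 3" using rec[of 2] unfolding S D c1 by (simp add: Z[unfolded One_nat_def])
  have c3: "c 3 = 7" using rec[of 3] unfolding S D c1 c2 by (simp add: Z[unfolded One_nat_def])
  have c4: "c 4 = 26" using rec[of 4] unfolding S D c1 c2 c3 by (simp add: Z[unfolded One_nat_def])
  have c5: "c 5 = 97" using rec[of 5] unfolding S D c1 c2 c3 c4 by (simp add: Z[unfolded One_nat_def])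
  have c6: "c 6 = 624" using rec[of 6] unfolding S D c1 c2 c3 c4 c5 by (simp add: Z[unfolded One_nat_def])
  have c7: "c 7 = 4163" using rec[of 7] unfolding S D c1 c2 c3 c4 c5 c6 by (simp add: Z[unfolded One_nat_def])
  show "num_connected_graphs 1 = 1" "num_connected_graphs 2 = 3" "num_connected_graphs 3 = 7"
    "num_connected_graphs 4 = 26" "num_connected_graphs 5 = 97" "num_connected_graphs 6 = 624"
    "num_connected_graphs 7 = 4163"
    using c1 c2 c3 c4 c5 c6 c7 unfolding c_def by simp_all
qed

theorem mainTheorem2:
  shows "(\<forall>n N. 1 \<le> n \<and> n < N \<longrightarrow> Z3 n = card (invariants N n))
    \<and> (\<forall>n. fps_nth (Plog Z3_series) n = of_nat (num_connected_graphs n))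
    \<and> (\<forall>n N. n < N \<longrightarrow> fps_nth (Plog Z3_series) n = of_nat (card (connected_invariants N n)))
    \<and> map (fps_nth (Plog Z3_series)) [0..<8] = [0, 1, 3, 7, 26, 97, 624, 4163]"
proof (intro conjI allI impI)
  show "Z3 n = card (invariants N n)" if "1 \<le> n \<and> n < N" for n N
    using that by (simp add: card_invariants)
  show "fps_nth (Plog Z3_series) n = of_nat (num_connected_graphs n)" for n
    by (rule Plog_Z3_series_nth)
  show "fps_nth (Plog Z3_series) n = of_nat (card (connected_invariants N n))" if "n < N" for n N
    using that by (simp add: Plog_Z3_series_nth card_connected_invariants)
  have "[0..<8] = [0, 1, 2, 3, 4, 5, 6, 7::nat]" by (simp add: upt_rec)
  then show "map (fps_nth (Plog Z3_series)) [0..<8] = [0, 1, 3, 7, 26, 97, 624, 4163]"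
    by (simp add: Plog_Z3_series_nth num_connected_graphs_0 num_connected_graphs_values[simplified])
qed

end
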